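(* Let $(W,H,\mu)$ be an abstract Wiener space. Let $a,b,c$ be measurable, positive functions on $W$ such that, for given $s,t\in[0,1]$ with $s+t=1$ and for any $h,k\in H$, we have $$a(w+sh+tk)\exp\left(-\tfrac12|sh+tk|_H^2\right)\ge\left(b(w+h)e^{-\frac12|h|_H^2}\right)^s\left(c(w+k)e^{-\frac12|k|_H^2}\right)^t$$ for $\mu$-almost every $w$. Let also $q$ be any $H$-log-concave density and denote by $\nu$ the measure $d\nu=q\,d\mu$. Then $$\int a\,d\nu\ge\left(\int b\,d\nu\right)^s\left(\int c\,d\nu\right)^t .$$
   Context: An abstract Wiener space $(W,H,\mu)$: $W$ is a separable Fréchet space, $H\subset W$ a separable Hilbert space densely and continuously injected (the Cameron-Martin space), $\mu$ the standard Gaussian measure on $W$, i.e. $\int e^{i\langle l,w\rangle}d\mu(w)=e^{-\frac12|l|_H^2}$ for $l\in W^\star\subset H^\star= H$; it is quasi-invariant under translations by elements of $H$. "Positive" means nonnegative. A density $q:W\to[0,\infty)$ (measurable, $\int q\,d\mu=1$) is $H$-log-concave if for any $h,k\in H$ and $s,t\ge0$ with $s+t=1$, $q(w+sh+tk)\ge q(w+h)^s q(w+k)^t$ for $\mu$-almost every $w$. Conventions: $0^0=\infty^0=1$, $0\cdot\infty=0$. *)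

theory Defs
  imports "HOL-Probability.Probability"
begin

text \<open>
  A Frechet space is a locally convex topological vector space whose topology comes from a complete
  translation-invariant metric; such a metric is taken as the \<^term>\<open>dist\<close> of the type.
  Continuity of addition follows from translation invariance.
\<close>

definition frechet_space :: "'w::{real_vector, complete_space} itself \<Rightarrow> bool" where
  "frechet_space TYPE('w) \<longleftrightarrow>
     (\<forall>x y z :: 'w. dist (x + z) (y + z) = dist x y) \<and>
     continuous_on UNIV (\<lambda>(r::real, x::'w). r *\<^sub>R x) \<and>
     (\<forall>U :: 'w set. open U \<longrightarrow> 0 \<in> U \<longrightarrow> (\<exists>V. open V \<and> convex V \<and> 0 \<in> V \<and> V \<subseteq> U))"

text \<open>
  The inclusion of the Cameron-Martin space \<open>H\<close> into \<open>W\<close> is the map \<open>j\<close>. A functional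
  \<open>l \<in> W\<^sup>\<star>\<close> is regarded as the element \<open>l \<circ> j\<close> of \<open>H\<^sup>\<star> = H\<close>, so that \<open>|l|\<^sub>H\<close> is the
  operator norm of \<open>l \<circ> j\<close>.
\<close>

locale abstract_wiener_space = prob_space \<mu>
  for j :: "'h::{real_inner, polish_space} \<Rightarrow> 'w::{real_vector, polish_space}"
    and \<mu> :: "'w measure" +
  assumes frechet: "frechet_space TYPE('w)"
    and sets_eq_borel: "sets \<mu> = sets borel"
    and linear_inclusion: "linear j"
    and inj_inclusion: "inj j"
    and continuous_inclusion: "continuous_on UNIV j"
    and dense_inclusion: "closure (range j) = UNIV"
    and gaussian: "\<And>l :: 'w \<Rightarrow> real. linear l \<Longrightarrow> continuous_on UNIV l \<Longrightarrow>
      (CLINT w|\<mu>. iexp (l w)) = complex_of_real (exp (- (1/2) * (onorm (l \<circ> j))\<^sup>2))"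

text \<open>
  Powers on \<open>[0, \<infinity>]\<close> with exponent in \<open>[0, \<infinity>)\<close> and \<open>0\<^sup>0 = \<infinity>\<^sup>0 = 1\<close>, whereas
  \<^term>\<open>(0::real) powr 0 = 0\<close>. Multiplication on \<^typ>\<open>ennreal\<close> already satisfies \<open>0 \<cdot> \<infinity> = 0\<close>.
\<close>

definition ennpow :: "ennreal \<Rightarrow> real \<Rightarrow> ennreal" (infixr "ennpow" 80) where
  "x ennpow s = (if s = 0 then 1 else if x = \<infinity> then \<infinity> else ennreal (enn2real x powr s))"

text \<open>Measurability is with respect to the \<open>\<mu>\<close>-completion of the Borel sets, which covers the Borel case.\<close>

definition H_log_concave_density ::
    "('h::{real_inner, polish_space} \<Rightarrow> 'w::{real_vector, polish_space}) \<Rightarrow> 'w measure \<Rightarrow> ('w \<Rightarrow> real) \<Rightarrow> bool" where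
  "H_log_concave_density j \<mu> q \<longleftrightarrow>
     q \<in> borel_measurable (completion \<mu>) \<and>
     (\<forall>w. 0 \<le> q w) \<and>
     (\<integral>\<^sup>+w. ennreal (q w) \<partial>completion \<mu>) = 1 \<and>
     (\<forall>h k. \<forall>s\<ge>0. \<forall>t\<ge>0. s + t = 1 \<longrightarrow>
        (AE w in \<mu>. ennreal (q (w + j (s *\<^sub>R h + t *\<^sub>R k)))
           \<ge> (ennreal (q (w + j h)) ennpow s) * (ennreal (q (w + j k)) ennpow t)))"

end

theory Submission
  imports Defs
begin

text \<open>
  The inequality is reduced to dimension one by integrating out one Gaussian coordinate at a time.

  Put \<open>A = a q\<close>, \<open>B = b q\<close>, \<open>C = c q\<close>. Since
  \<open>s |h|\<^sup>2 + t |k|\<^sup>2 - |s h + t k|\<^sup>2 = s t |h - k|\<^sup>2\<close>, the hypothesis multiplied by the log-concavity of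
  \<open>q\<close> becomes the condition
  \<open>A (w + s h + t k) \<ge> exp (- s t |h - k|\<^sup>2 / 2) B (w + h)\<^sup>s C (w + k)\<^sup>t\<close>
  for \<open>\<mu>\<close>-almost every \<open>w\<close>, and the claim is the corresponding inequality for the integrals with
  respect to \<open>\<mu>\<close>.

  Let \<open>l \<in> W\<^sup>\<star>\<close> have a Riesz representative \<open>e \<in> H\<close> of norm one. Replacing the coordinate
  \<open>l w\<close> by an independent standard normal variable preserves \<open>\<mu>\<close> (\<open>distr_resample\<close>); averaging over
  the new value is the conditional expectation given the other coordinates, called \<open>smooth\<close> below. On
  almost every line in the direction \<open>e\<close> the condition is the hypothesis of the one-dimensional
  Prekopa-Leindler inequality, in an almost everywhere version
  (\<open>essential_Prekopa_Leindler\<close>). Its conclusion says that the condition is inherited by the smoothed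
  functions (\<open>PL_condition_smooth\<close>).

  Smoothing along a finite orthonormal family turns every function of the coordinates of that family
  into a constant, its integral (\<open>smooth_list_cylinder\<close>). As trigonometric polynomials are dense in
  \<open>L\<^sup>1(\<mu>)\<close>, a suitable family brings the smoothed \<open>B\<close> and \<open>C\<close>, first
  truncated to bounded functions, close to the constants \<open>\<integral>B\<close> and \<open>\<integral>C\<close>. The condition at \<open>h = k = 0\<close> then bounds the smoothed \<open>A\<close>, whose integral is that of
  \<open>A\<close>, from below by almost \<open>(\<integral>B)\<^sup>s (\<integral>C)\<^sup>t\<close>.

  From the topology of \<open>W\<close> the argument needs that \<open>W\<^sup>\<star>\<close> generates the Borel sets
  (\<open>frechet_borel_subset_if_dual_measurable\<close>, by Hahn-Banach separation). This gives the density of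
  trigonometric polynomials and the uniqueness of characteristic functionals, on which
  \<open>distr_resample\<close> rests. Working only with directions that represent elements of \<open>W\<^sup>\<star>\<close> keeps
  quasi-invariance elementary (\<open>AE_translate\<close>).
\<close>

section \<open>The Hahn-Banach theorem for sublinear functionals\<close>

definition sublinear :: "('v::real_vector \<Rightarrow> real) \<Rightarrow> bool" where
  "sublinear p \<longleftrightarrow> (\<forall>x y. p (x + y) \<le> p x + p y) \<and> (\<forall>r>0. \<forall>x. p (r *\<^sub>R x) = r * p x)"

lemma sublinearD:
  assumes "sublinear p"
  shows "p (x + y) \<le> p x + p y" and "r > 0 \<Longrightarrow> p (r *\<^sub>R x) = r * p x" and "p 0 = 0"
    and "- p (- x) \<le> p x"
proof -
  show add: "p (x + y) \<le> p x + p y" for x y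
    using assms by (auto simp: sublinear_def)
  show hom: "p (r *\<^sub>R x) = r * p x" if "r > 0" for r x
    using assms that by (auto simp: sublinear_def)
  show zero: "p 0 = 0"
    using hom[of 2 0] by simp
  show "- p (- x) \<le> p x"
    using add[of x "- x"] zero by simp
qed

lemma sublinearI:
  assumes add: "\<And>x y. p (x + y) \<le> p x + p y"
    and hom: "\<And>r x. r > 0 \<Longrightarrow> p (r *\<^sub>R x) \<le> r * p x"
  shows "sublinear p"
proof -
  have "p (r *\<^sub>R x) = r * p x" if r: "r > 0" for r x
  proof (rule antisym[OF hom[OF r]])
    have "p x \<le> inverse r * p (r *\<^sub>R x)"
      using hom[of "inverse r" "r *\<^sub>R x"] r by simp
    then show "r * p x \<le> p (r *\<^sub>R x)"
      using r by (simp add: field_simps)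
  qed
  with add show ?thesis by (auto simp: sublinear_def)
qed

text \<open>
  This one construction drives the whole Hahn-Banach argument. A sublinear functional can be lowered,
  staying sublinear, until it is linear along a prescribed line: pass to the infimum of
  \<open>q (x + t y) - t q(y)\<close> over \<open>t \<ge> 0\<close>. Subadditivity bounds the infimum below by \<open>- q (- x)\<close>,
  and \<open>t = 1\<close>, \<open>x = - y\<close> gives the bound on \<open>q'(- y)\<close>.
\<close>

lemma sublinear_directional_minorant:
  assumes q: "sublinear q"
  obtains q' where "sublinear q'" "\<And>x. q' x \<le> q x" "q' (- y) \<le> - q y"
proof -
  note [simp] = sublinearD(3)[OF q]
  define F where "F x t = q (x + t *\<^sub>R y) - t * q y" for x t
  define q' where "q' x = (INF t\<in>{0..}. F x t)" for x
  have lower: "- q (- x) \<le> F x t" if "t \<ge> 0" for x t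
  proof -
    have "q (t *\<^sub>R y) = t * q y"
      using that sublinearD(2)[OF q, of t y] by (cases "t = 0") auto
    then show ?thesis
      using sublinearD(1)[OF q, of "x + t *\<^sub>R y" "- x"] by (simp add: F_def)
  qed
  then have bdd: "bdd_below (F x ` {0..})" for x
    by (auto intro!: bdd_belowI2[where m = "- q (- x)"])
  have le: "q' x \<le> F x t" if "t \<ge> 0" for x t
    unfolding q'_def using bdd that by (intro cINF_lower) auto
  have ge: "c \<le> q' x" if "\<And>t. t \<ge> 0 \<Longrightarrow> c \<le> F x t" for c x
    unfolding q'_def using that by (intro cINF_greatest) auto
  have "sublinear q'"
  proof (rule sublinearI)
    fix x1 x2
    have "q' (x1 + x2) \<le> F x1 t1 + F x2 t2" if "t1 \<ge> 0" "t2 \<ge> 0" for t1 t2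
    proof -
      have "q' (x1 + x2) \<le> F (x1 + x2) (t1 + t2)"
        using that by (intro le) auto
      also have "\<dots> \<le> F x1 t1 + F x2 t2"
        using sublinearD(1)[OF q, of "x1 + t1 *\<^sub>R y" "x2 + t2 *\<^sub>R y"]
        by (simp add: F_def algebra_simps)
      finally show ?thesis .
    qed
    then have "q' (x1 + x2) - F x2 t2 \<le> q' x1" if "t2 \<ge> 0" for t2
      using that by (intro ge) (simp add: algebra_simps)
    then have "q' (x1 + x2) - q' x1 \<le> q' x2"
      by (intro ge) (simp add: algebra_simps)
    then show "q' (x1 + x2) \<le> q' x1 + q' x2"
      by simp
  next
    fix r :: real and x assume r: "r > 0"
    have "q' (r *\<^sub>R x) \<le> r * F x t" if "t \<ge> 0" for t
    proof -
      have "q' (r *\<^sub>R x) \<le> F (r *\<^sub>R x) (r * t)"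
        using r that by (intro le) auto
      also have "\<dots> = r * F x t"
        using sublinearD(2)[OF q r, of "x + t *\<^sub>R y"] by (simp add: F_def algebra_simps)
      finally show ?thesis .
    qed
    then have "q' (r *\<^sub>R x) / r \<le> q' x"
      using r by (intro ge) (simp add: field_simps)
    then show "q' (r *\<^sub>R x) \<le> r * q' x"
      using r by (simp add: field_simps)
  qed
  moreover have "q' x \<le> q x" for x
    using le[of 0 x] by (simp add: F_def)
  moreover have "q' (- y) \<le> - q y"
    using le[of 1 "- y"] by (simp add: F_def)
  ultimately show thesis using that by blast
qed

text \<open>
  Zorn's lemma applies because the pointwise infimum of a chain of sublinear minorants is finite
  (each lies above \<open>- p (- x)\<close>) and subadditive: two members of a chain can be replaced by the
  smaller one.
\<close>

lemma ex_minimal_sublinear: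
  assumes p: "sublinear p"
  obtains q where "sublinear q" "q \<le> p" "\<And>q'. sublinear q' \<Longrightarrow> q' \<le> q \<Longrightarrow> q' = q"
proof -
  define A where "A = {q. sublinear q \<and> q \<le> p}"
  have "\<exists>m\<in>A. \<forall>a\<in>A. a \<le> m \<longrightarrow> a = m"
  proof (rule predicate_Zorn[where P = "\<lambda>q q'. q' \<le> q"])
    show "partial_order_on A (relation_of (\<lambda>q q'. q' \<le> q) A)"
      by (rule partial_order_on_relation_ofI) auto
    fix C assume C: "C \<in> Chains (relation_of (\<lambda>q q'. q' \<le> q) A)"
    have sub: "C \<subseteq> A"
      using C by (auto simp: Chains_def relation_of_def)
    have total: "q \<le> q' \<or> q' \<le> q" if "q \<in> C" "q' \<in> C" for q q'
      using C that by (auto simp: Chains_def relation_of_def)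
    show "\<exists>u\<in>A. \<forall>a\<in>C. u \<le> a"
    proof (cases "C = {}")
      case True
      then show ?thesis using p by (auto simp: A_def)
    next
      case False
      define u where "u x = (INF q\<in>C. q x)" for x
      have lower: "- p (- x) \<le> q x" if "q \<in> C" for q x
      proof -
        from that sub have "sublinear q" "q (- x) \<le> p (- x)"
          by (auto simp: A_def le_fun_def)
        then show ?thesis
          using sublinearD(4)[of q x] by linarith
      qed
      then have "bdd_below ((\<lambda>q. q x) ` C)" for x
        by (auto intro!: bdd_belowI2[where m = "- p (- x)"])
      then have le: "u x \<le> q x" if "q \<in> C" for q x
        unfolding u_def using that by (intro cINF_lower)
      have ge: "c \<le> u x" if "\<And>q. q \<in> C \<Longrightarrow> c \<le> q x" for c x
        unfolding u_def using that False by (intro cINF_greatest) auto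
      have "sublinear u"
      proof (rule sublinearI)
        fix x y
        have "u (x + y) \<le> q1 x + q2 y" if q12: "q1 \<in> C" "q2 \<in> C" for q1 q2
        proof -
          obtain q where q: "q \<in> C" "q \<le> q1" "q \<le> q2"
            using total[OF q12] q12 by blast
          then have "sublinear q" using sub by (auto simp: A_def)
          then have "q (x + y) \<le> q x + q y"
            by (rule sublinearD)
          moreover have "q x \<le> q1 x" "q y \<le> q2 y"
            using q by (auto simp: le_fun_def)
          ultimately show ?thesis
            using le[OF q(1), of "x + y"] by linarith
        qed
        then have "u (x + y) - q2 y \<le> u x" if "q2 \<in> C" for q2
          using that by (intro ge) (simp add: algebra_simps)
        then have "u (x + y) - u x \<le> u y"
          by (intro ge) (simp add: algebra_simps)
        then show "u (x + y) \<le> u x + u y" by simp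
      next
        fix r :: real and x assume r: "r > 0"
        have "u (r *\<^sub>R x) \<le> r * q x" if "q \<in> C" for q
        proof -
          have "sublinear q" using sub that by (auto simp: A_def)
          then show ?thesis
            using le[OF that, of "r *\<^sub>R x"] sublinearD(2)[of q r x] r by simp
        qed
        then have "u (r *\<^sub>R x) / r \<le> u x"
          using r by (intro ge) (simp add: field_simps)
        then show "u (r *\<^sub>R x) \<le> r * u x"
          using r by (simp add: field_simps)
      qed
      moreover have "u \<le> p"
      proof -
        obtain q where "q \<in> C" using False by blast
        with sub have "q \<le> p" by (auto simp: A_def)
        moreover have "u \<le> q" using le[OF \<open>q \<in> C\<close>] by (simp add: le_fun_def)
        ultimately show ?thesis by order
      qed
      ultimately show ?thesis
        using le by (auto simp: A_def le_fun_def)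
    qed
  qed
  then obtain q where q: "q \<in> A" "\<forall>a\<in>A. a \<le> q \<longrightarrow> a = q"
    by blast
  show thesis
  proof (rule that[of q])
    fix q' assume "sublinear q'" "q' \<le> q"
    with q have "q' \<in> A" by (auto simp: A_def)
    with q \<open>q' \<le> q\<close> show "q' = q" by blast
  qed (use q in \<open>auto simp: A_def\<close>)
qed

text \<open>
  A minimal sublinear functional is linear, since lowering it in the direction \<open>y\<close> changes nothing and
  hence \<open>m (- y) = - m(y)\<close>. Lowering \<open>p\<close> in the direction \<open>x0\<close> first makes every sublinear minorant
  agree with \<open>p\<close> at \<open>x0\<close>.
\<close>

theorem Hahn_Banach_sublinear:
  fixes p :: "'v::real_vector \<Rightarrow> real"
  assumes p: "sublinear p"
  obtains m where "linear m" "\<And>x. m x \<le> p x" "m x0 = p x0"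
proof -
  obtain p' where p': "sublinear p'" "\<And>x. p' x \<le> p x" "p' (- x0) \<le> - p x0"
    using sublinear_directional_minorant[OF p, where y = x0] by blast
  obtain m where m: "sublinear m" "m \<le> p'"
    and min: "\<And>q. sublinear q \<Longrightarrow> q \<le> m \<Longrightarrow> q = m"
    using ex_minimal_sublinear[OF p'(1)] by blast
  have neg: "m (- y) = - m y" for y
  proof -
    obtain q where "sublinear q" "\<And>x. q x \<le> m x" "q (- y) \<le> - m y"
      using sublinear_directional_minorant[OF m(1), where y = y] by blast
    moreover from this have "q = m" by (intro min) (auto simp: le_fun_def)
    ultimately have "m (- y) \<le> - m y" by simp
    with sublinearD(4)[OF m(1), of y] show ?thesis by simp
  qed
  have add: "m (x + y) = m x + m y" for x y
    using sublinearD(1)[OF m(1), of x y] sublinearD(1)[OF m(1), of "- x" "- y"] neg[of "x + y"]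
    by (simp add: neg)
  have hom: "m (r *\<^sub>R x) = r * m x" for r x
  proof -
    consider "r > 0" | "r = 0" | "r < 0" by linarith
    then show ?thesis
    proof cases
      case 3
      then have "m ((- r) *\<^sub>R (- x)) = (- r) * m (- x)"
        by (intro sublinearD[OF m(1)]) simp
      then show ?thesis by (simp add: neg)
    qed (use sublinearD[OF m(1)] in auto)
  qed
  have le: "m x \<le> p x" for x
    using m(2) p'(2)[of x] by (auto simp: le_fun_def intro: order_trans)
  have "- m x0 \<le> - p x0"
    using m(2) p'(3) by (auto simp: le_fun_def neg[symmetric] intro: order_trans)
  with le[of x0] have "m x0 = p x0" by simp
  moreover have "linear m"
    by (rule linearI) (auto simp: add hom)
  ultimately show thesis using le that by blast
qed

section \<open>The dual of a Frechet space generates the Borel sets\<close>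

definition dual_space :: "('w::{real_vector, topological_space} \<Rightarrow> real) set" where
  "dual_space = {l. linear l \<and> continuous_on UNIV l}"

lemma dual_space_borel:
  "l \<in> dual_space \<Longrightarrow> (l :: 'w::{real_vector, topological_space} \<Rightarrow> real) \<in> borel_measurable borel"
  by (auto simp: dual_space_def intro: borel_measurable_continuous_onI)

lemma dual_space_add: "l \<in> dual_space \<Longrightarrow> m \<in> dual_space \<Longrightarrow> (\<lambda>w. l w + m w) \<in> dual_space"
  and dual_space_diff: "l \<in> dual_space \<Longrightarrow> m \<in> dual_space \<Longrightarrow> (\<lambda>w. l w - m w) \<in> dual_space"
  and dual_space_scale: "l \<in> dual_space \<Longrightarrow> (\<lambda>w. r * l w) \<in> dual_space"
  and dual_space_zero: "(\<lambda>w. 0) \<in> dual_space"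
  by (auto simp: dual_space_def linear_iff algebra_simps intro!: continuous_intros)

context
  assumes frechet: "frechet_space TYPE('w::{real_vector, polish_space})"
begin

lemma frechet_tendsto_add:
  fixes f g :: "'b \<Rightarrow> 'w"
  assumes "(f \<longlongrightarrow> a) F" "(g \<longlongrightarrow> b) F"
  shows "((\<lambda>x. f x + g x) \<longlongrightarrow> a + b) F"
proof -
  have inv: "dist (x + z) (y + z) = dist x y" for x y z :: 'w
    using frechet by (simp add: frechet_space_def)
  have lim: "((\<lambda>x. dist (f x) a + dist (g x) b) \<longlongrightarrow> 0) F"
    using tendsto_add[OF assms[THEN tendsto_dist_iff[THEN iffD1]]] by simp
  have "dist (f x + g x) (a + b) \<le> dist (f x) a + dist (g x) b" for x
    using dist_triangle[of "f x + g x" "a + b" "a + g x"] inv[of "f x" "g x" a] inv[of "g x" a b]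
    by (simp add: add.commute[of a])
  then have "((\<lambda>x. dist (f x + g x) (a + b)) \<longlongrightarrow> 0) F"
    by (intro Lim_null_comparison[OF _ lim]) simp
  then show ?thesis
    by (subst tendsto_dist_iff)
qed

lemma frechet_tendsto_scaleR:
  fixes g :: "'b \<Rightarrow> 'w"
  assumes "(f \<longlongrightarrow> r) F" "(g \<longlongrightarrow> b) F"
  shows "((\<lambda>x. f x *\<^sub>R g x) \<longlongrightarrow> r *\<^sub>R b) F"
proof -
  have "continuous_on UNIV (\<lambda>(r::real, x::'w). r *\<^sub>R x)"
    using frechet by (simp add: frechet_space_def)
  then have "isCont (\<lambda>(r::real, x::'w). r *\<^sub>R x) (r, b)"
    by (simp add: continuous_on_eq_continuous_at)
  from isCont_tendsto_compose[OF this tendsto_Pair[OF assms]] show ?thesis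
    by simp
qed

lemma frechet_continuous_on_add:
  fixes f g :: "'b::topological_space \<Rightarrow> 'w"
  shows "continuous_on S f \<Longrightarrow> continuous_on S g \<Longrightarrow> continuous_on S (\<lambda>x. f x + g x)"
  unfolding continuous_on_def by (blast intro: frechet_tendsto_add)

lemma frechet_continuous_on_scaleR:
  fixes g :: "'b::topological_space \<Rightarrow> 'w"
  shows "continuous_on S f \<Longrightarrow> continuous_on S g \<Longrightarrow> continuous_on S (\<lambda>x. f x *\<^sub>R g x)"
  unfolding continuous_on_def by (blast intro: frechet_tendsto_scaleR)

lemma frechet_continuous_on_diff:
  fixes f g :: "'b::topological_space \<Rightarrow> 'w"
  assumes "continuous_on S f" "continuous_on S g"
  shows "continuous_on S (\<lambda>x. f x - g x)"
  using frechet_continuous_on_add[OF assms(1) frechet_continuous_on_scaleR[OF continuous_on_const assms(2), of "-1"]]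
  by simp

end

text \<open>
  The Minkowski functional of \<open>V\<close>.
\<close>

definition gauge_of :: "'v::real_vector set \<Rightarrow> 'v \<Rightarrow> real" where
  "gauge_of V x = Inf {r. r > 0 \<and> inverse r *\<^sub>R x \<in> V}"

context
  fixes V :: "'w::{real_vector, polish_space} set"
  assumes frechet: "frechet_space TYPE('w)"
    and V: "open V" "convex V" "0 \<in> V"
begin

lemma gauge_set_up_closed:
  assumes "r > 0" "inverse r *\<^sub>R x \<in> V" "r \<le> r'"
  shows "inverse r' *\<^sub>R x \<in> V"
proof -
  have "(r / r') *\<^sub>R (inverse r *\<^sub>R x) + (1 - r / r') *\<^sub>R 0 \<in> V"
    using assms V by (intro convexD) (auto simp: divide_simps)
  moreover have "r / r' * inverse r = inverse r'"
    using assms by (simp add: field_simps)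
  ultimately show ?thesis by simp
qed

lemma gauge_set_nonempty: "\<exists>r>0. inverse r *\<^sub>R x \<in> V"
proof -
  have "((\<lambda>r. r *\<^sub>R x) \<longlongrightarrow> 0 *\<^sub>R x) (at_right (0::real))"
    by (intro frechet_tendsto_scaleR[OF frechet] tendsto_intros)
  then have "\<forall>\<^sub>F r in at_right 0. r *\<^sub>R x \<in> V"
    using V by (auto dest: topological_tendstoD)
  then obtain b :: real where b: "b > 0" "\<And>r. 0 < r \<Longrightarrow> r < b \<Longrightarrow> r *\<^sub>R x \<in> V"
    by (auto simp: eventually_at_right_field)
  then have "inverse (inverse (b / 2)) *\<^sub>R x \<in> V"
    by simp
  with b show ?thesis by (metis half_gt_zero inverse_positive_iff_positive)
qed

lemma gauge_le:
  assumes "r > 0" "inverse r *\<^sub>R x \<in> V"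
  shows "gauge_of V x \<le> r"
  unfolding gauge_of_def using assms
  by (intro cInf_lower) (auto intro!: bdd_belowI[where m = 0])

lemma gauge_less_imp_mem:
  assumes "gauge_of V x < r"
  shows "r > 0" "inverse r *\<^sub>R x \<in> V"
proof -
  have "{r. r > 0 \<and> inverse r *\<^sub>R x \<in> V} \<noteq> {}"
    using gauge_set_nonempty by auto
  from cInf_lessD[OF this assms[unfolded gauge_of_def]]
  obtain r0 where "r0 > 0" "inverse r0 *\<^sub>R x \<in> V" "r0 < r" by auto
  then show "r > 0" "inverse r *\<^sub>R x \<in> V"
    using gauge_set_up_closed[of r0 x r] by auto
qed

lemma sublinear_gauge: "sublinear (gauge_of V)"
proof (rule sublinearI)
  fix x y
  have "gauge_of V (x + y) \<le> gauge_of V x + gauge_of V y + e" if e: "e > 0" for e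
  proof -
    define r where "r = gauge_of V x + e / 2"
    define s where "s = gauge_of V y + e / 2"
    have r: "r > 0" "inverse r *\<^sub>R x \<in> V" and s: "s > 0" "inverse s *\<^sub>R y \<in> V"
      using e gauge_less_imp_mem[of x r] gauge_less_imp_mem[of y s] by (auto simp: r_def s_def)
    have "(r / (r + s)) *\<^sub>R (inverse r *\<^sub>R x) + (s / (r + s)) *\<^sub>R (inverse s *\<^sub>R y) \<in> V"
      using r s V by (intro convexD) (auto simp flip: add_divide_distrib)
    moreover have "r / (r + s) * inverse r = inverse (r + s)" "s / (r + s) * inverse s = inverse (r + s)"
      using r s by (auto simp: field_simps)
    ultimately have "inverse (r + s) *\<^sub>R (x + y) \<in> V"
      by (simp add: scaleR_add_right)
    then have "gauge_of V (x + y) \<le> r + s"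
      using r s by (intro gauge_le) auto
    then show ?thesis by (simp add: r_def s_def)
  qed
  then show "gauge_of V (x + y) \<le> gauge_of V x + gauge_of V y"
    by (rule field_le_epsilon)
next
  fix c :: real and x assume c: "c > 0"
  have "gauge_of V (c *\<^sub>R x) \<le> c * gauge_of V x + e" if e: "e > 0" for e
  proof -
    define r where "r = gauge_of V x + e / c"
    have r: "r > 0" "inverse r *\<^sub>R x \<in> V"
      using e c gauge_less_imp_mem[of x r] by (auto simp: r_def)
    then have "gauge_of V (c *\<^sub>R x) \<le> c * r"
      using c by (intro gauge_le) (auto simp: field_simps)
    moreover have "c * r = c * gauge_of V x + e"
      using c by (simp add: r_def distrib_left)
    ultimately show ?thesis by simp
  qed
  then show "gauge_of V (c *\<^sub>R x) \<le> c * gauge_of V x"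
    by (rule field_le_epsilon)
qed

lemma gauge_le_1: "x \<in> V \<Longrightarrow> gauge_of V x \<le> 1"
  using gauge_le[of 1 x] by simp

lemma gauge_le_1_closure:
  assumes "gauge_of V x \<le> 1"
  shows "x \<in> closure V"
proof -
  have "((\<lambda>r. inverse r *\<^sub>R x) \<longlongrightarrow> inverse 1 *\<^sub>R x) (at_right (1::real))"
    by (intro frechet_tendsto_scaleR[OF frechet] tendsto_intros) auto
  then have lim: "((\<lambda>r. inverse r *\<^sub>R x) \<longlongrightarrow> x) (at_right (1::real))"
    by simp
  have "\<forall>\<^sub>F r in at_right (1::real). r > 1"
    by (simp add: eventually_at_filter)
  then have "\<forall>\<^sub>F r in at_right (1::real). inverse r *\<^sub>R x \<in> closure V"
  proof eventually_elim
    case (elim r)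
    then have "inverse r *\<^sub>R x \<in> V"
      using assms by (intro gauge_less_imp_mem) auto
    then show ?case using closure_subset by blast
  qed
  from Lim_in_closed_set[OF closed_closure this _ lim] show ?thesis
    by simp
qed

text \<open>
  Domination by the gauge bounds \<open>m\<close> by 1 on the neighbourhood \<open>V\<close> of 0, which for a linear
  functional is continuity.
\<close>

lemma gauge_dominated_in_dual:
  assumes m: "linear m" "\<And>x. m x \<le> gauge_of V x"
  shows "m \<in> dual_space"
proof -
  have "(m \<longlongrightarrow> m x) (at x)" for x
  proof (rule tendstoI)
    fix e :: real assume e: "e > 0"
    have "((\<lambda>y. (2 / e) *\<^sub>R (y + (-1) *\<^sub>R x)) \<longlongrightarrow> (2 / e) *\<^sub>R (x + (-1) *\<^sub>R x)) (at x)"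
         "((\<lambda>y. (- (2 / e)) *\<^sub>R (y + (-1) *\<^sub>R x)) \<longlongrightarrow> (- (2 / e)) *\<^sub>R (x + (-1) *\<^sub>R x)) (at x)"
      by (intro frechet_tendsto_scaleR[OF frechet] frechet_tendsto_add[OF frechet] tendsto_intros)+
    then have "\<forall>\<^sub>F y in at x. (2 / e) *\<^sub>R (y - x) \<in> V" "\<forall>\<^sub>F y in at x. (- (2 / e)) *\<^sub>R (y - x) \<in> V"
      using V by (auto dest: topological_tendstoD)
    then show "\<forall>\<^sub>F y in at x. dist (m y) (m x) < e"
    proof eventually_elim
      case (elim y)
      have "m ((2 / e) *\<^sub>R (y - x)) \<le> 1" "m ((- (2 / e)) *\<^sub>R (y - x)) \<le> 1"
        using elim m(2) gauge_le_1 order_trans by blast+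
      then show ?case
        using e by (simp add: linear_cmul[OF m(1)] linear_diff[OF m(1)] linear_neg[OF m(1)] dist_real_def field_simps abs_less_iff)
    qed
  qed
  then show ?thesis
    using m(1) by (simp add: dual_space_def continuous_on_eq_continuous_at isCont_def)
qed

text \<open>
  By Hahn-Banach, the complement of the gauge ball is a union of open half-spaces of continuous
  functionals; as \<open>W\<close> is second countable, countably many of them suffice.
\<close>

lemma gauge_ball_in_sets:
  assumes "space N = (UNIV :: 'w set)" "\<And>l. l \<in> dual_space \<Longrightarrow> l \<in> borel_measurable N"
  shows "{y. gauge_of V (y - x) \<le> 1} \<in> sets N"
proof -
  define D where "D = {m. linear m \<and> (\<forall>x. m x \<le> gauge_of V x)}"
  have D: "m \<in> dual_space" if "m \<in> D" for m
    using that gauge_dominated_in_dual by (auto simp: D_def)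
  define \<H> where "\<H> = (\<lambda>m. {y. m y > 1 + m x}) ` D"
  have op: "open H" if "H \<in> \<H>" for H
    using that D by (auto simp: \<H>_def dual_space_def intro!: open_Collect_less)
  have union: "\<Union>\<H> = {y. gauge_of V (y - x) > 1}"
  proof (intro equalityI subsetI)
    fix y assume "y \<in> \<Union>\<H>"
    then obtain m where m: "m \<in> D" "m y > 1 + m x" by (auto simp: \<H>_def)
    then have "m (y - x) > 1"
      using linear_diff[of m] by (simp add: D_def)
    moreover have "m (y - x) \<le> gauge_of V (y - x)" using m by (simp add: D_def)
    ultimately show "y \<in> {y. gauge_of V (y - x) > 1}" by simp
  next
    fix y assume y: "y \<in> {y. gauge_of V (y - x) > 1}"
    obtain m where m: "linear m" "\<And>z. m z \<le> gauge_of V z" "m (y - x) = gauge_of V (y - x)"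
      using Hahn_Banach_sublinear[OF sublinear_gauge, of "y - x"] by blast
    then have "m \<in> D" by (simp add: D_def)
    moreover have "m y > 1 + m x"
      using y m linear_diff[of m] by simp
    ultimately show "y \<in> \<Union>\<H>" by (auto simp: \<H>_def)
  qed
  obtain \<H>' where \<H>': "\<H>' \<subseteq> \<H>" "countable \<H>'" "\<Union>\<H>' = \<Union>\<H>"
    using Lindelof[OF op] by blast
  have "H \<in> sets N" if "H \<in> \<H>" for H
  proof -
    from that obtain m where m: "m \<in> D" "H = {y. m y > 1 + m x}" by (auto simp: \<H>_def)
    then have [measurable]: "m \<in> borel_measurable N" using D assms(2) by blast
    have "{y \<in> space N. m y > 1 + m x} \<in> sets N" by measurable
    with m assms(1) show ?thesis by simp
  qed
  then have "\<Union>\<H>' \<in> sets N"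
    using \<H>' by (intro sets.countable_Union) auto
  then have "space N - \<Union>\<H>' \<in> sets N" by blast
  moreover have "space N - \<Union>\<H>' = {y. gauge_of V (y - x) \<le> 1}"
    using \<H>'(3) union assms(1) by auto
  ultimately show ?thesis by simp
qed

end

text \<open>
  The continuous functionals generate the Borel sets: every open set is a union of gauge balls of
  convex neighbourhoods, and by the Lindelof property a countable one.
\<close>

theorem frechet_borel_subset_if_dual_measurable:
  fixes N :: "'w::{real_vector, polish_space} measure"
  assumes frechet: "frechet_space TYPE('w)"
    and N: "space N = UNIV" "\<And>l. l \<in> dual_space \<Longrightarrow> l \<in> borel_measurable N"
  shows "sets borel \<subseteq> sets N"
proof -
  have "U \<in> sets N" if U: "open U" for U :: "'w set"
  proof -
    have inv: "dist (x + z) (y + z) = dist x y" for x y z :: 'w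
      using frechet by (simp add: frechet_space_def)
    have "\<exists>V. open V \<and> convex V \<and> 0 \<in> V \<and> {y. gauge_of V (y - x) \<le> 1} \<subseteq> U" if x: "x \<in> U" for x
    proof -
      obtain r where r: "r > 0" "ball x r \<subseteq> U"
        using U x by (auto simp: open_contains_ball)
      obtain V :: "'w set" where V: "open V" "convex V" "0 \<in> V" "V \<subseteq> ball 0 (r / 2)"
        using frechet r unfolding frechet_space_def by (meson centre_in_ball half_gt_zero open_ball)
      have "y \<in> U" if "gauge_of V (y - x) \<le> 1" for y
      proof -
        have "y - x \<in> closure V"
          using gauge_le_1_closure[OF frechet V(1-3) that] .
        also have "closure V \<subseteq> cball 0 (r / 2)"
          using V(4) by (intro closure_minimal) auto
        finally have "dist 0 (y - x) \<le> r / 2" by simp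
        then have "dist x y < r"
          using inv[of 0 x "y - x"] r by simp
        then show ?thesis using r by auto
      qed
      with V show ?thesis by blast
    qed
    then obtain V where V: "\<And>x. x \<in> U \<Longrightarrow> open (V x) \<and> convex (V x) \<and> 0 \<in> V x \<and> {y. gauge_of (V x) (y - x) \<le> 1} \<subseteq> U"
      by metis
    define \<G> where "\<G> = (\<lambda>x. {y. y - x \<in> V x}) ` U"
    have "open {y. y - x \<in> V x}" if "x \<in> U" for x
    proof -
      have "continuous_on UNIV (\<lambda>y. y - x)"
        by (intro frechet_continuous_on_diff[OF frechet] continuous_intros)
      moreover have "open (V x)" using V that by blast
      ultimately have "open ((\<lambda>y. y - x) -` V x)"
        by (simp add: open_vimage)
      then show ?thesis by (simp add: vimage_def)
    qed
    then have op: "open G" if "G \<in> \<G>" for G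
      using that by (auto simp: \<G>_def)
    obtain \<G>' where \<G>': "\<G>' \<subseteq> \<G>" "countable \<G>'" "\<Union>\<G>' = \<Union>\<G>"
      using Lindelof[OF op] by blast
    obtain X where X: "X \<subseteq> U" "countable X" "\<G>' = (\<lambda>x. {y. y - x \<in> V x}) ` X"
      using \<G>'(1,2) countable_subset_image[of \<G>' "\<lambda>x. {y. y - x \<in> V x}" U]
      unfolding \<G>_def by blast
    have "U = (\<Union>x\<in>X. {y. gauge_of (V x) (y - x) \<le> 1})"
    proof (intro equalityI subsetI)
      fix y assume "y \<in> U"
      then have "y \<in> \<Union>\<G>" using V by (force simp: \<G>_def)
      then obtain x where x: "x \<in> X" "y - x \<in> V x"
        using \<G>'(3) X(3) by auto
      then have "gauge_of (V x) (y - x) \<le> 1"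
        using V X(1) by (intro gauge_le_1[OF frechet]) auto
      with x show "y \<in> (\<Union>x\<in>X. {y. gauge_of (V x) (y - x) \<le> 1})" by blast
    qed (use V X in blast)
    also have "\<dots> \<in> sets N"
    proof (rule sets.countable_UN')
      show "(\<lambda>x. {y. gauge_of (V x) (y - x) \<le> 1}) ` X \<subseteq> sets N"
        using X V by (auto intro: gauge_ball_in_sets[OF frechet _ _ _ N] simp del: mem_Collect_eq)
    qed (use X in simp)
    finally show ?thesis .
  qed
  then have "sigma_sets UNIV {U :: 'w set. open U} \<subseteq> sets N"
    using N(1) sets.sigma_sets_subset[of "{U. open U}" N] by auto
  then show ?thesis
    by (simp add: borel_def)
qed

section \<open>Algebras of bounded functions closed under bounded limits\<close>

text \<open>
  Two facts about measures on \<open>W\<close> are needed: trigonometric polynomials are dense in \<open>L\<^sup>1\<close>, and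
  they determine the measure. Both follow from a monotone class theorem for algebras of bounded
  functions.
\<close>

locale bounded_algebra =
  fixes \<C> :: "('a \<Rightarrow> real) set"
  assumes const: "\<And>c. (\<lambda>w. c) \<in> \<C>"
    and add: "\<And>f g. f \<in> \<C> \<Longrightarrow> g \<in> \<C> \<Longrightarrow> (\<lambda>w. f w + g w) \<in> \<C>"
    and mult: "\<And>f g. f \<in> \<C> \<Longrightarrow> g \<in> \<C> \<Longrightarrow> (\<lambda>w. f w * g w) \<in> \<C>"
    and bdd: "\<And>f. f \<in> \<C> \<Longrightarrow> \<exists>C. \<forall>w. \<bar>f w\<bar> \<le> C"
    and lim: "\<And>F f C. (\<And>n. F n \<in> \<C>) \<Longrightarrow> (\<And>n w. \<bar>F n w\<bar> \<le> C) \<Longrightarrow> (\<And>w. (\<lambda>n::nat. F n w) \<longlonglongrightarrow> f w) \<Longrightarrow> f \<in> \<C>"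
begin

lemma comp_polynomial:
  assumes p: "real_polynomial_function (p :: real \<Rightarrow> real)" and f: "f \<in> \<C>"
  shows "(\<lambda>w. p (f w)) \<in> \<C>"
  using p
proof induction
  case (linear p)
  have "p (f w) = f w * p 1" for w
    using linear_cmul[OF bounded_linear.linear[OF linear], of "f w" 1] by simp
  then show ?case using mult[OF f const[of "p 1"]] by simp
qed (auto intro: const add mult)

text \<open>
  The indicator is a bounded pointwise limit of continuous ramps, and on the bounded range of \<open>f\<close> the
  ramps are uniform limits of polynomials.
\<close>

lemma indicator_superlevel:
  assumes f: "f \<in> \<C>"
  shows "indicator {w. f w > c} \<in> \<C>"
proof -
  obtain C where C: "\<And>w. \<bar>f w\<bar> \<le> C" using bdd[OF f] by auto
  define ramp where "ramp n x = min 1 (max 0 (real n * (x - c)))" for n :: nat and x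
  have "\<exists>p. real_polynomial_function p \<and> (\<forall>x\<in>{-C..C}. \<bar>ramp n x - p x\<bar> < inverse (real (Suc n)))" for n
  proof -
    have "continuous_on {-C..C} (\<lambda>x. min 1 (max 0 (real n * (x - c))))"
      by (intro continuous_intros)
    then have "continuous_on {-C..C} (ramp n)"
      by (simp add: ramp_def[abs_def])
    then obtain p where "real_polynomial_function p"
      "\<And>x. x \<in> {-C..C} \<Longrightarrow> \<bar>ramp n x - p x\<bar> < inverse (real (Suc n))"
      by (rule Stone_Weierstrass_real_polynomial_function[OF compact_Icc, where e = "inverse (real (Suc n))"]) auto
    then show ?thesis by blast
  qed
  then obtain p where p: "\<And>n. real_polynomial_function (p n)"
    "\<And>n x. x \<in> {-C..C} \<Longrightarrow> \<bar>ramp n x - p n x\<bar> < inverse (real (Suc n))"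
    by metis
  have close: "\<bar>ramp n (f w) - p n (f w)\<bar> < inverse (real (Suc n))" for n w
    using C[of w] by (intro p) (auto simp: abs_le_iff)
  (* The bound 2 is the supremum 1 of a ramp plus an approximation error of at most 1. *)
  show ?thesis
  proof (rule lim[where F = "\<lambda>n w. p n (f w)" and C = 2])
    show "(\<lambda>w. p n (f w)) \<in> \<C>" for n
      by (rule comp_polynomial[OF p(1) f])
    show "\<bar>p n (f w)\<bar> \<le> 2" for n w
    proof -
      have "inverse (real (Suc n)) \<le> 1" by (simp add: field_simps)
      moreover have "\<bar>ramp n (f w)\<bar> \<le> 1" by (simp add: ramp_def)
      ultimately show ?thesis using close[of n w] by linarith
    qed
    show "(\<lambda>n. p n (f w)) \<longlonglongrightarrow> indicator {w. f w > c} w" for w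
    proof -
      have ramp_lim: "(\<lambda>n. ramp n (f w)) \<longlonglongrightarrow> indicator {w. f w > c} w"
      proof (cases "f w > c")
        case True
        have "\<forall>\<^sub>F n in sequentially. real n \<ge> 1 / (f w - c)"
          using filterlim_real_sequentially by (auto simp: filterlim_at_top)
        then have "\<forall>\<^sub>F n in sequentially. ramp n (f w) = 1"
          by eventually_elim (use True in \<open>auto simp: ramp_def field_simps\<close>)
        then show ?thesis
          using True by (intro tendsto_eventually) simp
      next
        case False
        then have "real n * (f w - c) \<le> 0" for n
          by (intro mult_nonneg_nonpos) auto
        then have "ramp n (f w) = 0" for n
          by (simp add: ramp_def max_absorb1)
        then show ?thesis using False by simp
      qed
      have "(\<lambda>n. p n (f w) - ramp n (f w)) \<longlonglongrightarrow> 0"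
      proof (rule Lim_null_comparison[OF _ LIMSEQ_inverse_real_of_nat])
        show "\<forall>\<^sub>F n in sequentially. norm (p n (f w) - ramp n (f w)) \<le> inverse (real (Suc n))"
          by (rule always_eventually) (metis abs_minus_commute close less_imp_le real_norm_def)
      qed
      from tendsto_add[OF ramp_lim this] show ?thesis
        by simp
    qed
  qed
qed

end

text \<open>
  The sets whose indicators lie in the algebra form a sigma-algebra. The algebra contains
  \<open>sin (l / n)\<close>, whose rescalings \<open>n sin (l / n)\<close> converge to \<open>l\<close>; so all continuous functionals
  are measurable for this sigma-algebra, which therefore contains the Borel sets.
\<close>

theorem bounded_algebra_contains_indicators:
  fixes \<C> :: "('w::{real_vector, polish_space} \<Rightarrow> real) set"
  assumes frechet: "frechet_space TYPE('w)" and alg: "bounded_algebra \<C>"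
    and sin: "\<And>l. l \<in> dual_space \<Longrightarrow> (\<lambda>w. sin (l w)) \<in> \<C>"
    and A: "A \<in> sets borel"
  shows "indicator A \<in> \<C>"
proof -
  interpret bounded_algebra \<C> by (rule alg)
  define \<Sigma> where "\<Sigma> = {A. indicator A \<in> \<C>}"
  have compl: "- A \<in> \<Sigma>" if "A \<in> \<Sigma>" for A
  proof -
    have "(\<lambda>w. 1 + -1 * indicator A w) \<in> \<C>"
      using that by (intro add mult const) (auto simp: \<Sigma>_def)
    also have "(\<lambda>w. 1 + -1 * indicator A w) = (indicator (- A) :: 'w \<Rightarrow> real)"
      by (auto simp: indicator_def)
    finally show ?thesis by (simp add: \<Sigma>_def)
  qed
  have inter: "A \<inter> B \<in> \<Sigma>" if "A \<in> \<Sigma>" "B \<in> \<Sigma>" for A B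
  proof -
    have "(\<lambda>w. indicator A w * indicator B w) \<in> \<C>"
      using mult[of "indicator A" "indicator B"] that by (simp add: \<Sigma>_def)
    also have "(\<lambda>w. indicator A w * indicator B w) = (indicator (A \<inter> B) :: 'w \<Rightarrow> real)"
      by (simp add: fun_eq_iff indicator_inter_arith)
    finally show ?thesis by (simp add: \<Sigma>_def)
  qed
  have union: "A \<union> B \<in> \<Sigma>" if "A \<in> \<Sigma>" "B \<in> \<Sigma>" for A B
    using compl[OF inter[OF compl[OF that(1)] compl[OF that(2)]]] by simp
  have empty: "{} \<in> \<Sigma>"
  proof -
    have "(indicator {} :: 'w \<Rightarrow> real) = (\<lambda>w. 0)" by auto
    with const[of 0] show ?thesis unfolding \<Sigma>_def by simp
  qed
  have countable: "(\<Union>i. A i) \<in> \<Sigma>" if A: "\<And>i. A i \<in> \<Sigma>" for A :: "nat \<Rightarrow> 'w set"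
  proof -
    define B where "B n = (\<Union>i<n. A i)" for n
    have B: "B n \<in> \<Sigma>" for n
      by (induction n) (auto simp: B_def lessThan_Suc empty intro: union A)
    have "indicator (\<Union>i. A i) \<in> \<C>"
    proof (rule lim[where F = "\<lambda>n. indicator (B n)" and C = 1])
      show "indicator (B n) \<in> \<C>" for n
        using B by (simp add: \<Sigma>_def)
      show "(\<lambda>n. indicator (B n) w) \<longlonglongrightarrow> (indicator (\<Union>i. A i) w :: real)" for w
        unfolding B_def by (rule LIMSEQ_indicator_UN)
    qed (simp add: indicator_def)
    then show ?thesis by (simp add: \<Sigma>_def)
  qed
  have sa: "sigma_algebra UNIV \<Sigma>"
    unfolding sigma_algebra_iff2
  proof (intro conjI ballI allI impI)
    show "UNIV - A \<in> \<Sigma>" if "A \<in> \<Sigma>" for A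
      using compl[OF that] by (simp add: Compl_eq_Diff_UNIV)
    show "(\<Union>i. A i) \<in> \<Sigma>" if "range A \<subseteq> \<Sigma>" for A :: "nat \<Rightarrow> 'w set"
      using that by (intro countable) auto
  qed (use empty in auto)
  define N where "N = sigma UNIV \<Sigma>"
  have N: "space N = UNIV" "sets N = \<Sigma>"
    using sigma_algebra.sets_measure_of_eq[OF sa] by (auto simp: N_def space_measure_of)
  have "l \<in> borel_measurable N" if l: "l \<in> dual_space" for l
  proof (rule borel_measurable_LIMSEQ_real)
    fix n :: nat
    have "(\<lambda>w. sin (1 / real (Suc n) * l w)) \<in> \<C>"
      by (intro sin dual_space_scale l)
    from indicator_superlevel[OF this]
    have "{w. sin (1 / real (Suc n) * l w) > c} \<in> \<Sigma>" for c
      by (simp add: \<Sigma>_def)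
    then have "(\<lambda>w. sin (1 / real (Suc n) * l w)) \<in> borel_measurable N"
      by (subst borel_measurable_iff_greater) (simp add: N)
    then show "(\<lambda>w. real (Suc n) * sin (1 / real (Suc n) * l w)) \<in> borel_measurable N"
      by measurable
  next
    fix w
    have "(\<lambda>n. real n * sin (1 / real n * l w)) \<longlonglongrightarrow> l w"
      by real_asymp
    then show "(\<lambda>n. real (Suc n) * sin (1 / real (Suc n) * l w)) \<longlonglongrightarrow> l w"
      by (rule LIMSEQ_Suc)
  qed
  from frechet_borel_subset_if_dual_measurable[OF frechet N(1) this] A N(2)
  show ?thesis by (auto simp: \<Sigma>_def)
qed

corollary bounded_algebra_contains_borel:
  fixes \<C> :: "('w::{real_vector, polish_space} \<Rightarrow> real) set"
  assumes frechet: "frechet_space TYPE('w)" and alg: "bounded_algebra \<C>"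
    and sin: "\<And>l. l \<in> dual_space \<Longrightarrow> (\<lambda>w. sin (l w)) \<in> \<C>"
    and f: "f \<in> borel_measurable borel" "\<And>w. 0 \<le> f w" "\<And>w. f w \<le> C"
  shows "f \<in> \<C>"
proof -
  interpret bounded_algebra \<C> by (rule alg)
  have "(\<exists>C. \<forall>w. f w \<le> C) \<longrightarrow> f \<in> \<C>"
    using f(1,2)
  proof (induction rule: borel_measurable_induct_real)
    case (set A)
    then show ?case using bounded_algebra_contains_indicators[OF frechet alg sin] by simp
  next
    case (mult u c)
    show ?case
    proof
      assume "\<exists>C. \<forall>w. c * u w \<le> C"
      then obtain C where C: "\<And>w. c * u w \<le> C" by auto
      show "(\<lambda>w. c * u w) \<in> \<C>"
      proof (cases "c = 0")
        case True
        then show ?thesis using const[of 0] by simp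
      next
        case False
        with mult have "u w \<le> C / c" for w using C[of w] by (simp add: field_simps)
        then have "u \<in> \<C>" using mult by blast
        then show ?thesis by (intro bounded_algebra.mult[OF alg] const)
      qed
    qed
  next
    case (add u v)
    show ?case
    proof
      assume "\<exists>C. \<forall>w. v w + u w \<le> C"
      then obtain C where C: "\<And>w. v w + u w \<le> C" by auto
      have "u w \<le> C" "v w \<le> C" for w
        using C[of w] add.hyps(2,4)[of w] by linarith+
      then have "u \<in> \<C>" "v \<in> \<C>" using add.IH by blast+
      then show "(\<lambda>w. v w + u w) \<in> \<C>" by (intro bounded_algebra.add[OF alg])
    qed
  next
    case (seq U)
    show ?case
    proof
      assume "\<exists>C. \<forall>w. f w \<le> C"
      then obtain C where C: "\<And>w. f w \<le> C" by auto
      have le: "U i w \<le> C" for i w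
      proof -
        have "incseq (\<lambda>i. U i w)"
          using seq.hyps(3) by (auto simp: incseq_def le_fun_def)
        from incseq_le[OF this seq.hyps(4), of i] C[of w] show ?thesis by simp
      qed
      then have "U i \<in> \<C>" for i using seq.IH by blast
      then show "f \<in> \<C>"
        by (rule lim[where C = C]) (use seq.hyps(2,4) le in auto)
    qed
  qed
  then show ?thesis using f(3) by blast
qed

section \<open>Density of trigonometric polynomials and uniqueness of characteristic functionals\<close>

inductive_set trig_polynomials :: "('w::{real_vector, topological_space} \<Rightarrow> real) set" where
  cos: "l \<in> dual_space \<Longrightarrow> (\<lambda>w. cos (l w + \<theta>)) \<in> trig_polynomials"
| add: "f \<in> trig_polynomials \<Longrightarrow> g \<in> trig_polynomials \<Longrightarrow> (\<lambda>w. f w + g w) \<in> trig_polynomials"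
| scale: "f \<in> trig_polynomials \<Longrightarrow> (\<lambda>w. r * f w) \<in> trig_polynomials"

lemma trig_polynomials_borel: "f \<in> trig_polynomials \<Longrightarrow> f \<in> borel_measurable borel"
proof (induction rule: trig_polynomials.induct)
  case (cos l \<theta>)
  from dual_space_borel[OF cos] show ?case by measurable
qed simp_all

lemma trig_polynomials_bounded: "f \<in> trig_polynomials \<Longrightarrow> \<exists>C. \<forall>w. \<bar>f w\<bar> \<le> C"
proof (induction rule: trig_polynomials.induct)
  case (cos l \<theta>)
  then show ?case by (auto intro: exI[of _ 1])
next
  case (add f g)
  then obtain C D where "\<And>w. \<bar>f w\<bar> \<le> C" "\<And>w. \<bar>g w\<bar> \<le> D" by auto
  then have "\<bar>f w + g w\<bar> \<le> C + D" for w
    by (meson abs_triangle_ineq add_mono order_trans)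
  then show ?case by blast
next
  case (scale f r)
  then obtain C where "\<And>w. \<bar>f w\<bar> \<le> C" by auto
  then have "\<bar>r * f w\<bar> \<le> \<bar>r\<bar> * C" for w
    by (simp add: abs_mult mult_left_mono)
  then show ?case by blast
qed

lemma trig_polynomials_const: "(\<lambda>w. c) \<in> trig_polynomials"
  using trig_polynomials.scale[OF trig_polynomials.cos[OF dual_space_zero, of 0], of c] by simp

lemma trig_polynomials_sin: "l \<in> dual_space \<Longrightarrow> (\<lambda>w. sin (l w)) \<in> trig_polynomials"
  using trig_polynomials.cos[of l "- pi / 2"] by (simp add: cos_diff)

lemma trig_polynomials_mult:
  assumes "f \<in> trig_polynomials" "g \<in> trig_polynomials"
  shows "(\<lambda>w. f w * g w) \<in> trig_polynomials"
proof -
  have times_cos: "(\<lambda>w. f w * cos (m w + \<phi>)) \<in> trig_polynomials" if m: "m \<in> dual_space" for m \<phi>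
    using assms(1)
  proof induction
    case (cos l \<theta>)
    have "(\<lambda>w. 1 / 2 * (cos (l w - m w + (\<theta> - \<phi>)) + cos (l w + m w + (\<theta> + \<phi>)))) \<in> trig_polynomials"
      by (intro trig_polynomials.intros dual_space_add dual_space_diff cos m)
    also have "(\<lambda>w. 1 / 2 * (cos (l w - m w + (\<theta> - \<phi>)) + cos (l w + m w + (\<theta> + \<phi>)))) =
        (\<lambda>w. cos (l w + \<theta>) * cos (m w + \<phi>))"
    proof
      fix w
      show "1 / 2 * (cos (l w - m w + (\<theta> - \<phi>)) + cos (l w + m w + (\<theta> + \<phi>))) = cos (l w + \<theta>) * cos (m w + \<phi>)"
        using cos_diff[of "l w + \<theta>" "m w + \<phi>"] cos_add[of "l w + \<theta>" "m w + \<phi>"]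
        by (simp add: algebra_simps)
    qed
    finally show ?case .
  next
    case (add f g)
    from trig_polynomials.add[OF add.IH] show ?case by (simp add: distrib_right)
  next
    case (scale f r)
    from trig_polynomials.scale[OF scale.IH, of r] show ?case by (simp add: mult.assoc)
  qed
  show ?thesis
    using assms(2)
  proof induction
    case (cos l \<theta>)
    then show ?case using times_cos by blast
  next
    case (add g h)
    from trig_polynomials.add[OF add.IH] show ?case by (simp add: distrib_left)
  next
    case (scale g r)
    from trig_polynomials.scale[OF scale.IH, of r] show ?case by (simp add: mult_ac)
  qed
qed

definition depends_only_on :: "('w \<Rightarrow> real) set \<Rightarrow> ('w \<Rightarrow> 'b) \<Rightarrow> bool" where
  "depends_only_on L f \<longleftrightarrow> (\<forall>w w'. (\<forall>l\<in>L. l w = l w') \<longrightarrow> f w = f w')"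

lemma depends_only_onI: "(\<And>w w'. (\<And>l. l \<in> L \<Longrightarrow> l w = l w') \<Longrightarrow> f w = f w') \<Longrightarrow> depends_only_on L f"
  unfolding depends_only_on_def by blast

lemma depends_only_onD: "depends_only_on L f \<Longrightarrow> (\<And>l. l \<in> L \<Longrightarrow> l w = l w') \<Longrightarrow> f w = f w'"
  unfolding depends_only_on_def by blast

lemma depends_only_on_mono: "depends_only_on K f \<Longrightarrow> K \<subseteq> L \<Longrightarrow> depends_only_on L f"
  unfolding depends_only_on_def by blast

lemma trig_polynomials_depend_on_finite:
  assumes "f \<in> trig_polynomials"
  obtains L where "finite L" "L \<subseteq> dual_space" "depends_only_on L f"
proof -
  have "\<exists>L. finite L \<and> L \<subseteq> dual_space \<and> depends_only_on L f"
    using assms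
  proof induction
    case (cos l \<theta>)
    then show ?case by (intro exI[of _ "{l}"]) (simp add: depends_only_on_def)
  next
    case (add f g)
    then obtain K L where
      KL: "finite K" "K \<subseteq> dual_space" "depends_only_on K f" "finite L" "L \<subseteq> dual_space" "depends_only_on L g"
      by blast
    have "depends_only_on (K \<union> L) (\<lambda>w. f w + g w)"
    proof (rule depends_only_onI)
      fix w w' assume eq: "\<And>l. l \<in> K \<union> L \<Longrightarrow> l w = l w'"
      have "f w = f w'" by (rule depends_only_onD[OF KL(3)]) (simp add: eq)
      moreover have "g w = g w'" by (rule depends_only_onD[OF KL(6)]) (simp add: eq)
      ultimately show "f w + g w = f w' + g w'" by simp
    qed
    with KL show ?case by (intro exI[of _ "K \<union> L"]) simp
  next
    case (scale f r)
    then obtain L where L: "finite L" "L \<subseteq> dual_space" "depends_only_on L f"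
      by blast
    have "depends_only_on L (\<lambda>w. r * f w)"
    proof (rule depends_only_onI)
      fix w w' assume "\<And>l. l \<in> L \<Longrightarrow> l w = l w'"
      then have "f w = f w'" by (rule depends_only_onD[OF L(3)])
      then show "r * f w = r * f w'" by simp
    qed
    with L show ?case by blast
  qed
  then show thesis using that by blast
qed

text \<open>
  Approximability in \<open>L\<^sup>1\<close> of all measures of a family by the same trigonometric polynomial. A single
  measure gives density; a pair gives uniqueness, because the same polynomial then compares both.
\<close>

definition trig_approximable :: "('w::{real_vector, topological_space}) measure set \<Rightarrow> ('w \<Rightarrow> real) set" where
  "trig_approximable \<M> = {f. f \<in> borel_measurable borel \<and> (\<exists>C. \<forall>w. \<bar>f w\<bar> \<le> C) \<and>
     (\<forall>e>0. \<exists>g\<in>trig_polynomials. \<forall>M\<in>\<M>. (\<integral>\<^sup>+w. ennreal \<bar>f w - g w\<bar> \<partial>M) \<le> ennreal e)}"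

lemma trig_approximableI:
  assumes "f \<in> borel_measurable borel" "\<And>w. \<bar>f w\<bar> \<le> C"
    and "\<And>e. e > 0 \<Longrightarrow> \<exists>g\<in>trig_polynomials. \<forall>M\<in>\<M>. (\<integral>\<^sup>+w. ennreal \<bar>f w - g w\<bar> \<partial>M) \<le> ennreal e"
  shows "f \<in> trig_approximable \<M>"
  using assms unfolding trig_approximable_def by blast

lemma trig_approximableD:
  assumes "f \<in> trig_approximable \<M>"
  shows "f \<in> borel_measurable borel" "\<exists>C. \<forall>w. \<bar>f w\<bar> \<le> C"
    "e > 0 \<Longrightarrow> \<exists>g\<in>trig_polynomials. \<forall>M\<in>\<M>. (\<integral>\<^sup>+w. ennreal \<bar>f w - g w\<bar> \<partial>M) \<le> ennreal e"
  using assms by (auto simp: trig_approximable_def)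

lemma nn_integral_le_combination:
  assumes [measurable]: "u \<in> borel_measurable M" "v \<in> borel_measurable M"
    and le: "\<And>w. \<bar>d w\<bar> \<le> A * \<bar>u w\<bar> + B * \<bar>v w\<bar>" and AB: "A \<ge> 0" "B \<ge> 0"
    and u: "(\<integral>\<^sup>+w. ennreal \<bar>u w\<bar> \<partial>M) \<le> ennreal x" and v: "(\<integral>\<^sup>+w. ennreal \<bar>v w\<bar> \<partial>M) \<le> ennreal y"
    and xy: "x \<ge> 0" "y \<ge> 0"
  shows "(\<integral>\<^sup>+w. ennreal \<bar>d w\<bar> \<partial>M) \<le> ennreal (A * x + B * (y::real))"
proof -
  have "(\<integral>\<^sup>+w. ennreal \<bar>d w\<bar> \<partial>M) \<le> (\<integral>\<^sup>+w. ennreal A * ennreal \<bar>u w\<bar> + ennreal B * ennreal \<bar>v w\<bar> \<partial>M)"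
    using le AB by (intro nn_integral_mono) (simp add: ennreal_mult[symmetric] ennreal_plus[symmetric] ennreal_leI del: ennreal_plus)
  also have "\<dots> = ennreal A * (\<integral>\<^sup>+w. ennreal \<bar>u w\<bar> \<partial>M) + ennreal B * (\<integral>\<^sup>+w. ennreal \<bar>v w\<bar> \<partial>M)"
    by (simp add: nn_integral_add nn_integral_cmult)
  also have "\<dots> \<le> ennreal A * ennreal x + ennreal B * ennreal y"
    by (intro add_mono mult_left_mono u v) auto
  also have "\<dots> = ennreal (A * x + B * y)"
    using AB xy by (simp add: ennreal_mult ennreal_plus)
  finally show ?thesis .
qed

lemma trig_polynomials_approximable: "f \<in> trig_polynomials \<Longrightarrow> f \<in> trig_approximable \<M>"
  using trig_polynomials_bounded[of f]
  by (auto simp: trig_approximable_def intro!: trig_polynomials_borel bexI[of _ f])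

text \<open>
  For the product \<open>f g\<close> the approximants are chosen one after the other: the tolerance for \<open>g\<close>
  depends on the sup norm of the approximant of \<open>f\<close>. Pointwise limits are handled by dominated
  convergence.
\<close>

lemma bounded_algebra_trig_approximable:
  fixes \<M> :: "'w::{real_vector, topological_space} measure set"
  assumes fin: "finite \<M>" and M: "\<And>M. M \<in> \<M> \<Longrightarrow> finite_measure M" "\<And>M. M \<in> \<M> \<Longrightarrow> sets M = sets borel"
  shows "bounded_algebra (trig_approximable \<M>)"
proof
  have meas: "f \<in> borel_measurable M" if "f \<in> borel_measurable borel" "M \<in> \<M>" for f :: "'w \<Rightarrow> real" and M
    using that(1) measurable_cong_sets[OF M(2)[OF that(2)] refl] by blast
  show "(\<lambda>w. c) \<in> trig_approximable \<M>" for c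
    by (intro trig_polynomials_approximable trig_polynomials_const)
  show "\<exists>C. \<forall>w. \<bar>f w\<bar> \<le> C" if "f \<in> trig_approximable \<M>" for f
    using trig_approximableD(2)[OF that] .
  fix f g assume f: "f \<in> trig_approximable \<M>" and g: "g \<in> trig_approximable \<M>"
  note [measurable] = trig_approximableD(1)[OF f] trig_approximableD(1)[OF g]
  obtain C D where CD: "\<And>w. \<bar>f w\<bar> \<le> C" "\<And>w. \<bar>g w\<bar> \<le> D"
    using trig_approximableD(2)[OF f] trig_approximableD(2)[OF g] by auto
  then have "C \<ge> 0" "D \<ge> 0" by (meson abs_ge_zero order_trans)+
  show "(\<lambda>w. f w + g w) \<in> trig_approximable \<M>"
  proof (rule trig_approximableI)
    show "\<bar>f w + g w\<bar> \<le> C + D" for w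
      using CD[of w] by linarith
    fix e :: real assume e: "e > 0"
    obtain f' where f': "f' \<in> trig_polynomials" "\<And>M. M \<in> \<M> \<Longrightarrow> (\<integral>\<^sup>+w. ennreal \<bar>f w - f' w\<bar> \<partial>M) \<le> ennreal (e / 2)"
      using trig_approximableD(3)[OF f, of "e / 2"] e by auto
    obtain g' where g': "g' \<in> trig_polynomials" "\<And>M. M \<in> \<M> \<Longrightarrow> (\<integral>\<^sup>+w. ennreal \<bar>g w - g' w\<bar> \<partial>M) \<le> ennreal (e / 2)"
      using trig_approximableD(3)[OF g, of "e / 2"] e by auto
    note [measurable] = trig_polynomials_borel[OF f'(1)] trig_polynomials_borel[OF g'(1)]
    have "(\<integral>\<^sup>+w. ennreal \<bar>f w + g w - (f' w + g' w)\<bar> \<partial>M) \<le> ennreal (1 * (e / 2) + 1 * (e / 2))" if "M \<in> \<M>" for M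
      using f' g' that e
      by (intro nn_integral_le_combination[where u = "\<lambda>w. f w - f' w" and v = "\<lambda>w. g w - g' w"])
        (auto intro!: meas[OF _ that])
    then show "\<exists>h\<in>trig_polynomials. \<forall>M\<in>\<M>. (\<integral>\<^sup>+w. ennreal \<bar>f w + g w - h w\<bar> \<partial>M) \<le> ennreal e"
      using trig_polynomials.add[OF f'(1) g'(1)] by (auto intro!: bexI)
  qed measurable
  show "(\<lambda>w. f w * g w) \<in> trig_approximable \<M>"
  proof (rule trig_approximableI)
    show "\<bar>f w * g w\<bar> \<le> C * D" for w
      using CD[of w] \<open>C \<ge> 0\<close> by (simp add: abs_mult mult_mono)
    fix e :: real assume e: "e > 0"
    define x where "x = e / 2 / (D + 1)"
    have x: "x > 0" using e \<open>D \<ge> 0\<close> by (simp add: x_def)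
    obtain f' where f': "f' \<in> trig_polynomials" "\<And>M. M \<in> \<M> \<Longrightarrow> (\<integral>\<^sup>+w. ennreal \<bar>f w - f' w\<bar> \<partial>M) \<le> ennreal x"
      using trig_approximableD(3)[OF f x] by auto
    obtain C' where C': "\<And>w. \<bar>f' w\<bar> \<le> C'"
      using trig_polynomials_bounded[OF f'(1)] by auto
    then have "C' \<ge> 0" by (meson abs_ge_zero order_trans)
    define y where "y = e / 2 / (C' + 1)"
    have y: "y > 0" using e \<open>C' \<ge> 0\<close> by (simp add: y_def)
    obtain g' where g': "g' \<in> trig_polynomials" "\<And>M. M \<in> \<M> \<Longrightarrow> (\<integral>\<^sup>+w. ennreal \<bar>g w - g' w\<bar> \<partial>M) \<le> ennreal y"
      using trig_approximableD(3)[OF g y] by auto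
    note [measurable] = trig_polynomials_borel[OF f'(1)] trig_polynomials_borel[OF g'(1)]
    have "(\<integral>\<^sup>+w. ennreal \<bar>f w * g w - f' w * g' w\<bar> \<partial>M) \<le> ennreal (D * x + C' * y)" if "M \<in> \<M>" for M
    proof (rule nn_integral_le_combination[where u = "\<lambda>w. f w - f' w" and v = "\<lambda>w. g w - g' w"])
      fix w
      have "\<bar>f w * g w - f' w * g' w\<bar> = \<bar>(f w - f' w) * g w + f' w * (g w - g' w)\<bar>"
        by (simp add: algebra_simps)
      also have "\<dots> \<le> \<bar>f w - f' w\<bar> * \<bar>g w\<bar> + \<bar>f' w\<bar> * \<bar>g w - g' w\<bar>"
        by (metis abs_mult abs_triangle_ineq)
      also have "\<dots> \<le> D * \<bar>f w - f' w\<bar> + C' * \<bar>g w - g' w\<bar>"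
        using CD(2)[of w] C'[of w] by (metis abs_ge_zero add_mono mult.commute mult_right_mono)
      finally show "\<bar>f w * g w - f' w * g' w\<bar> \<le> D * \<bar>f w - f' w\<bar> + C' * \<bar>g w - g' w\<bar>" .
    qed (use f' g' that x y \<open>D \<ge> 0\<close> \<open>C' \<ge> 0\<close> in \<open>auto intro!: meas[OF _ that]\<close>)
    moreover have "D * x \<le> e / 2" "C' * y \<le> e / 2"
      using e \<open>D \<ge> 0\<close> \<open>C' \<ge> 0\<close> by (auto simp: x_def y_def field_simps)
    then have "ennreal (D * x + C' * y) \<le> ennreal e"
      by (intro ennreal_leI) linarith
    ultimately show "\<exists>h\<in>trig_polynomials. \<forall>M\<in>\<M>. (\<integral>\<^sup>+w. ennreal \<bar>f w * g w - h w\<bar> \<partial>M) \<le> ennreal e"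
      using trig_polynomials_mult[OF f'(1) g'(1)] by (auto intro!: bexI intro: order_trans)
  qed measurable
next
  have meas: "f \<in> borel_measurable M" if "f \<in> borel_measurable borel" "M \<in> \<M>" for f :: "'w \<Rightarrow> real" and M
    using that(1) measurable_cong_sets[OF M(2)[OF that(2)] refl] by blast
  fix F :: "nat \<Rightarrow> 'w \<Rightarrow> real" and f C
  assume F: "\<And>n. F n \<in> trig_approximable \<M>" and bd: "\<And>n w. \<bar>F n w\<bar> \<le> C" and lim: "\<And>w. (\<lambda>n. F n w) \<longlonglongrightarrow> f w"
  have F_meas [measurable]: "F n \<in> borel_measurable borel" for n
    using trig_approximableD(1)[OF F] .
  have f_meas [measurable]: "f \<in> borel_measurable borel"
    by (rule borel_measurable_LIMSEQ_real[OF lim]) measurable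
  have C: "C \<ge> 0" using bd by (meson abs_ge_zero order_trans)
  have fC: "\<bar>f w\<bar> \<le> C" for w
    using bd by (intro LIMSEQ_le_const2[OF tendsto_rabs[OF lim]]) auto
  show "f \<in> trig_approximable \<M>"
  proof (rule trig_approximableI)
    show "\<bar>f w\<bar> \<le> C" for w by (rule fC)
    fix e :: real assume e: "e > 0"
    have conv: "(\<lambda>n. \<integral>\<^sup>+w. ennreal \<bar>f w - F n w\<bar> \<partial>M) \<longlonglongrightarrow> 0" if "M \<in> \<M>" for M
    proof -
      interpret finite_measure M by (rule M(1)[OF that])
      have [measurable]: "f \<in> borel_measurable M" "F n \<in> borel_measurable M" for n
        using meas[OF f_meas that] meas[OF F_meas that] by auto
      have "(\<lambda>n. \<integral>\<^sup>+w. ennreal \<bar>f w - F n w\<bar> \<partial>M) \<longlonglongrightarrow> (\<integral>\<^sup>+w. 0 \<partial>M)"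
      proof (rule nn_integral_dominated_convergence[where w = "\<lambda>_. ennreal (2 * C)"])
        show "AE w in M. ennreal \<bar>f w - F n w\<bar> \<le> ennreal (2 * C)" for n
        proof (intro AE_I2 ennreal_leI)
          show "\<bar>f w - F n w\<bar> \<le> 2 * C" for w using fC[of w] bd[of n w] by linarith
        qed
        show "AE w in M. (\<lambda>n. ennreal \<bar>f w - F n w\<bar>) \<longlonglongrightarrow> 0"
        proof (intro AE_I2)
          fix w
          have "(\<lambda>n. \<bar>f w - F n w\<bar>) \<longlonglongrightarrow> \<bar>f w - f w\<bar>"
            by (intro tendsto_intros lim)
          from tendsto_ennrealI[OF this] show "(\<lambda>n. ennreal \<bar>f w - F n w\<bar>) \<longlonglongrightarrow> 0" by simp
        qed
        show "(\<integral>\<^sup>+w. ennreal (2 * C) \<partial>M) < \<infinity>"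
        proof -
          have "emeasure M (space M) < top"
            using emeasure_finite[of "space M"] by (simp only: infinity_ennreal_def top.not_eq_extremum)
          then show ?thesis by (simp add: ennreal_mult_less_top)
        qed
      qed simp_all
      then show ?thesis by simp
    qed
    have "\<forall>\<^sub>F n in sequentially. \<forall>M\<in>\<M>. (\<integral>\<^sup>+w. ennreal \<bar>f w - F n w\<bar> \<partial>M) < ennreal (e / 2)"
      using e by (intro eventually_ball_finite fin ballI order_tendstoD(2)[OF conv]) auto
    then obtain n where n: "\<And>M. M \<in> \<M> \<Longrightarrow> (\<integral>\<^sup>+w. ennreal \<bar>f w - F n w\<bar> \<partial>M) \<le> ennreal (e / 2)"
      by (auto simp: eventually_sequentially intro: less_imp_le)
    obtain g where g: "g \<in> trig_polynomials" "\<And>M. M \<in> \<M> \<Longrightarrow> (\<integral>\<^sup>+w. ennreal \<bar>F n w - g w\<bar> \<partial>M) \<le> ennreal (e / 2)"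
      using trig_approximableD(3)[OF F, of "e / 2" n] e by auto
    note [measurable] = trig_polynomials_borel[OF g(1)]
    have "(\<integral>\<^sup>+w. ennreal \<bar>f w - g w\<bar> \<partial>M) \<le> ennreal (1 * (e / 2) + 1 * (e / 2))" if "M \<in> \<M>" for M
      using n g that e
      by (intro nn_integral_le_combination[where u = "\<lambda>w. f w - F n w" and v = "\<lambda>w. F n w - g w"])
        (auto intro!: meas[OF _ that])
    then show "\<exists>g\<in>trig_polynomials. \<forall>M\<in>\<M>. (\<integral>\<^sup>+w. ennreal \<bar>f w - g w\<bar> \<partial>M) \<le> ennreal e"
      using g(1) by auto
  qed measurable
qed

theorem trig_polynomials_dense:
  fixes \<M> :: "'w::{real_vector, polish_space} measure set"
  assumes frechet: "frechet_space TYPE('w)"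
    and \<M>: "finite \<M>" "\<And>M. M \<in> \<M> \<Longrightarrow> finite_measure M" "\<And>M. M \<in> \<M> \<Longrightarrow> sets M = sets borel"
    and f: "f \<in> borel_measurable borel" "\<And>w. 0 \<le> f w" "\<And>w. f w \<le> C" and e: "e > 0"
  obtains g where "g \<in> trig_polynomials" "\<And>M. M \<in> \<M> \<Longrightarrow> (\<integral>\<^sup>+w. ennreal \<bar>f w - g w\<bar> \<partial>M) \<le> ennreal e"
proof -
  have "f \<in> trig_approximable \<M>"
  proof (rule bounded_algebra_contains_borel[OF frechet])
    show "bounded_algebra (trig_approximable \<M>)"
      using \<M> by (rule bounded_algebra_trig_approximable)
    show "(\<lambda>w. sin (l w)) \<in> trig_approximable \<M>" if "l \<in> dual_space" for l
      using that by (intro trig_polynomials_approximable trig_polynomials_sin)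
  qed (use f in auto)
  from trig_approximableD(3)[OF this e] show thesis
    using that by blast
qed

theorem frechet_measure_eqI_cos:
  fixes M N :: "'w::{real_vector, polish_space} measure"
  assumes frechet: "frechet_space TYPE('w)"
    and M: "prob_space M" "sets M = sets borel" and N: "prob_space N" "sets N = sets borel"
    and eq: "\<And>l \<theta>. l \<in> dual_space \<Longrightarrow> (\<integral>w. cos (l w + \<theta>) \<partial>M) = (\<integral>w. cos (l w + \<theta>) \<partial>N)"
  shows "M = N"
proof (rule measure_eqI)
  show "sets M = sets N" using M N by simp
  interpret M: prob_space M by fact
  interpret N: prob_space N by fact
  have mM: "f \<in> borel_measurable M" and mN: "f \<in> borel_measurable N" if "f \<in> borel_measurable borel" for f :: "'w \<Rightarrow> real"
    using that measurable_cong_sets[OF M(2) refl] measurable_cong_sets[OF N(2) refl] by blast+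
  have intM: "integrable M f" and intN: "integrable N f" if f: "f \<in> trig_polynomials" for f
  proof -
    obtain C where "\<And>w. \<bar>f w\<bar> \<le> C" using trig_polynomials_bounded[OF f] by auto
    then show "integrable M f" "integrable N f"
      using mM[OF trig_polynomials_borel[OF f]] mN[OF trig_polynomials_borel[OF f]]
      by (simp_all add: M.integrable_const_bound[where B = C] N.integrable_const_bound[where B = C])
  qed
  have trig: "(\<integral>w. f w \<partial>M) = (\<integral>w. f w \<partial>N)" if "f \<in> trig_polynomials" for f
    using that by induction (auto simp: eq intM intN)
  fix A assume "A \<in> sets M"
  then have A [measurable]: "A \<in> sets borel" "A \<in> sets M" "A \<in> sets N" using M N by auto
  have "\<bar>measure M A - measure N A\<bar> \<le> e" if e: "e > 0" for e
  proof -
    have fm: "finite_measure K" and sm: "sets K = sets borel" if "K \<in> {M, N}" for K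
      using that M.finite_measure_axioms N.finite_measure_axioms M(2) N(2) by auto
    obtain g where g: "g \<in> trig_polynomials"
      "\<And>K. K \<in> {M, N} \<Longrightarrow> (\<integral>\<^sup>+w. ennreal \<bar>indicator A w - g w\<bar> \<partial>K) \<le> ennreal (e / 2)"
    proof (rule trig_polynomials_dense[OF frechet, of "{M, N}" "indicator A" 1 "e / 2"])
      show "(indicator A :: 'w \<Rightarrow> real) \<in> borel_measurable borel" by measurable
    qed (use fm sm e in auto)
    have close: "\<bar>measure K A - (\<integral>w. g w \<partial>K)\<bar> \<le> e / 2"
      if K: "K \<in> {M, N}" "finite_measure K" "integrable K g" "A \<in> sets K" for K
    proof -
      interpret finite_measure K by fact
      have iA: "integrable K (indicator A :: 'w \<Rightarrow> real)"
        by (intro integrable_const_bound[where B = 1]) (use K in auto)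
      have "\<bar>measure K A - (\<integral>w. g w \<partial>K)\<bar> = \<bar>\<integral>w. indicator A w - g w \<partial>K\<bar>"
        using iA K by simp
      also have "\<dots> \<le> (\<integral>w. \<bar>indicator A w - g w\<bar> \<partial>K)"
        by (rule integral_abs_bound)
      also have "\<dots> \<le> e / 2"
      proof -
        have "ennreal (\<integral>w. \<bar>indicator A w - g w\<bar> \<partial>K) = (\<integral>\<^sup>+w. ennreal \<bar>indicator A w - g w\<bar> \<partial>K)"
          using iA K(3) by (intro nn_integral_eq_integral[symmetric]) auto
        also have "\<dots> \<le> ennreal (e / 2)" by (rule g(2)[OF K(1)])
        finally show ?thesis using e by (subst (asm) ennreal_le_iff) auto
      qed
      finally show ?thesis .
    qed
    have "\<bar>measure M A - (\<integral>w. g w \<partial>M)\<bar> \<le> e / 2" "\<bar>measure N A - (\<integral>w. g w \<partial>N)\<bar> \<le> e / 2"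
      using close[OF _ M.finite_measure_axioms intM[OF g(1)] A(2)]
        close[OF _ N.finite_measure_axioms intN[OF g(1)] A(3)] by simp_all
    then show ?thesis using trig[OF g(1)] by linarith
  qed
  then have "\<bar>measure M A - measure N A\<bar> \<le> 0"
    by (rule field_le_epsilon) simp
  then show "emeasure M A = emeasure N A"
    by (simp add: M.emeasure_eq_measure N.emeasure_eq_measure)
qed

section \<open>Powers of extended nonnegative numbers\<close>

lemma ennpow_simps [simp]:
  "x ennpow 0 = 1" "s > 0 \<Longrightarrow> 0 ennpow s = 0" "s > 0 \<Longrightarrow> \<infinity> ennpow s = \<infinity>"
  by (auto simp: ennpow_def)

lemma ennpow_ennreal: "r > 0 \<Longrightarrow> ennreal r ennpow s = ennreal (r powr s)"
  by (auto simp: ennpow_def)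

lemma ennpow_product_ennreal:
  "x > 0 \<Longrightarrow> y > 0 \<Longrightarrow> ennreal x ennpow s * ennreal y ennpow t = ennreal (x powr s * y powr t)"
  by (simp add: ennpow_ennreal ennreal_mult)

lemma ennpow_one [simp]: "x ennpow 1 = x"
  by (cases x) (auto simp: ennpow_def)

lemma ennpow_mono: "x \<le> y \<Longrightarrow> s \<ge> 0 \<Longrightarrow> x ennpow s \<le> y ennpow s"
  by (cases x; cases y) (auto simp: ennpow_def top_unique intro!: powr_mono2)

lemma ennpow_mult: "s > 0 \<Longrightarrow> (x * y) ennpow s = x ennpow s * y ennpow s"
  by (cases x; cases y)
     (auto simp: ennpow_def ennreal_mult_top ennreal_top_mult powr_mult ennreal_mult'[symmetric] ennreal_mult_eq_top_iff)

lemma ennpow_add_self: "s > 0 \<Longrightarrow> t > 0 \<Longrightarrow> s + t = 1 \<Longrightarrow> x ennpow s * x ennpow t = x"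
  by (cases x) (auto simp: ennpow_def powr_add[symmetric] ennreal_mult'[symmetric])

lemma borel_measurable_ennpow [measurable (raw)]:
  assumes [measurable]: "f \<in> borel_measurable M"
  shows "(\<lambda>x. f x ennpow s) \<in> borel_measurable M"
  unfolding ennpow_def by measurable

text \<open>
  Lower semicontinuity of \<open>(X, Y) \<mapsto> X\<^sup>s Y\<^sup>t\<close>, with the convention \<open>0 \<cdot> \<infinity> = 0\<close>. It
  reduces inequalities between integrals to finite positive numbers below them.
\<close>

lemma ennpow_product_le_if_below:
  assumes st: "s > 0" "t > 0"
    and below: "\<And>x y. x > 0 \<Longrightarrow> y > 0 \<Longrightarrow> ennreal x < X \<Longrightarrow> ennreal y < Y \<Longrightarrow>
      ennreal (x powr s * y powr t) \<le> Z"
  shows "X ennpow s * Y ennpow t \<le> Z"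
proof (cases "X = 0 \<or> Y = 0")
  case True
  then show ?thesis using st by auto
next
  case False
  have approx: "\<exists>f. (\<forall>\<^sub>F n in sequentially. f n > 0 \<and> ennreal (f n) < X) \<and>
      ((\<lambda>n. ennreal (f n powr s)) \<longlonglongrightarrow> X ennpow s)" if "X \<noteq> 0" "s > 0" for X s
  proof (cases X)
    case (real r)
    with that have r: "r > 0" by auto
    define f where "f n = r * (1 - inverse (real (Suc n)))" for n
    have "f \<longlonglongrightarrow> r * (1 - 0)"
      unfolding f_def by (intro tendsto_intros LIMSEQ_inverse_real_of_nat)
    then have "(\<lambda>n. ennreal (f n powr s)) \<longlonglongrightarrow> ennreal (r powr s)"
      using r by (intro tendsto_intros tendsto_ennrealI) auto
    moreover have "\<forall>\<^sub>F n in sequentially. f n > 0 \<and> ennreal (f n) < X"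
      using eventually_gt_at_top[of 0]
    proof eventually_elim
      case (elim n)
      then have "inverse (real (Suc n)) < 1" "inverse (real (Suc n)) > 0"
        by (auto simp: field_simps)
      then show ?case using r real
        by (auto simp: f_def ennreal_less_iff mult_less_cancel_left1)
    qed
    ultimately show ?thesis using r real by (auto simp: ennpow_ennreal)
  next
    case top
    have "filterlim (\<lambda>n. real (Suc n) powr s) at_top sequentially"
      using that by real_asymp
    then have "(\<lambda>n. ennreal (real (Suc n) powr s)) \<longlonglongrightarrow> top"
      by (rule ennreal_tendsto_top_eq_at_top[THEN iffD2])
    then show ?thesis
      using top that by (intro exI[of _ "\<lambda>n. real (Suc n)"]) (auto simp: ennpow_def ennreal_less_top)
  qed
  obtain f where f: "\<forall>\<^sub>F n in sequentially. f n > 0 \<and> ennreal (f n) < X"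
    "(\<lambda>n. ennreal (f n powr s)) \<longlonglongrightarrow> X ennpow s"
    using approx[of X s] False st by auto
  obtain g where g: "\<forall>\<^sub>F n in sequentially. g n > 0 \<and> ennreal (g n) < Y"
    "(\<lambda>n. ennreal (g n powr t)) \<longlonglongrightarrow> Y ennpow t"
    using approx[of Y t] False st by auto
  have "X ennpow s \<noteq> 0" "Y ennpow t \<noteq> 0"
    using False st by (cases X; cases Y; auto simp: ennpow_def)+
  then have "(\<lambda>n. ennreal (f n powr s) * ennreal (g n powr t)) \<longlonglongrightarrow> X ennpow s * Y ennpow t"
    by (intro tendsto_mult_ennreal f g) auto
  moreover have "\<forall>\<^sub>F n in sequentially. ennreal (f n powr s) * ennreal (g n powr t) \<le> Z"
    using f(1) g(1) by eventually_elim (auto simp: ennreal_mult'[symmetric] below)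
  ultimately show ?thesis
    by (rule tendsto_upperbound) simp
qed

section \<open>An essential Brunn-Minkowski inequality on the line\<close>

text \<open>
  Otherwise almost every point of \<open>A\<close> lies in \<open>D = {x. F x > \<delta>}\<close>, where \<open>F x\<close> is the measure of
  the part of \<open>A\<close> above \<open>x\<close>. With \<open>\<alpha> = Sup D\<close>, no mass of \<open>A\<close> lies above \<open>\<alpha>\<close>, while continuity
  from above gives mass at least \<open>\<delta>\<close> to \<open>A \<inter> {\<alpha>..}\<close>.
\<close>

lemma ex_near_essential_top:
  fixes A :: "real set"
  assumes A [measurable]: "A \<in> sets borel" and fin: "emeasure lborel A < \<infinity>"
    and pos: "emeasure lborel A > 0" and P: "AE x in lborel. P x" and d: "\<delta> > 0"
  obtains x where "x \<in> A" "P x" "emeasure lborel (A \<inter> {x..}) \<le> \<delta>"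
proof -
  define F where "F x = emeasure lborel (A \<inter> {x..})" for x
  have F_antimono: "F y \<le> F x" if "x \<le> y" for x y
    unfolding F_def using that by (intro emeasure_mono) auto
  have F_fin: "F x \<noteq> \<infinity>" for x
  proof -
    have "F x \<le> emeasure lborel A" unfolding F_def by (intro emeasure_mono) auto
    with fin show ?thesis by (auto simp: top_unique)
  qed
  have lim: "(\<lambda>n. F (X n)) \<longlonglongrightarrow> emeasure lborel (\<Inter>n. A \<inter> {X n..})" if "incseq X" for X :: "nat \<Rightarrow> real"
    unfolding F_def
  proof (rule Lim_emeasure_decseq)
    show "decseq (\<lambda>n. A \<inter> {X n..})"
      using that by (force simp: decseq_def incseq_def intro: order_trans)
    show "emeasure lborel (A \<inter> {X n..}) \<noteq> \<infinity>" for n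
      using F_fin[of "X n"] by (simp add: F_def)
  qed auto
  define D where "D = {x. F x > \<delta>}"
  have "\<exists>x. x \<in> A \<and> P x \<and> F x \<le> \<delta>"
  proof (rule ccontr)
    assume "\<not> ?thesis"
    with P have AD: "AE x in lborel. x \<in> A \<longrightarrow> x \<in> D"
      by (auto simp: D_def not_le)
    have "D \<noteq> {}"
    proof
      assume "D = {}"
      with AD have "AE x in lborel. x \<notin> A" by simp
      then have "emeasure lborel A = 0"
        by (subst (asm) AE_iff_measurable[of A]) auto
      with pos show False by simp
    qed
    have "\<exists>n. x \<notin> {real n..}" for x
      using reals_Archimedean2[of x] by (auto simp: not_le)
    then have "(\<Inter>n. A \<inter> {real n..}) = {}"
      by blast
    with lim[of real] have "(\<lambda>n. F (real n)) \<longlonglongrightarrow> 0"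
      by (simp add: incseq_def)
    from order_tendstoD(2)[OF this d] obtain n where n: "F (real n) < \<delta>"
      by (auto simp: eventually_sequentially)
    have Dn: "x \<le> real n" if "x \<in> D" for x
      using that F_antimono[of "real n" x] n by (force simp: D_def)
    define \<alpha> where "\<alpha> = Sup D"
    have upper: "x \<le> \<alpha>" if "x \<in> D" for x
      unfolding \<alpha>_def using that Dn by (intro cSup_upper bdd_aboveI[where M = "real n"]) auto
    have less: "F x > \<delta>" if x: "x < \<alpha>" for x
    proof -
      obtain y where "y \<in> D" "x < y"
        using less_cSupD[OF \<open>D \<noteq> {}\<close>, of x] x unfolding \<alpha>_def by blast
      then show ?thesis using F_antimono[of x y] by (auto simp: D_def)
    qed
    define X where "X n = \<alpha> - inverse (real (Suc n))" for n
    have X_lim: "X \<longlonglongrightarrow> \<alpha>"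
      unfolding X_def using tendsto_diff[OF tendsto_const LIMSEQ_inverse_real_of_nat, of \<alpha>] by simp
    have X_less: "X n < \<alpha>" for n
      by (simp add: X_def)
    have "incseq X"
      by (auto simp: incseq_def X_def field_simps)
    have "(\<Inter>n. A \<inter> {X n..}) = A \<inter> {\<alpha>..}"
    proof (intro equalityI subsetI)
      fix x assume "x \<in> (\<Inter>n. A \<inter> {X n..})"
      then show "x \<in> A \<inter> {\<alpha>..}"
        using LIMSEQ_le_const2[OF X_lim, of x] by auto
    next
      fix x assume "x \<in> A \<inter> {\<alpha>..}"
      then show "x \<in> (\<Inter>n. A \<inter> {X n..})"
        using order_trans[OF less_imp_le[OF X_less]] by simp
    qed
    with lim[OF \<open>incseq X\<close>] have "(\<lambda>n. F (X n)) \<longlonglongrightarrow> F \<alpha>"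
      by (simp add: F_def)
    then have "\<delta> \<le> F \<alpha>"
      by (rule LIMSEQ_le_const) (use less X_less in \<open>auto intro!: exI[of _ 0] less_imp_le\<close>)
    moreover have "F \<alpha> = 0"
    proof -
      have "AE x in lborel. x \<noteq> \<alpha>" by (rule AE_lborel_singleton)
      with AD have "AE x in lborel. x \<notin> A \<inter> {\<alpha>..}"
        by eventually_elim (auto dest: upper)
      then show ?thesis
        unfolding F_def by (subst (asm) AE_iff_measurable[of "A \<inter> {\<alpha>..}"]) auto
    qed
    ultimately show False using d by simp
  qed
  then show thesis using that by (auto simp: F_def)
qed

lemma ex_near_essential_bottom:
  fixes A :: "real set"
  assumes A [measurable]: "A \<in> sets borel" and fin: "emeasure lborel A < \<infinity>"
    and pos: "emeasure lborel A > 0" and P: "AE x in lborel. P x" and d: "\<delta> > 0"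
  obtains x where "x \<in> A" "P x" "emeasure lborel (A \<inter> {..x}) \<le> \<delta>"
proof -
  have refl: "emeasure lborel (uminus -` B) = emeasure lborel B" if "B \<in> sets borel" for B :: "real set"
    using emeasure_distr[of uminus lborel borel B] that by (simp add: lborel_distr_uminus)
  obtain N where N: "N \<in> sets borel" "emeasure lborel N = 0" "{x. \<not> P x} \<subseteq> N"
    using P by (auto elim!: AE_E)
  have "uminus -` N \<in> sets borel"
    using N(1) measurable_sets_borel[of uminus borel N] by simp
  then have "AE x in lborel. x \<notin> uminus -` N"
    using N refl[of N] by (intro AE_not_in) (auto simp: null_sets_def)
  then have P': "AE x in lborel. P (- x)"
    using N by (auto elim!: eventually_mono)
  have "uminus -` A \<in> sets borel"
    using A measurable_sets_borel[of uminus borel A] by simp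
  then obtain x where x: "x \<in> uminus -` A" "P (- x)" "emeasure lborel (uminus -` A \<inter> {x..}) \<le> \<delta>"
    using ex_near_essential_top[OF _ _ _ P' d, of "uminus -` A"] fin pos refl[OF A] by auto
  have "uminus -` (A \<inter> {..- x}) = uminus -` A \<inter> {x..}"
    by auto
  with refl[of "A \<inter> {..- x}"] x that[of "- x"] show thesis by simp
qed

lemma emeasure_lborel_affine_preimage:
  fixes A :: "real set"
  assumes [measurable]: "A \<in> sets borel" and s: "s > 0"
  shows "emeasure lborel {z. (z - c) / s \<in> A} = ennreal s * emeasure lborel A"
proof -
  have [measurable]: "{z. (z - c) / s \<in> A} \<in> sets borel"
    by measurable
  have "emeasure lborel {z. (z - c) / s \<in> A} = (\<integral>\<^sup>+z. indicator {z. (z - c) / s \<in> A} z \<partial>lborel)"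
    by simp
  also have "\<dots> = ennreal s * (\<integral>\<^sup>+z. indicator {z. (z - c) / s \<in> A} (c + s * z) \<partial>lborel)"
    using s by (subst nn_integral_real_affine[of _ s c]) auto
  also have "(\<lambda>z. indicator {z. (z - c) / s \<in> A} (c + s * z) :: ennreal) = indicator A"
    using s by (auto simp: indicator_def)
  finally show ?thesis by simp
qed

text \<open>
  Choose \<open>x \<in> A\<close> with almost nothing of \<open>A\<close> above it and \<open>y \<in> B\<close> with almost nothing of \<open>B\<close> below
  it. The rest of \<open>s A + t y\<close> lies below \<open>s x + t y\<close> and the rest of \<open>s x + t B\<close> above it, so these
  pieces are disjoint, and for almost all choices of \<open>x\<close> and \<open>y\<close> they lie in \<open>C\<close> up to null sets.
  Only sections at two points are used, which is why an almost everywhere hypothesis is enough.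
\<close>

lemma essential_Brunn_Minkowski_finite:
  fixes A B C :: "real set"
  assumes [measurable]: "A \<in> sets borel" "B \<in> sets borel" "C \<in> sets borel"
    and s: "s > 0" and t: "t > 0"
    and pos: "emeasure lborel A > 0" "emeasure lborel B > 0"
    and fin: "emeasure lborel A < \<infinity>" "emeasure lborel B < \<infinity>"
    and AE: "AE x in lborel. AE y in lborel. x \<in> A \<longrightarrow> y \<in> B \<longrightarrow> s * x + t * y \<in> C"
  shows "ennreal s * emeasure lborel A + ennreal t * emeasure lborel B \<le> emeasure lborel C"
proof (rule ennreal_le_epsilon)
  fix e :: real assume e: "e > 0"
  define \<delta> where "\<delta> = e / (s + t)"
  have d: "ennreal \<delta> > 0" using e s t by (auto simp: \<delta>_def)
  have AE': "AE y in lborel. AE x in lborel. x \<in> A \<longrightarrow> y \<in> B \<longrightarrow> s * x + t * y \<in> C"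
    using AE by (subst lborel_pair.AE_commute[symmetric]) measurable
  obtain x where x: "x \<in> A" "AE y in lborel. x \<in> A \<longrightarrow> y \<in> B \<longrightarrow> s * x + t * y \<in> C"
    "emeasure lborel (A \<inter> {x..}) \<le> \<delta>"
    using ex_near_essential_top[OF _ fin(1) pos(1) AE d] by auto
  obtain y where y: "y \<in> B" "AE x in lborel. x \<in> A \<longrightarrow> y \<in> B \<longrightarrow> s * x + t * y \<in> C"
    "emeasure lborel (B \<inter> {..y}) \<le> \<delta>"
    using ex_near_essential_bottom[OF _ fin(2) pos(2) AE' d] by auto
  define A' B' where "A' = A \<inter> {..<x}" and "B' = B \<inter> {y<..}"
  have [measurable]: "A' \<in> sets borel" "B' \<in> sets borel" by (auto simp: A'_def B'_def)
  have A': "emeasure lborel A \<le> emeasure lborel A' + \<delta>"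
  proof -
    have "emeasure lborel A \<le> emeasure lborel (A' \<union> (A \<inter> {x..}))"
      by (intro emeasure_mono) (auto simp: A'_def)
    also have "\<dots> \<le> emeasure lborel A' + emeasure lborel (A \<inter> {x..})"
      by (intro emeasure_subadditive) auto
    also have "\<dots> \<le> emeasure lborel A' + \<delta>"
      using x by (intro add_mono) auto
    finally show ?thesis .
  qed
  have B': "emeasure lborel B \<le> emeasure lborel B' + \<delta>"
  proof -
    have "emeasure lborel B \<le> emeasure lborel (B' \<union> (B \<inter> {..y}))"
      by (intro emeasure_mono) (auto simp: B'_def)
    also have "\<dots> \<le> emeasure lborel B' + emeasure lborel (B \<inter> {..y})"
      by (intro emeasure_subadditive) auto
    also have "\<dots> \<le> emeasure lborel B' + \<delta>"
      using y by (intro add_mono) auto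
    finally show ?thesis .
  qed
  define S1 S2 where "S1 = {z. (z - t * y) / s \<in> A'}" and "S2 = {z. (z - s * x) / t \<in> B'}"
  have [measurable]: "S1 \<in> sets borel" "S2 \<in> sets borel"
    unfolding S1_def S2_def by measurable
  have "AE z in lborel. z \<in> S1 \<longrightarrow> z \<in> C"
  proof -
    have "AE z in lborel. - t * y / s + 1 / s * z \<in> A \<longrightarrow> s * (- t * y / s + 1 / s * z) + t * y \<in> C"
      using y(1,2) s by (intro AE_borel_affine[where P = "\<lambda>x. x \<in> A \<longrightarrow> s * x + t * y \<in> C"]) auto
    moreover have "- t * y / s + 1 / s * z = (z - t * y) / s" "s * ((z - t * y) / s) + t * y = z" for z
      using s by (simp add: diff_divide_distrib, simp)
    ultimately have "AE z in lborel. (z - t * y) / s \<in> A \<longrightarrow> z \<in> C"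
      by (simp only:)
    then show ?thesis
      by eventually_elim (auto simp: S1_def A'_def)
  qed
  moreover have "AE z in lborel. z \<in> S2 \<longrightarrow> z \<in> C"
  proof -
    have "AE z in lborel. - s * x / t + 1 / t * z \<in> B \<longrightarrow> s * x + t * (- s * x / t + 1 / t * z) \<in> C"
      using x(1,2) t by (intro AE_borel_affine[where P = "\<lambda>y. y \<in> B \<longrightarrow> s * x + t * y \<in> C"]) auto
    moreover have "- s * x / t + 1 / t * z = (z - s * x) / t" "s * x + t * ((z - s * x) / t) = z" for z
      using t by (simp add: diff_divide_distrib, simp)
    ultimately have "AE z in lborel. (z - s * x) / t \<in> B \<longrightarrow> z \<in> C"
      by (simp only:)
    then show ?thesis
      by eventually_elim (auto simp: S2_def B'_def)
  qed
  ultimately have "AE z in lborel. z \<in> S1 \<union> S2 \<longrightarrow> z \<in> C"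
    by eventually_elim auto
  then have "emeasure lborel (S1 \<union> S2) \<le> emeasure lborel C"
    by (intro emeasure_mono_AE) auto
  moreover have "S1 \<inter> S2 = {}"
    using s t by (auto simp: S1_def S2_def A'_def B'_def field_simps)
  then have "emeasure lborel (S1 \<union> S2) = emeasure lborel S1 + emeasure lborel S2"
    by (intro plus_emeasure[symmetric]) auto
  moreover have "emeasure lborel S1 = ennreal s * emeasure lborel A'"
    "emeasure lborel S2 = ennreal t * emeasure lborel B'"
    unfolding S1_def S2_def using s t by (auto intro: emeasure_lborel_affine_preimage)
  ultimately have C: "ennreal s * emeasure lborel A' + ennreal t * emeasure lborel B' \<le> emeasure lborel C"
    by simp
  have "ennreal s * emeasure lborel A + ennreal t * emeasure lborel B \<le>
      ennreal s * (emeasure lborel A' + \<delta>) + ennreal t * (emeasure lborel B' + \<delta>)"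
    by (intro add_mono mult_left_mono A' B') auto
  also have "\<dots> = (ennreal s * emeasure lborel A' + ennreal t * emeasure lborel B') + (ennreal s * \<delta> + ennreal t * \<delta>)"
    by (simp add: distrib_left ac_simps)
  also have "ennreal s * \<delta> + ennreal t * \<delta> = ennreal e"
    using s t e by (simp add: \<delta>_def ennreal_mult[symmetric] ennreal_plus[symmetric] add_divide_distrib[symmetric] distrib_right[symmetric] del: ennreal_plus)
  also have "(ennreal s * emeasure lborel A' + ennreal t * emeasure lborel B') + ennreal e \<le> emeasure lborel C + ennreal e"
    by (intro add_mono C) auto
  finally show "ennreal s * emeasure lborel A + ennreal t * emeasure lborel B \<le> emeasure lborel C + ennreal e" .
qed

lemma essential_Brunn_Minkowski:
  fixes A B C :: "real set"
  assumes [measurable]: "A \<in> sets borel" "B \<in> sets borel" "C \<in> sets borel"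
    and s: "s > 0" and t: "t > 0"
    and pos: "emeasure lborel A > 0" "emeasure lborel B > 0"
    and AE: "AE x in lborel. AE y in lborel. x \<in> A \<longrightarrow> y \<in> B \<longrightarrow> s * x + t * y \<in> C"
  shows "ennreal s * emeasure lborel A + ennreal t * emeasure lborel B \<le> emeasure lborel C"
proof -
  define I where "I n = {- real n..real n}" for n
  have lim: "(\<lambda>n. emeasure lborel (S \<inter> I n)) \<longlonglongrightarrow> emeasure lborel S" if [measurable]: "S \<in> sets borel" for S :: "real set"
  proof -
    have "incseq (\<lambda>n. S \<inter> I n)"
      by (auto simp: incseq_def I_def)
    moreover have "(\<Union>n. S \<inter> I n) = S"
    proof -
      have "\<exists>n. x \<in> I n" for x
      proof -
        obtain n where "\<bar>x\<bar> \<le> real n" using real_arch_simple by blast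
        then have "x \<in> I n" by (auto simp: I_def abs_le_iff)
        then show ?thesis ..
      qed
      then show ?thesis by blast
    qed
    moreover have "range (\<lambda>n. S \<inter> I n) \<subseteq> sets lborel"
      using that by (auto simp: I_def)
    ultimately show ?thesis
      using Lim_emeasure_incseq[of "\<lambda>n. S \<inter> I n" lborel] by simp
  qed
  have fin: "emeasure lborel (S \<inter> I n) < \<infinity>" if [measurable]: "S \<in> sets borel" for S n
  proof -
    have "emeasure lborel (S \<inter> I n) \<le> emeasure lborel (I n)"
      by (intro emeasure_mono) (auto simp: I_def)
    also have "\<dots> < \<infinity>" by (simp add: I_def)
    finally show ?thesis .
  qed
  have "\<forall>\<^sub>F n in sequentially. emeasure lborel (A \<inter> I n) > 0" "\<forall>\<^sub>F n in sequentially. emeasure lborel (B \<inter> I n) > 0"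
    using pos by (auto intro!: order_tendstoD(1)[OF lim])
  then have "\<forall>\<^sub>F n in sequentially. ennreal s * emeasure lborel (A \<inter> I n) + ennreal t * emeasure lborel (B \<inter> I n) \<le> emeasure lborel C"
  proof eventually_elim
    case (elim n)
    from AE have "AE x in lborel. AE y in lborel. x \<in> A \<inter> I n \<longrightarrow> y \<in> B \<inter> I n \<longrightarrow> s * x + t * y \<in> C"
      by (rule eventually_mono) (auto elim!: eventually_mono)
    then show ?case
      using elim s t fin by (intro essential_Brunn_Minkowski_finite) (auto simp: I_def)
  qed
  moreover have "(\<lambda>n. ennreal s * emeasure lborel (A \<inter> I n) + ennreal t * emeasure lborel (B \<inter> I n)) \<longlonglongrightarrow>
      ennreal s * emeasure lborel A + ennreal t * emeasure lborel B"
    using s t by (intro tendsto_add tendsto_mult_ennreal tendsto_const lim) auto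
  ultimately show ?thesis
    by (intro tendsto_upperbound) auto
qed

section \<open>An essential Prekopa-Leindler inequality on the line\<close>

lemma ennpow_AM_GM:
  assumes st: "s > 0" "t > 0" "s + t = 1"
  shows "x ennpow s * y ennpow t \<le> ennreal s * x + ennreal t * y"
proof (cases "x = 0 \<or> y = 0 \<or> x = \<infinity> \<or> y = \<infinity>")
  case True
  then show ?thesis using st by (auto simp: ennreal_mult_top)
next
  case False
  then obtain u v where uv: "x = ennreal u" "u > 0" "y = ennreal v" "v > 0"
    by (cases x; cases y) (auto simp: less_le)
  have "u powr s * v powr t \<le> s * u + t * v"
    using uv st by (intro Youngs_inequality_0) auto
  then show ?thesis
    using uv st by (simp add: ennpow_ennreal ennreal_mult[symmetric] ennreal_plus[symmetric] ennreal_leI del: ennreal_plus)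
qed

text \<open>
  Layer-cake estimates over the levels in \<open>(0, 1)\<close>: strict superlevel sets bound a truncated value
  from above, and weak superlevel sets bound a value from below.
\<close>

lemma layer_lower:
  assumes M: "M > 0"
  shows "min v (ennreal M) \<le> ennreal M * (\<integral>\<^sup>+\<rho>. indicator {0<..<1} \<rho> * indicator {\<rho>. ennreal (M * \<rho>) < v} \<rho> \<partial>lborel)"
proof -
  obtain r where r: "min v (ennreal M) = ennreal r" "0 \<le> r" "r \<le> M"
    using min.cobounded2[of v "ennreal M"] M
    by (cases "min v (ennreal M)") (simp_all only: ennreal_le_iff less_imp_le top_unique ennreal_neq_top)
  have "ennreal (r / M) = (\<integral>\<^sup>+\<rho>. indicator {0<..<r / M} \<rho> \<partial>lborel)"
    using r M by simp
  also have "\<dots> \<le> (\<integral>\<^sup>+\<rho>. indicator {0<..<1} \<rho> * indicator {\<rho>. ennreal (M * \<rho>) < v} \<rho> \<partial>lborel)"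
  proof (intro nn_integral_mono)
    fix \<rho> :: real
    have "ennreal (M * \<rho>) < v" "\<rho> < 1" if l: "0 < \<rho>" "\<rho> < r / M"
    proof -
      have "M * \<rho> < r" using l M by (simp add: field_simps)
      then have "ennreal (M * \<rho>) < ennreal r"
        using l M by (intro ennreal_lessI) (auto intro: less_trans[OF mult_pos_pos])
      also have "ennreal r \<le> v" using r(1) by (metis min.cobounded1)
      finally show "ennreal (M * \<rho>) < v" .
      have "r / M \<le> 1" using r M by simp
      with l show "\<rho> < 1" by simp
    qed
    then show "indicator {0<..<r / M} \<rho> \<le> (indicator {0<..<1} \<rho> * indicator {\<rho>. ennreal (M * \<rho>) < v} \<rho> :: ennreal)"
      by (auto simp: indicator_def)
  qed
  finally have "ennreal M * ennreal (r / M) \<le> ennreal M * (\<integral>\<^sup>+\<rho>. indicator {0<..<1} \<rho> * indicator {\<rho>. ennreal (M * \<rho>) < v} \<rho> \<partial>lborel)"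
    by (intro mult_left_mono) auto
  also have "ennreal M * ennreal (r / M) = ennreal r"
    using M r by (simp add: ennreal_mult[symmetric])
  finally show ?thesis using r by simp
qed

lemma layer_upper:
  assumes K: "K > 0"
  shows "ennreal K * (\<integral>\<^sup>+\<rho>. indicator {0<..<1} \<rho> * indicator {\<rho>. ennreal (K * \<rho>) \<le> v} \<rho> \<partial>lborel) \<le> v"
proof (cases v)
  case (real r)
  have "(\<integral>\<^sup>+\<rho>. indicator {0<..<1} \<rho> * indicator {\<rho>. ennreal (K * \<rho>) \<le> v} \<rho> \<partial>lborel) \<le> (\<integral>\<^sup>+\<rho>. indicator {0..r / K} \<rho> \<partial>lborel)"
    using K real by (intro nn_integral_mono) (auto simp: indicator_def ennreal_le_iff field_simps)
  also have "\<dots> = ennreal (r / K)"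
    using real K by simp
  finally have "ennreal K * (\<integral>\<^sup>+\<rho>. indicator {0<..<1} \<rho> * indicator {\<rho>. ennreal (K * \<rho>) \<le> v} \<rho> \<partial>lborel) \<le> ennreal K * ennreal (r / K)"
    by (intro mult_left_mono) auto
  also have "\<dots> = v"
    using K real by (simp add: ennreal_mult[symmetric])
  finally show ?thesis .
qed simp

text \<open>
  Rescale so that both truncation levels become 1. Then every level \<open>\<rho> \<in> (0, 1)\<close> has superlevel sets
  of positive measure for both \<open>g\<close> and \<open>h\<close>, so the Brunn-Minkowski inequality applies to all levels;
  integrating over \<open>\<rho>\<close> gives an arithmetic mean, which dominates the geometric mean.
\<close>

lemma essential_Prekopa_Leindler_truncated:
  fixes f g h :: "real \<Rightarrow> ennreal"
  assumes [measurable]: "f \<in> borel_measurable borel" "g \<in> borel_measurable borel" "h \<in> borel_measurable borel"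
    and st: "s > 0" "t > 0" "s + t = 1"
    and AE: "AE x in lborel. AE y in lborel. g x ennpow s * h y ennpow t \<le> f (s * x + t * y)"
    and M: "M > 0" "ennreal M \<le> esssup lborel g" and N: "N > 0" "ennreal N \<le> esssup lborel h"
  shows "(\<integral>\<^sup>+x. min (g x) M \<partial>lborel) ennpow s * (\<integral>\<^sup>+x. min (h x) N \<partial>lborel) ennpow t \<le> (\<integral>\<^sup>+x. f x \<partial>lborel)"
proof -
  define K where "K = M powr s * N powr t"
  have K: "K > 0" using M N by (simp add: K_def)
  define I where "I = (indicator {0<..<1} :: real \<Rightarrow> ennreal)"
  have [measurable]: "I \<in> borel_measurable borel" by (simp add: I_def)
  define G where "G = (\<integral>\<^sup>+\<rho>. I \<rho> * emeasure lborel {x. ennreal (M * \<rho>) < g x} \<partial>lborel)"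
  define H where "H = (\<integral>\<^sup>+\<rho>. I \<rho> * emeasure lborel {x. ennreal (N * \<rho>) < h x} \<partial>lborel)"
  have swap: "(\<integral>\<^sup>+x. (\<integral>\<^sup>+\<rho>. I \<rho> * indicator {\<rho>. P \<rho> x} \<rho> \<partial>lborel) \<partial>lborel) = (\<integral>\<^sup>+\<rho>. I \<rho> * emeasure lborel {x. P \<rho> x} \<partial>lborel)"
    if P [measurable]: "Measurable.pred (borel \<Otimes>\<^sub>M borel) (\<lambda>(x, \<rho>). P \<rho> x)" for P :: "real \<Rightarrow> real \<Rightarrow> bool"
  proof -
    have ind: "indicator {\<rho>. P \<rho> x} \<rho> = (indicator {z. case z of (x, \<rho>) \<Rightarrow> P \<rho> x} (x, \<rho>) :: ennreal)" for x \<rho>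
      by (simp add: indicator_def)
    have [measurable]: "{z. case z of (x, \<rho>) \<Rightarrow> P \<rho> x} \<in> sets (borel \<Otimes>\<^sub>M borel)"
      using P by (simp add: pred_def space_pair_measure)
    have "(\<integral>\<^sup>+x. (\<integral>\<^sup>+\<rho>. I \<rho> * indicator {\<rho>. P \<rho> x} \<rho> \<partial>lborel) \<partial>lborel) = (\<integral>\<^sup>+\<rho>. (\<integral>\<^sup>+x. I \<rho> * indicator {\<rho>. P \<rho> x} \<rho> \<partial>lborel) \<partial>lborel)"
      unfolding ind by (rule lborel_pair.Fubini'[symmetric]) measurable
    also have "\<dots> = (\<integral>\<^sup>+\<rho>. I \<rho> * emeasure lborel {x. P \<rho> x} \<partial>lborel)"
    proof (intro nn_integral_cong)
      fix \<rho> :: real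
      have [measurable]: "{x. P \<rho> x} \<in> sets borel"
      proof -
        have "Measurable.pred borel (\<lambda>x. P \<rho> x)" by measurable
        then show ?thesis by (simp add: pred_def)
      qed
      have "(\<integral>\<^sup>+x. I \<rho> * indicator {\<rho>. P \<rho> x} \<rho> \<partial>lborel) = (\<integral>\<^sup>+x. I \<rho> * indicator {x. P \<rho> x} x \<partial>lborel)"
        by (simp add: indicator_def)
      also have "\<dots> = I \<rho> * emeasure lborel {x. P \<rho> x}"
        by (simp add: nn_integral_cmult)
      finally show "(\<integral>\<^sup>+x. I \<rho> * indicator {\<rho>. P \<rho> x} \<rho> \<partial>lborel) = I \<rho> * emeasure lborel {x. P \<rho> x}" .
    qed
    finally show ?thesis .
  qed
  have bound: "(\<integral>\<^sup>+x. min (u x) (ennreal L) \<partial>lborel) \<le> ennreal L * (\<integral>\<^sup>+\<rho>. I \<rho> * emeasure lborel {x. ennreal (L * \<rho>) < u x} \<partial>lborel)"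
    if [measurable]: "u \<in> borel_measurable borel" and L: "L > 0" for u :: "real \<Rightarrow> ennreal" and L
  proof -
    have "(\<integral>\<^sup>+x. min (u x) (ennreal L) \<partial>lborel) \<le> (\<integral>\<^sup>+x. ennreal L * (\<integral>\<^sup>+\<rho>. I \<rho> * indicator {\<rho>. ennreal (L * \<rho>) < u x} \<rho> \<partial>lborel) \<partial>lborel)"
      using layer_lower[OF L] by (intro nn_integral_mono) (simp add: I_def)
    also have "\<dots> = ennreal L * (\<integral>\<^sup>+x. (\<integral>\<^sup>+\<rho>. I \<rho> * indicator {\<rho>. ennreal (L * \<rho>) < u x} \<rho> \<partial>lborel) \<partial>lborel)"
      unfolding indicator_def by (rule nn_integral_cmult) measurable
    also have "(\<integral>\<^sup>+x. (\<integral>\<^sup>+\<rho>. I \<rho> * indicator {\<rho>. ennreal (L * \<rho>) < u x} \<rho> \<partial>lborel) \<partial>lborel) = (\<integral>\<^sup>+\<rho>. I \<rho> * emeasure lborel {x. ennreal (L * \<rho>) < u x} \<partial>lborel)"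
      by (rule swap) measurable
    finally show ?thesis .
  qed
  have level: "I \<rho> * (ennreal s * emeasure lborel {x. ennreal (M * \<rho>) < g x} + ennreal t * emeasure lborel {x. ennreal (N * \<rho>) < h x})
      \<le> I \<rho> * emeasure lborel {x. ennreal (K * \<rho>) \<le> f x}" for \<rho>
  proof (cases "0 < \<rho> \<and> \<rho> < 1")
    case True
    have pos: "emeasure lborel {x. ennreal (L * \<rho>) < u x} > 0"
      if [measurable]: "u \<in> borel_measurable borel" and L: "L > 0" "ennreal L \<le> esssup lborel u" for u :: "real \<Rightarrow> ennreal" and L
    proof -
      have "ennreal (L * \<rho>) < ennreal L" using L True by (intro ennreal_lessI) auto
      also note L(2)
      finally show ?thesis using esssup_pos_measure[of u lborel] by simp
    qed
    have "ennreal s * emeasure lborel {x. ennreal (M * \<rho>) < g x} + ennreal t * emeasure lborel {x. ennreal (N * \<rho>) < h x}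
      \<le> emeasure lborel {x. ennreal (K * \<rho>) \<le> f x}"
    proof (rule essential_Brunn_Minkowski)
      have "ennreal (K * \<rho>) \<le> f (s * x + t * y)"
        if "g x ennpow s * h y ennpow t \<le> f (s * x + t * y)" "ennreal (M * \<rho>) < g x" "ennreal (N * \<rho>) < h y" for x y
      proof -
        have "K * \<rho> = (M * \<rho>) powr s * (N * \<rho>) powr t"
          using M N True st(3) by (simp add: K_def powr_mult powr_add[symmetric] mult_ac)
        then have "ennreal (K * \<rho>) = ennreal (M * \<rho>) ennpow s * ennreal (N * \<rho>) ennpow t"
          using M N True ennpow_product_ennreal[of "M * \<rho>" "N * \<rho>" s t] by simp
        also have "\<dots> \<le> g x ennpow s * h y ennpow t"
          using that st by (intro mult_mono ennpow_mono) auto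
        also note that(1)
        finally show ?thesis .
      qed
      then show "AE x in lborel. AE y in lborel. x \<in> {x. ennreal (M * \<rho>) < g x} \<longrightarrow> y \<in> {x. ennreal (N * \<rho>) < h x} \<longrightarrow> s * x + t * y \<in> {x. ennreal (K * \<rho>) \<le> f x}"
        using AE by (auto elim!: eventually_mono)
    qed (use st pos M N in \<open>auto simp: pos\<close>)
    then show ?thesis by (intro mult_left_mono) auto
  qed (auto simp: I_def)
  have mG [measurable]: "(\<lambda>\<rho>. emeasure lborel {x. ennreal (L * \<rho>) < u x}) \<in> borel_measurable borel"
    if [measurable]: "u \<in> borel_measurable borel" for u :: "real \<Rightarrow> ennreal" and L
  proof -
    have "{z \<in> space (borel \<Otimes>\<^sub>M lborel). ennreal (L * fst z) < u (snd z)} \<in> sets (borel \<Otimes>\<^sub>M lborel)"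
      by measurable
    from lborel.measurable_emeasure_Pair[OF this] show ?thesis
      by (simp add: vimage_def space_pair_measure)
  qed
  have "ennreal s * G + ennreal t * H = (\<integral>\<^sup>+\<rho>. I \<rho> * (ennreal s * emeasure lborel {x. ennreal (M * \<rho>) < g x} + ennreal t * emeasure lborel {x. ennreal (N * \<rho>) < h x}) \<partial>lborel)"
    unfolding G_def H_def
    by (simp add: nn_integral_cmult[symmetric] nn_integral_add[symmetric] distrib_left mult_ac del: nn_integral_cmult)
  also have "\<dots> \<le> (\<integral>\<^sup>+\<rho>. I \<rho> * emeasure lborel {x. ennreal (K * \<rho>) \<le> f x} \<partial>lborel)"
    by (intro nn_integral_mono level)
  also have "\<dots> = (\<integral>\<^sup>+x. (\<integral>\<^sup>+\<rho>. I \<rho> * indicator {\<rho>. ennreal (K * \<rho>) \<le> f x} \<rho> \<partial>lborel) \<partial>lborel)"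
    by (rule swap[symmetric]) measurable
  finally have "ennreal K * (ennreal s * G + ennreal t * H) \<le> ennreal K * (\<integral>\<^sup>+x. (\<integral>\<^sup>+\<rho>. I \<rho> * indicator {\<rho>. ennreal (K * \<rho>) \<le> f x} \<rho> \<partial>lborel) \<partial>lborel)"
    by (intro mult_left_mono) auto
  also have "\<dots> = (\<integral>\<^sup>+x. ennreal K * (\<integral>\<^sup>+\<rho>. I \<rho> * indicator {\<rho>. ennreal (K * \<rho>) \<le> f x} \<rho> \<partial>lborel) \<partial>lborel)"
    unfolding indicator_def by (rule nn_integral_cmult[symmetric]) measurable
  also have "\<dots> \<le> (\<integral>\<^sup>+x. f x \<partial>lborel)"
    using layer_upper[OF K] by (intro nn_integral_mono) (simp add: I_def)
  finally have main: "ennreal K * (ennreal s * G + ennreal t * H) \<le> (\<integral>\<^sup>+x. f x \<partial>lborel)" .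
  have "(\<integral>\<^sup>+x. min (g x) M \<partial>lborel) ennpow s * (\<integral>\<^sup>+x. min (h x) N \<partial>lborel) ennpow t
      \<le> (ennreal M * G) ennpow s * (ennreal N * H) ennpow t"
    using st M N unfolding G_def H_def by (intro mult_mono ennpow_mono bound) auto
  also have "\<dots> = ennreal K * (G ennpow s * H ennpow t)"
    using st M N by (simp add: ennpow_mult ennpow_ennreal K_def ennreal_mult mult_ac)
  also have "\<dots> \<le> ennreal K * (ennreal s * G + ennreal t * H)"
    by (intro mult_left_mono ennpow_AM_GM st) auto
  also note main
  finally show ?thesis .
qed

text \<open>
  The level \<open>L\<close> is the minimum of the essential supremum and a large integer; truncating at the
  essential supremum costs nothing.
\<close>

lemma nn_integral_less_truncation:
  fixes g :: "'a \<Rightarrow> ennreal"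
  assumes [measurable]: "g \<in> borel_measurable M" and x: "ennreal x < (\<integral>\<^sup>+w. g w \<partial>M)" "x > 0"
  obtains L where "L > 0" "ennreal L \<le> esssup M g" "ennreal x < (\<integral>\<^sup>+w. min (g w) (ennreal L) \<partial>M)"
proof -
  have "incseq (\<lambda>n w. min (g w) (ennreal (real n)))"
    by (auto simp: incseq_def le_fun_def intro: min.coboundedI2 ennreal_leI)
  moreover have "(SUP n. min (g w) (ennreal (real n))) = g w" for w
  proof (rule antisym)
    show "g w \<le> (SUP n. min (g w) (ennreal (real n)))"
    proof (cases "g w")
      case (real r)
      obtain n where "r \<le> real n" using real_arch_simple by blast
      with real have "g w = min (g w) (ennreal (real n))" by (auto simp: min_def ennreal_le_iff)
      then show ?thesis by (metis SUP_upper UNIV_I)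
    next
      case top
      then show ?thesis
        using ennreal_SUP_of_nat_eq_top by (simp add: ennreal_of_nat_eq_real_of_nat min_def top_unique)
    qed
  qed (auto intro: SUP_least)
  ultimately have "(\<integral>\<^sup>+w. g w \<partial>M) = (SUP n. \<integral>\<^sup>+w. min (g w) (ennreal (real n)) \<partial>M)"
    using nn_integral_monotone_convergence_SUP[of "\<lambda>n w. min (g w) (ennreal (real n))" M] by simp
  with x obtain n where n: "ennreal x < (\<integral>\<^sup>+w. min (g w) (ennreal (real n)) \<partial>M)"
    by (auto simp: less_SUP_iff)
  define L where "L = enn2real (min (esssup M g) (ennreal (real n)))"
  have L: "ennreal L = min (esssup M g) (ennreal (real n))"
    unfolding L_def using min.cobounded2[of "esssup M g" "ennreal (real n)"]
    by (intro ennreal_enn2real le_less_trans[OF _ ennreal_less_top])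
  have "(\<integral>\<^sup>+w. min (g w) (ennreal (real n)) \<partial>M) = (\<integral>\<^sup>+w. min (g w) (ennreal L) \<partial>M)"
    using esssup_AE[where M = M and f = g] by (intro nn_integral_cong_AE, eventually_elim) (auto simp: L min_def)
  with n have n': "ennreal x < (\<integral>\<^sup>+w. min (g w) (ennreal L) \<partial>M)" by simp
  have "L > 0"
  proof (rule ccontr)
    assume "\<not> L > 0"
    then have "ennreal L = 0" by (simp add: ennreal_neg)
    with n' show False by simp
  qed
  with n' L that show thesis by (metis min.cobounded1)
qed

theorem essential_Prekopa_Leindler:
  fixes f g h :: "real \<Rightarrow> ennreal"
  assumes [measurable]: "f \<in> borel_measurable borel" "g \<in> borel_measurable borel" "h \<in> borel_measurable borel"
    and st: "s > 0" "t > 0" "s + t = 1"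
    and AE: "AE x in lborel. AE y in lborel. g x ennpow s * h y ennpow t \<le> f (s * x + t * y)"
  shows "(\<integral>\<^sup>+x. g x \<partial>lborel) ennpow s * (\<integral>\<^sup>+x. h x \<partial>lborel) ennpow t \<le> (\<integral>\<^sup>+x. f x \<partial>lborel)"
proof (rule ennpow_product_le_if_below[OF st(1,2)])
  fix x y :: real
  assume x: "x > 0" "ennreal x < (\<integral>\<^sup>+x. g x \<partial>lborel)" and y: "y > 0" "ennreal y < (\<integral>\<^sup>+x. h x \<partial>lborel)"
  obtain M where M: "M > 0" "ennreal M \<le> esssup lborel g" "ennreal x < (\<integral>\<^sup>+x. min (g x) M \<partial>lborel)"
    using nn_integral_less_truncation[of g lborel x] x by auto
  obtain N where N: "N > 0" "ennreal N \<le> esssup lborel h" "ennreal y < (\<integral>\<^sup>+x. min (h x) N \<partial>lborel)"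
    using nn_integral_less_truncation[of h lborel y] y by auto
  have "ennreal (x powr s * y powr t) = ennreal x ennpow s * ennreal y ennpow t"
    using x y by (simp add: ennpow_product_ennreal)
  also have "\<dots> \<le> (\<integral>\<^sup>+x. min (g x) M \<partial>lborel) ennpow s * (\<integral>\<^sup>+x. min (h x) N \<partial>lborel) ennpow t"
    using M N st by (intro mult_mono ennpow_mono) auto
  also have "\<dots> \<le> (\<integral>\<^sup>+x. f x \<partial>lborel)"
    using st AE M N by (intro essential_Prekopa_Leindler_truncated) auto
  finally show "ennreal (x powr s * y powr t) \<le> (\<integral>\<^sup>+x. f x \<partial>lborel)" .
qed

section \<open>Riesz representation and resampling of a Gaussian coordinate\<close>

text \<open>
  The representative is the minimiser of \<open>\<phi> h = |h|\<^sup>2 / 2 - m h\<close>. By the parallelogram law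
  minimising sequences are Cauchy, and the first-order condition at the minimum is \<open>m h = e \<bullet> h\<close>.
\<close>

theorem Riesz_representation:
  fixes m :: "'h::{real_inner, complete_space} \<Rightarrow> real"
  assumes lin: "linear m" and cont: "continuous_on UNIV m"
  obtains e where "\<And>h. m h = e \<bullet> h"
proof -
  note add = linear_add[OF lin] and scale = linear_scale[OF lin] and zero = linear_0[OF lin]
  obtain K where K: "\<And>h. \<bar>m h\<bar> \<le> K * norm h"
  proof -
    have "isCont m 0" using cont by (simp add: continuous_on_eq_continuous_at)
    then obtain d where d: "d > 0" "\<And>h. norm h < d \<Longrightarrow> \<bar>m h\<bar> < 1"
      using zero by (auto simp: continuous_at_eps_delta dist_norm dest!: spec[of _ 1])
    have "\<bar>m h\<bar> \<le> (2 / d) * norm h" for h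
    proof (cases "h = 0")
      case False
      then have "norm ((d / (2 * norm h)) *\<^sub>R h) < d" using d(1) by simp
      then have "\<bar>m ((d / (2 * norm h)) *\<^sub>R h)\<bar> < 1" by (rule d(2))
      then show ?thesis
        using d(1) False by (simp add: scale abs_mult field_simps)
    qed (simp add: zero)
    then show thesis using that by blast
  qed
  define \<phi> where "\<phi> h = (norm h)\<^sup>2 / 2 - m h" for h
  have \<phi>_ge: "- K\<^sup>2 / 2 \<le> \<phi> h" for h
  proof -
    have "0 \<le> (norm h - K)\<^sup>2" by simp
    then have "- K\<^sup>2 / 2 \<le> (norm h)\<^sup>2 / 2 - K * norm h"
      by (simp add: power2_eq_square algebra_simps)
    also have "\<dots> \<le> \<phi> h" using K[of h] by (simp add: \<phi>_def)
    finally show ?thesis .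
  qed
  define I where "I = Inf (range \<phi>)"
  have I_le: "I \<le> \<phi> h" for h
    unfolding I_def using \<phi>_ge by (intro cInf_lower) (auto intro!: bdd_belowI2)
  have "\<exists>h. \<phi> h < I + inverse (real (Suc n))" for n
    using cInf_lessD[of "range \<phi>" "I + inverse (real (Suc n))"] by (auto simp: I_def)
  then obtain X where X: "\<And>n. \<phi> (X n) < I + inverse (real (Suc n))" by metis
  have parallelogram: "(norm (x - y))\<^sup>2 / 4 = \<phi> x + \<phi> y - 2 * \<phi> ((1 / 2) *\<^sub>R (x + y))" for x y
    by (simp add: \<phi>_def add scale power2_norm_eq_inner inner_simps inner_commute field_simps)
  have close: "(norm (x - y))\<^sup>2 \<le> 4 * (\<phi> x + \<phi> y - 2 * I)" for x y
    using parallelogram[of x y] I_le[of "(1 / 2) *\<^sub>R (x + y)"] by simp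
  have "Cauchy X"
  proof (rule metric_CauchyI)
    fix e :: real assume e: "e > 0"
    obtain N where N: "inverse (real (Suc N)) < e\<^sup>2 / 8"
      using reals_Archimedean[of "e\<^sup>2 / 8"] e by auto
    have "dist (X m) (X n) < e" if "m \<ge> N" "n \<ge> N" for m n
    proof -
      have small: "\<phi> (X k) < I + e\<^sup>2 / 8" if "k \<ge> N" for k
      proof -
        have "inverse (real (Suc k)) \<le> inverse (real (Suc N))"
          using that by (intro le_imp_inverse_le) auto
        with N have "inverse (real (Suc k)) < e\<^sup>2 / 8" by (rule le_less_trans[rotated])
        then have "I + inverse (real (Suc k)) < I + e\<^sup>2 / 8" by simp
        with X[of k] show ?thesis by (rule less_trans)
      qed
      have "(norm (X m - X n))\<^sup>2 < e\<^sup>2"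
        using close[of "X m" "X n"] small[OF that(1)] small[OF that(2)] by (simp add: algebra_simps)
      then show ?thesis
        using e by (auto simp: dist_norm intro: power2_less_imp_less)
    qed
    then show "\<exists>M. \<forall>m\<ge>M. \<forall>n\<ge>M. dist (X m) (X n) < e" by blast
  qed
  then obtain e where e: "X \<longlonglongrightarrow> e"
    using Cauchy_convergent convergent_def by blast
  have m_lim: "(\<lambda>n. m (X n)) \<longlonglongrightarrow> m e"
    using cont e by (auto simp: continuous_on_eq_continuous_at isCont_tendsto_compose)
  have "\<phi> e \<le> I"
  proof (rule LIMSEQ_le)
    show "(\<lambda>n. \<phi> (X n)) \<longlonglongrightarrow> \<phi> e"
      unfolding \<phi>_def by (intro tendsto_intros e m_lim) simp
    show "(\<lambda>n. I + inverse (real (Suc n))) \<longlonglongrightarrow> I"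
      using tendsto_add[OF tendsto_const LIMSEQ_inverse_real_of_nat, of I] by simp
  qed (use X in \<open>auto intro: less_imp_le\<close>)
  then have min: "\<phi> e \<le> \<phi> (e + r *\<^sub>R h)" for r h
    using I_le order_trans by blast
  have "m h = e \<bullet> h" for h
  proof (cases "h = 0")
    case False
    define d where "d = e \<bullet> h - m h"
    (* The minimiser of the quadratic \<open>r d + r\<^sup>2 |h|\<^sup>2 / 2\<close>. *)
    define r where "r = - d / (norm h)\<^sup>2"
    have n: "(norm h)\<^sup>2 > 0" using False by simp
    have "\<phi> (e + r *\<^sub>R h) - \<phi> e = r * d + r\<^sup>2 * (norm h)\<^sup>2 / 2"
    proof -
      have "(norm (e + r *\<^sub>R h))\<^sup>2 = (norm e)\<^sup>2 + 2 * r * (e \<bullet> h) + r\<^sup>2 * (norm h)\<^sup>2"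
        by (simp add: power2_norm_eq_inner inner_simps inner_commute power2_eq_square[of r])
      then show ?thesis
        by (simp add: \<phi>_def d_def add scale algebra_simps add_divide_distrib)
    qed
    also have "\<dots> = - d\<^sup>2 / (2 * (norm h)\<^sup>2)"
      using n by (simp add: r_def power2_eq_square field_simps)
    finally have "0 \<le> - d\<^sup>2 / (2 * (norm h)\<^sup>2)"
      using min[of r h] by simp
    then have "d = 0"
      using n by (simp add: divide_le_0_iff)
    then show ?thesis by (simp add: d_def)
  qed (simp add: zero)
  then show thesis using that by blast
qed

lemma onorm_inner: "onorm (\<lambda>h. e \<bullet> h) = norm e"
proof (rule antisym)
  show "onorm (\<lambda>h. e \<bullet> h) \<le> norm e"
    by (rule onorm_bound) (auto simp: Cauchy_Schwarz_ineq2)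
  have "norm (e \<bullet> e) \<le> onorm (\<lambda>h. e \<bullet> h) * norm e"
    by (rule onorm[OF bounded_linear_inner_right])
  then have "norm e * norm e \<le> onorm (\<lambda>h. e \<bullet> h) * norm e"
    by (simp add: power2_norm_eq_inner[symmetric] power2_eq_square)
  then show "norm e \<le> onorm (\<lambda>h. e \<bullet> h)"
    using onorm_pos_le[OF bounded_linear_inner_right, of e] by (cases "e = 0") auto
qed

lemma Re_char_cos:
  assumes M: "prob_space M" and f [measurable]: "f \<in> borel_measurable M"
    and char: "(CLINT w|M. iexp (f w)) = complex_of_real r"
  shows "(\<integral>w. cos (f w + \<theta>) \<partial>M) = cos \<theta> * r"
proof -
  interpret prob_space M by fact
  have int: "integrable M (\<lambda>w. iexp (f w))"
    by (rule integrable_const_bound[where B = 1]) auto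
  have "(CLINT w|M. iexp \<theta> * iexp (f w)) = iexp \<theta> * complex_of_real r"
    using int char by simp
  then have "Re (CLINT w|M. iexp \<theta> * iexp (f w)) = cos \<theta> * r"
    by (simp add: cis_conv_exp[symmetric])
  moreover have "Re (CLINT w|M. iexp \<theta> * iexp (f w)) = (\<integral>w. Re (iexp \<theta> * iexp (f w)) \<partial>M)"
    using int by (intro integral_Re[symmetric]) simp
  moreover have "Re (iexp \<theta> * iexp (f w)) = cos (f w + \<theta>)" for w
    by (simp only: cis_conv_exp[symmetric] cis_mult cis.sel add.commute)
  ultimately show ?thesis by simp
qed

lemma std_normal_cos: "(\<integral>x. cos (c * x + \<theta>) \<partial>std_normal_distribution) = cos \<theta> * exp (- c\<^sup>2 / 2)"
proof (rule Re_char_cos)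
  show "prob_space std_normal_distribution"
    by (rule prob_space_normal_density) simp
  show "(CLINT x|std_normal_distribution. iexp (c * x)) = complex_of_real (exp (- c\<^sup>2 / 2))"
    using fun_cong[OF char_std_normal_distribution, of c] by (simp add: char_def)
qed simp

context abstract_wiener_space
begin

text \<open>
  A continuous functional together with the Riesz representative of its restriction to \<open>H\<close>.
\<close>

definition dual_pair :: "('w \<Rightarrow> real) \<Rightarrow> 'h \<Rightarrow> bool" where
  "dual_pair l e \<longleftrightarrow> l \<in> dual_space \<and> (\<forall>h. l (j h) = e \<bullet> h)"

lemma dual_pairD:
  assumes "dual_pair l e"
  shows "l \<in> dual_space" "linear l" "l (j h) = e \<bullet> h" "l (v + w) = l v + l w" "l (r *\<^sub>R w) = r * l w"
  using assms by (auto simp: dual_pair_def dual_space_def linear_add linear_scale)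

lemma j_add: "j (h + k) = j h + j k" and j_scale: "j (r *\<^sub>R h) = r *\<^sub>R j h"
  and j_diff: "j (h - k) = j h - j k" and j_0 [simp]: "j 0 = 0"
  using linear_inclusion by (auto simp: linear_add linear_scale linear_diff linear_0)

lemma dual_pair_combine:
  assumes "dual_pair l e" "dual_pair m f"
  shows "dual_pair (\<lambda>w. r * l w + s * m w) (r *\<^sub>R e + s *\<^sub>R f)"
  using assms by (auto simp: dual_pair_def inner_simps intro!: dual_space_add dual_space_scale)

lemma ex_dual_pair:
  assumes "l \<in> dual_space"
  obtains e where "dual_pair l e"
proof -
  have "linear (\<lambda>h. l (j h))"
    using assms by (auto simp: dual_space_def linear_iff j_add j_scale)
  moreover have "continuous_on UNIV (\<lambda>h. l (j h))"
    using assms continuous_inclusion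
    by (auto simp: dual_space_def intro: continuous_on_compose2[of UNIV l UNIV j])
  ultimately obtain e where "\<And>h. l (j h) = e \<bullet> h"
    using Riesz_representation[of "\<lambda>h. l (j h)"] by blast
  with assms that show thesis by (auto simp: dual_pair_def)
qed

text \<open>
  Density of \<open>H\<close> in \<open>W\<close>: a functional vanishing on \<open>H\<close> vanishes.
\<close>

lemma dual_pair_zero_iff:
  assumes "dual_pair l 0"
  shows "l w = 0"
proof -
  have "closed {w. l w = 0}"
    using assms by (intro closed_Collect_eq continuous_intros) (auto simp: dual_pair_def dual_space_def)
  moreover have "range j \<subseteq> {w. l w = 0}"
    using assms by (auto simp: dual_pair_def)
  ultimately have "closure (range j) \<subseteq> {w. l w = 0}"
    by (rule closure_minimal[rotated])
  then show ?thesis by (auto simp: dense_inclusion)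
qed

lemma dual_measurable [measurable]: "l \<in> dual_space \<Longrightarrow> l \<in> borel_measurable \<mu>"
  using dual_space_borel measurable_cong_sets[OF sets_eq_borel refl] by blast

lemma gaussian_cos:
  assumes "dual_pair l e"
  shows "(\<integral>w. cos (l w + \<theta>) \<partial>\<mu>) = cos \<theta> * exp (- (norm e)\<^sup>2 / 2)"
proof (rule Re_char_cos[OF prob_space_axioms])
  have "l \<circ> j = (\<lambda>h. e \<bullet> h)" using assms by (auto simp: dual_pair_def)
  then show "(CLINT w|\<mu>. iexp (l w)) = complex_of_real (exp (- (norm e)\<^sup>2 / 2))"
    using gaussian[of l] assms by (simp add: dual_pair_def dual_space_def onorm_inner)
qed (use assms in \<open>auto simp: dual_pair_def\<close>)

lemma measurable_shift [measurable (raw)]: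
  fixes f :: "'c \<Rightarrow> 'w"
  assumes f: "f \<in> N \<rightarrow>\<^sub>M borel" and r: "r \<in> borel_measurable N"
  shows "(\<lambda>z. f z + r z *\<^sub>R v) \<in> N \<rightarrow>\<^sub>M borel"
proof (rule borel_measurable_continuous_Pair[OF f r])
  show "continuous_on UNIV (\<lambda>z. fst z + snd z *\<^sub>R v)"
    by (intro frechet_continuous_on_add[OF frechet] frechet_continuous_on_scaleR[OF frechet] continuous_intros)
qed

lemma measurable_translate [measurable (raw)]:
  fixes f :: "'c \<Rightarrow> 'w"
  assumes "f \<in> N \<rightarrow>\<^sub>M borel"
  shows "(\<lambda>z. f z + v) \<in> N \<rightarrow>\<^sub>M borel"
  using measurable_shift[OF assms borel_measurable_const, of 1 v] by simp

text \<open>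
  The point \<open>w\<close> with its coordinate \<open>l w\<close> replaced by \<open>x\<close> (for \<open>l (j e) = 1\<close>).
\<close>

definition resample :: "('w \<Rightarrow> real) \<Rightarrow> 'h \<Rightarrow> 'w \<Rightarrow> real \<Rightarrow> 'w" where
  "resample l e w x = w + (x - l w) *\<^sub>R j e"

lemma measurable_resample:
  assumes l: "l \<in> dual_space" and [measurable]: "f \<in> N \<rightarrow>\<^sub>M borel" "r \<in> borel_measurable N"
  shows "(\<lambda>z. resample l e (f z) (r z)) \<in> N \<rightarrow>\<^sub>M borel"
proof -
  have [measurable]: "l \<in> borel_measurable borel" using l by (rule dual_space_borel)
  show ?thesis unfolding resample_def by measurable
qed

lemma resample_measurable_pair:
  "l \<in> dual_space \<Longrightarrow> (\<lambda>(w, x). resample l e w x) \<in> \<mu> \<Otimes>\<^sub>M std_normal_distribution \<rightarrow>\<^sub>M borel"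
  using measurable_resample[of l fst "\<mu> \<Otimes>\<^sub>M std_normal_distribution" snd e]
  by (simp add: case_prod_beta' sets_eq_borel cong: measurable_cong_sets)

text \<open>
  Under \<open>\<mu>\<close> the coordinate \<open>l\<close> is standard normal and independent of the remaining ones, so
  replacing it by an independent standard normal variable does not change the law. In terms of
  characteristic functionals this is Pythagoras: \<open>|f|\<^sup>2 = |f - c e|\<^sup>2 + c\<^sup>2\<close> with \<open>c = f \<bullet> e\<close>.
\<close>

theorem distr_resample:
  assumes le: "dual_pair l e" and e: "norm e = 1"
  shows "distr (\<mu> \<Otimes>\<^sub>M std_normal_distribution) borel (\<lambda>(w, x). resample l e w x) = \<mu>"
proof (rule frechet_measure_eqI_cos[OF frechet])
  interpret \<gamma>: prob_space std_normal_distribution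
    by (rule prob_space_normal_density) simp
  interpret pair_prob_space \<mu> std_normal_distribution ..
  note meas = resample_measurable_pair[OF dual_pairD(1)[OF le]]
  show "prob_space (distr (\<mu> \<Otimes>\<^sub>M std_normal_distribution) borel (\<lambda>(w, x). resample l e w x))"
    by (rule P.prob_space_distr[OF meas])
  fix m :: "'w \<Rightarrow> real" and \<theta> :: real assume m: "m \<in> dual_space"
  obtain f where f: "dual_pair m f" using ex_dual_pair[OF m] .
  define c where "c = f \<bullet> e"
  have [measurable]: "m \<in> borel_measurable borel" "l \<in> borel_measurable \<mu>" "m \<in> borel_measurable \<mu>"
    using m le by (auto intro: dual_space_borel simp: dual_pair_def)
  have "(\<integral>w. cos (m w + \<theta>) \<partial>distr (\<mu> \<Otimes>\<^sub>M std_normal_distribution) borel (\<lambda>(w, x). resample l e w x)) =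
      (\<integral>p. (\<lambda>(w, x). cos (c * x + (m w - c * l w + \<theta>))) p \<partial>(\<mu> \<Otimes>\<^sub>M std_normal_distribution))"
  proof -
    have eq: "m (resample l e w x) + \<theta> = c * x + (m w - c * l w + \<theta>)" for w x
      unfolding resample_def dual_pairD(4)[OF f] dual_pairD(5)[OF f] dual_pairD(3)[OF f]
      by (simp add: algebra_simps c_def)
    show ?thesis
      by (subst integral_distr[OF meas]) (measurable, simp only: case_prod_beta' eq)
  qed
  also have "\<dots> = (\<integral>w. (\<integral>x. cos (c * x + (m w - c * l w + \<theta>)) \<partial>std_normal_distribution) \<partial>\<mu>)"
  proof -
    have "integrable (\<mu> \<Otimes>\<^sub>M std_normal_distribution) (\<lambda>(w, x). cos (c * x + (m w - c * l w + \<theta>)))"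
      by (rule P.integrable_const_bound[where B = 1]) auto
    from integral_fst'[OF this] show ?thesis by simp
  qed
  also have "\<dots> = (\<integral>w. cos (m w - c * l w + \<theta>) * exp (- c\<^sup>2 / 2) \<partial>\<mu>)"
    by (simp add: std_normal_cos)
  also have "\<dots> = (\<integral>w. cos (m w - c * l w + \<theta>) \<partial>\<mu>) * exp (- c\<^sup>2 / 2)"
    by simp
  also have "(\<integral>w. cos (m w - c * l w + \<theta>) \<partial>\<mu>) = cos \<theta> * exp (- (norm (f - c *\<^sub>R e))\<^sup>2 / 2)"
    using gaussian_cos[OF dual_pair_combine[OF f le, of 1 "- c"], of \<theta>] by simp
  also have "(norm (f - c *\<^sub>R e))\<^sup>2 = (norm f)\<^sup>2 - c\<^sup>2"
  proof -
    have "e \<bullet> e = 1" using e by (simp add: power2_norm_eq_inner[symmetric])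
    then show ?thesis
      by (simp add: power2_norm_eq_inner inner_simps c_def inner_commute[of f e] power2_eq_square[of "e \<bullet> f"])
  qed
  also have "cos \<theta> * exp (- ((norm f)\<^sup>2 - c\<^sup>2) / 2) * exp (- c\<^sup>2 / 2) = cos \<theta> * exp (- (norm f)\<^sup>2 / 2)"
    by (simp add: mult.assoc exp_add[symmetric] diff_divide_distrib)
  also have "\<dots> = (\<integral>w. cos (m w + \<theta>) \<partial>\<mu>)"
    by (rule gaussian_cos[OF f, symmetric])
  finally show "(\<integral>w. cos (m w + \<theta>) \<partial>distr (\<mu> \<Otimes>\<^sub>M std_normal_distribution) borel (\<lambda>(w, x). resample l e w x)) =
      (\<integral>w. cos (m w + \<theta>) \<partial>\<mu>)" .
qed (auto simp: sets_eq_borel prob_space_axioms)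

end

section \<open>Smoothing along one direction\<close>

interpretation std_normal: prob_space std_normal_distribution
  by (rule prob_space_normal_density) simp

lemma (in sigma_finite_measure) AE_swap_real2:
  fixes \<Phi> :: "'a \<Rightarrow> real \<Rightarrow> real \<Rightarrow> bool"
  assumes pred: "Measurable.pred ((lborel \<Otimes>\<^sub>M lborel) \<Otimes>\<^sub>M M) (\<lambda>(r, p). \<Phi> p (fst r) (snd r))"
    and each: "\<And>r1 r2. AE p in M. \<Phi> p r1 r2"
  shows "AE p in M. AE r1 in lborel. AE r2 in lborel. \<Phi> p r1 r2"
proof -
  interpret R: pair_sigma_finite "lborel \<Otimes>\<^sub>M lborel :: (real \<times> real) measure" M
    by (intro pair_sigma_finite.intro sigma_finite_measure_axioms lborel_pair.sigma_finite_measure_axioms)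
  have "{z \<in> space ((lborel \<Otimes>\<^sub>M lborel) \<Otimes>\<^sub>M M). \<Phi> (snd z) (fst (fst z)) (snd (fst z))} \<in> sets ((lborel \<Otimes>\<^sub>M lborel) \<Otimes>\<^sub>M M)"
    using pred by (simp add: pred_def case_prod_beta')
  from R.AE_commute[OF this] each
  have "AE p in M. AE r in lborel \<Otimes>\<^sub>M lborel. \<Phi> p (fst r) (snd r)"
    by simp
  then show ?thesis
  proof eventually_elim
    case (elim p)
    from lborel_pair.AE_pair[OF elim] show ?case by simp
  qed
qed

lemma AE_std_normal_iff: "(AE x in std_normal_distribution. P x) \<longleftrightarrow> (AE x in lborel. P x)"
  by (subst AE_density) (auto simp: normal_density_pos)

lemma AE_lborel_shift:
  fixes r :: real
  assumes "AE x in lborel. P x"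
  shows "AE x in lborel. P (r + x)"
proof -
  have "AE x in distr lborel borel ((+) r). P x"
    using assms by (subst lborel_distr_plus)
  from AE_distrD[OF _ this] show ?thesis by simp
qed

lemma nn_integral_std_normal:
  "f \<in> borel_measurable borel \<Longrightarrow>
    (\<integral>\<^sup>+x. f x \<partial>std_normal_distribution) = (\<integral>\<^sup>+x. ennreal (std_normal_density x) * f x \<partial>lborel)"
  by (subst nn_integral_density) auto

text \<open>
  By this identity the Gaussian factors on the two sides of a Prekopa-Leindler hypothesis combine to a
  function of the difference \<open>h - k\<close> only.
\<close>

lemma Gaussian_weight_identity:
  fixes h k :: "'h::real_inner"
  assumes "s + t = (1::real)"
  shows "(norm (s *\<^sub>R h + t *\<^sub>R k))\<^sup>2 = s * (norm h)\<^sup>2 + t * (norm k)\<^sup>2 - s * t * (norm (h - k))\<^sup>2"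
proof -
  have t: "t = 1 - s" using assms by simp
  show ?thesis
    by (simp add: t power2_norm_eq_inner inner_simps inner_commute[of k h]) (simp add: algebra_simps)
qed

lemma std_normal_density_power_product:
  assumes "s + t = 1"
  shows "std_normal_density x powr s * std_normal_density y powr t =
    exp (- (s * t * (x - y)\<^sup>2 / 2)) * std_normal_density (s * x + t * y)"
proof -
  define c where "c = 1 / sqrt (2 * pi)"
  have c: "c > 0" by (simp add: c_def)
  have d: "std_normal_density z = c * exp (- z\<^sup>2 / 2)" for z
    by (simp add: std_normal_density_def c_def)
  have "c powr s * c powr t = c"
    using c assms by (simp add: powr_add[symmetric])
  moreover have "exp (- x\<^sup>2 / 2) powr s * exp (- y\<^sup>2 / 2) powr t =
      exp (- (s * t * (x - y)\<^sup>2 / 2)) * exp (- (s * x + t * y)\<^sup>2 / 2)"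
  proof -
    have "s * x\<^sup>2 + t * y\<^sup>2 = s * t * (x - y)\<^sup>2 + (s * x + t * y)\<^sup>2"
      using Gaussian_weight_identity[OF assms, of x y] by simp
    then show ?thesis
      by (simp add: exp_powr_real exp_add[symmetric] add_divide_distrib[symmetric] mult.commute)
  qed
  ultimately show ?thesis
    using c by (simp add: d powr_mult mult_ac)
qed

context abstract_wiener_space
begin

lemma measurable_mu: "f \<in> borel \<rightarrow>\<^sub>M K \<Longrightarrow> f \<in> \<mu> \<rightarrow>\<^sub>M K"
  using measurable_cong_sets[OF sets_eq_borel refl] by blast

lemma AE_resample_pair:
  assumes le: "dual_pair l e" "norm e = 1" and P: "AE w in \<mu>. P w"
  shows "AE p in \<mu> \<Otimes>\<^sub>M std_normal_distribution. P (resample l e (fst p) (snd p))"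
proof -
  have "AE w in distr (\<mu> \<Otimes>\<^sub>M std_normal_distribution) borel (\<lambda>(w, x). resample l e w x). P w"
    using P by (subst distr_resample[OF le])
  from AE_distrD[OF resample_measurable_pair[OF dual_pairD(1)[OF le(1)]] this]
  show ?thesis by (simp add: case_prod_beta')
qed

lemma AE_resample:
  assumes le: "dual_pair l e" "norm e = 1" and P: "AE w in \<mu>. P w"
  shows "AE w in \<mu>. AE x in std_normal_distribution. P (resample l e w x)"
proof -
  interpret pair_prob_space \<mu> std_normal_distribution ..
  from AE_pair[OF AE_resample_pair[OF assms]] show ?thesis by simp
qed

text \<open>
  Quasi-invariance of \<open>\<mu>\<close>, restricted to directions that represent a continuous functional, where it
  reduces to the translation invariance of null sets on the line: a shift along \<open>e\<close> only moves the
  resampled coordinate.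
\<close>

lemma AE_translate:
  assumes lh: "dual_pair l h" and P: "AE w in \<mu>. P w"
  shows "AE w in \<mu>. P (w + j h)"
proof (cases "h = 0")
  case True
  then show ?thesis using P by simp
next
  case False
  interpret pair_prob_space \<mu> std_normal_distribution ..
  define r where "r = norm h"
  define e where "e = (1 / r) *\<^sub>R h"
  define l' where "l' = (\<lambda>w. 1 / r * l w)"
  have r: "r > 0" using False by (simp add: r_def)
  have le: "dual_pair l' e"
    using dual_pair_combine[OF lh lh, of "1 / r" 0] by (simp add: l'_def e_def)
  have e: "norm e = 1" using r by (simp add: e_def r_def)
  have h: "r *\<^sub>R j e = j h" using r by (simp add: e_def j_scale[symmetric])
  obtain N where N: "{w \<in> space \<mu>. \<not> P w} \<subseteq> N" "emeasure \<mu> N = 0" "N \<in> sets \<mu>"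
    using AE_E[OF P] .
  have space: "space \<mu> = UNIV" using sets_eq_imp_space_eq[OF sets_eq_borel] by simp
  have N_borel [measurable]: "N \<in> sets borel" using N(3) sets_eq_borel by simp
  have "AE w in \<mu>. w \<notin> N" using N by (intro AE_not_in) (auto simp: null_sets_def)
  from AE_resample[OF le e this]
  have "AE w in \<mu>. AE x in std_normal_distribution. resample l' e w x + j h \<notin> N"
  proof eventually_elim
    case (elim w)
    then have "AE x in lborel. resample l' e w (r + x) \<notin> N"
      unfolding AE_std_normal_iff by (rule AE_lborel_shift)
    moreover have "resample l' e w (r + x) = resample l' e w x + j h" for x
      by (simp add: resample_def h[symmetric] algebra_simps)
    ultimately show ?case by (simp add: AE_std_normal_iff)
  qed
  moreover note meas = resample_measurable_pair[OF dual_pairD(1)[OF le], of e]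
  have [measurable]: "{w. w + j h \<notin> N} \<in> sets borel"
  proof -
    have "Measurable.pred borel (\<lambda>w. w + j h \<notin> N)" by measurable
    then show ?thesis by (simp add: pred_def)
  qed
  have "{p \<in> space (\<mu> \<Otimes>\<^sub>M std_normal_distribution). (case p of (w, x) \<Rightarrow> resample l' e w x) + j h \<notin> N} \<in> sets (\<mu> \<Otimes>\<^sub>M std_normal_distribution)"
    using measurable_sets[OF meas, of "{w. w + j h \<notin> N}"] by (simp add: vimage_def Int_def conj_commute)
  ultimately have "AE p in \<mu> \<Otimes>\<^sub>M std_normal_distribution. (case p of (w, x) \<Rightarrow> resample l' e w x) + j h \<notin> N"
    by (intro AE_pair_measure) auto
  then have "AE w in distr (\<mu> \<Otimes>\<^sub>M std_normal_distribution) borel (\<lambda>(w, x). resample l' e w x). w + j h \<notin> N"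
    by (subst AE_distr_iff[OF meas]) auto
  then have "AE w in \<mu>. w + j h \<notin> N"
    by (subst (asm) distr_resample[OF le e])
  then show ?thesis
    by eventually_elim (use N(1) space in auto)
qed

text \<open>
  The conditional expectation of \<open>f\<close> given all coordinates orthogonal to \<open>l\<close>, as an explicit kernel.
\<close>

definition smooth :: "('w \<Rightarrow> real) \<Rightarrow> 'h \<Rightarrow> ('w \<Rightarrow> ennreal) \<Rightarrow> 'w \<Rightarrow> ennreal" where
  "smooth l e f w = (\<integral>\<^sup>+x. f (resample l e w x) \<partial>std_normal_distribution)"

lemma borel_measurable_smooth:
  assumes l: "l \<in> dual_space" and f [measurable]: "f \<in> borel_measurable borel"
  shows "smooth l e f \<in> borel_measurable borel"
proof -
  have [measurable]: "(\<lambda>p. resample l e (fst p) (snd p)) \<in> borel \<Otimes>\<^sub>M std_normal_distribution \<rightarrow>\<^sub>M borel"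
    by (rule measurable_resample[OF l]) measurable
  have "(\<lambda>p. f (resample l e (fst p) (snd p))) \<in> borel_measurable (borel \<Otimes>\<^sub>M std_normal_distribution)"
    by measurable
  from std_normal.borel_measurable_nn_integral_fst[OF this] show ?thesis
    by (simp add: smooth_def[abs_def])
qed

lemma nn_integral_smooth:
  assumes le: "dual_pair l e" "norm e = 1" and f [measurable]: "f \<in> borel_measurable borel"
  shows "(\<integral>\<^sup>+w. smooth l e f w \<partial>\<mu>) = (\<integral>\<^sup>+w. f w \<partial>\<mu>)"
proof -
  note meas [measurable] = resample_measurable_pair[OF dual_pairD(1)[OF le(1)], of e]
  have "(\<integral>\<^sup>+w. f w \<partial>\<mu>) = (\<integral>\<^sup>+w. f w \<partial>distr (\<mu> \<Otimes>\<^sub>M std_normal_distribution) borel (\<lambda>(w, x). resample l e w x))"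
    by (simp add: distr_resample[OF le])
  also have "\<dots> = (\<integral>\<^sup>+p. f (case p of (w, x) \<Rightarrow> resample l e w x) \<partial>(\<mu> \<Otimes>\<^sub>M std_normal_distribution))"
    by (subst nn_integral_distr[OF meas]) simp_all
  also have "\<dots> = (\<integral>\<^sup>+w. smooth l e f w \<partial>\<mu>)"
    by (subst std_normal.nn_integral_fst[symmetric]) (simp_all add: smooth_def[abs_def])
  finally show ?thesis by simp
qed

lemma smooth_mono: "(\<And>w. f w \<le> g w) \<Longrightarrow> smooth l e f w \<le> smooth l e g w"
  unfolding smooth_def by (intro nn_integral_mono) simp

lemma resample_borel_snd:
  assumes "l \<in> dual_space"
  shows "(\<lambda>x. resample l e w x) \<in> borel \<rightarrow>\<^sub>M borel"
  by (rule measurable_resample[OF assms]) measurable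

lemma smooth_add:
  assumes l: "l \<in> dual_space" and [measurable]: "f \<in> borel_measurable borel" "g \<in> borel_measurable borel"
  shows "smooth l e (\<lambda>w. f w + g w) w = smooth l e f w + smooth l e g w"
proof -
  note [measurable] = resample_borel_snd[OF l]
  show ?thesis unfolding smooth_def by (rule nn_integral_add) measurable
qed

lemma depends_only_on_smooth:
  assumes le: "dual_pair l e" "norm e = 1" and L: "\<And>m. m \<in> L \<Longrightarrow> linear m \<and> m (j e) = 0"
    and f: "depends_only_on (insert l L) f"
  shows "depends_only_on L (smooth l e f)"
proof (rule depends_only_onI)
  fix w w' assume eq: "\<And>m. m \<in> L \<Longrightarrow> m w = m w'"
  have ee: "e \<bullet> e = 1" using le(2) by (simp add: power2_norm_eq_inner[symmetric])
  have "l (resample l e v x) = x" for v x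
    unfolding resample_def dual_pairD(4)[OF le(1)] dual_pairD(5)[OF le(1)] dual_pairD(3)[OF le(1)] ee by simp
  moreover have "m (resample l e v x) = m v" if "m \<in> L" for m v x
    using L[OF that] by (simp add: resample_def linear_add linear_scale)
  ultimately have "n (resample l e w x) = n (resample l e w' x)" if "n \<in> insert l L" for n x
    using that eq by (metis insertE)
  then have "f (resample l e w x) = f (resample l e w' x)" for x
    by (rule depends_only_onD[OF f])
  then show "smooth l e f w = smooth l e f w'" by (simp add: smooth_def)
qed

text \<open>
  The hypothesis of the theorem for Borel functions with the density absorbed. The weight comes from
  \<open>|s h + t k|\<^sup>2 = s |h|\<^sup>2 + t |k|\<^sup>2 - s t |h - k|\<^sup>2\<close> after moving all exponentials to one side. Directions
  are restricted to Riesz representatives of continuous functionals, along which null sets can be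
  translated.
\<close>

definition PL_condition :: "real \<Rightarrow> real \<Rightarrow> ('w \<Rightarrow> ennreal) \<Rightarrow> ('w \<Rightarrow> ennreal) \<Rightarrow> ('w \<Rightarrow> ennreal) \<Rightarrow> bool" where
  "PL_condition s t A B C \<longleftrightarrow> (\<forall>l m h k. dual_pair l h \<longrightarrow> dual_pair m k \<longrightarrow>
     (AE w in \<mu>. ennreal (exp (- (s * t * (norm (h - k))\<^sup>2 / 2))) * (B (w + j h) ennpow s * C (w + j k) ennpow t)
        \<le> A (w + j (s *\<^sub>R h + t *\<^sub>R k))))"

lemma PL_conditionD:
  assumes "PL_condition s t A B C" "dual_pair l h" "dual_pair m k"
  shows "AE w in \<mu>. ennreal (exp (- (s * t * (norm (h - k))\<^sup>2 / 2))) * (B (w + j h) ennpow s * C (w + j k) ennpow t)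
        \<le> A (w + j (s *\<^sub>R h + t *\<^sub>R k))"
  using assms unfolding PL_condition_def by blast

text \<open>
  Write \<open>h = h' + (e \<bullet> h) e\<close> and likewise \<open>k\<close>. Smoothing along \<open>e\<close> sees only the orthogonal parts
  \<open>h'\<close>, \<open>k'\<close>. Apply the condition to \<open>h' + r1 e\<close> and \<open>k' + r2 e\<close> for all real \<open>r1\<close>, \<open>r2\<close> and resample
  the coordinate \<open>l\<close>: for almost every \<open>w\<close>, Fubini gives the hypothesis of the one-dimensional
  Prekopa-Leindler inequality for the sections of \<open>A\<close>, \<open>B\<close>, \<open>C\<close> along \<open>e\<close>, weighted by the standard
  normal density. That the weight of the condition depends on \<open>h - k\<close> alone is what makes the
  resampled value \<open>x\<close> drop out after the shift \<open>r1 \<mapsto> x + r1\<close>, \<open>r2 \<mapsto> x + r2\<close>.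
\<close>

theorem PL_condition_smooth:
  assumes st: "s > 0" "t > 0" "s + t = 1"
    and [measurable]: "A \<in> borel_measurable borel" "B \<in> borel_measurable borel" "C \<in> borel_measurable borel"
    and PL: "PL_condition s t A B C" and le: "dual_pair l e" and e: "norm e = 1"
  shows "PL_condition s t (smooth l e A) (smooth l e B) (smooth l e C)"
  unfolding PL_condition_def
proof (intro allI impI)
  fix m n h k assume mh: "dual_pair m h" and nk: "dual_pair n k"
  have ee: "e \<bullet> e = 1" using e by (simp add: power2_norm_eq_inner[symmetric])
  define h' k' where "h' = h - (e \<bullet> h) *\<^sub>R e" and "k' = k - (e \<bullet> k) *\<^sub>R e"
  have orth: "e \<bullet> h' = 0" "e \<bullet> k' = 0" by (auto simp: h'_def k'_def inner_simps ee)
  have norm_split: "(norm ((h' + r1 *\<^sub>R e) - (k' + r2 *\<^sub>R e)))\<^sup>2 = (norm (h' - k'))\<^sup>2 + (r1 - r2)\<^sup>2" for r1 r2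
  proof -
    have "(h' + r1 *\<^sub>R e) - (k' + r2 *\<^sub>R e) = (h' - k') + (r1 - r2) *\<^sub>R e"
      by (simp add: algebra_simps)
    moreover have "e \<bullet> (h' - k') = 0" by (simp add: inner_simps orth)
    ultimately show ?thesis
      by (simp only: power2_norm_eq_inner inner_add_left inner_add_right inner_scaleR_left inner_scaleR_right ee inner_commute[of "h' - k'" e])
        (simp add: power2_eq_square)
  qed
  define \<kappa> where "\<kappa> = exp (- (s * t * (norm (h' - k'))\<^sup>2 / 2))"
  have \<kappa>: "\<kappa> > 0" by (simp add: \<kappa>_def)
  define av where "av = j (s *\<^sub>R h' + t *\<^sub>R k')"
  (* The condition on the line through \<open>u\<close>, in terms of the positions \<open>x\<close>, \<open>y\<close> along \<open>e\<close>. *)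
  define Q where "Q u x y \<longleftrightarrow> ennreal (\<kappa> * exp (- (s * t * (x - y)\<^sup>2 / 2))) *
      (B (u + j h' + x *\<^sub>R j e) ennpow s * C (u + j k' + y *\<^sub>R j e) ennpow t) \<le> A (u + av + (s * x + t * y) *\<^sub>R j e)" for u x y
  (* The part of \<open>w\<close> that resampling leaves unchanged. *)
  define u where "u w = w + (- l w) *\<^sub>R j e" for w
  have l_meas [measurable]: "l \<in> borel_measurable borel" "l \<in> borel_measurable \<mu>"
    using dual_space_borel[OF dual_pairD(1)[OF le]] measurable_mu by auto
  have id_meas [measurable]: "(\<lambda>w. w) \<in> \<mu> \<rightarrow>\<^sub>M borel" by (rule measurable_mu) simp
  have [measurable]: "u \<in> \<mu> \<rightarrow>\<^sub>M borel" unfolding u_def[abs_def] by measurable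
  have each: "AE p in \<mu> \<Otimes>\<^sub>M std_normal_distribution. Q (u (fst p)) (snd p + r1) (snd p + r2)" for r1 r2
  proof -
    have "AE w in \<mu>. ennreal (exp (- (s * t * (norm ((h' + r1 *\<^sub>R e) - (k' + r2 *\<^sub>R e)))\<^sup>2 / 2))) *
        (B (w + j (h' + r1 *\<^sub>R e)) ennpow s * C (w + j (k' + r2 *\<^sub>R e)) ennpow t)
        \<le> A (w + j (s *\<^sub>R (h' + r1 *\<^sub>R e) + t *\<^sub>R (k' + r2 *\<^sub>R e)))"
    proof -
      have 1: "dual_pair (\<lambda>w. 1 * m w + (r1 - e \<bullet> h) * l w) (1 *\<^sub>R h + (r1 - e \<bullet> h) *\<^sub>R e)"
        by (rule dual_pair_combine[OF mh le])
      have 2: "dual_pair (\<lambda>w. 1 * n w + (r2 - e \<bullet> k) * l w) (1 *\<^sub>R k + (r2 - e \<bullet> k) *\<^sub>R e)"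
        by (rule dual_pair_combine[OF nk le])
      have 3: "1 *\<^sub>R h + (r1 - e \<bullet> h) *\<^sub>R e = h' + r1 *\<^sub>R e" "1 *\<^sub>R k + (r2 - e \<bullet> k) *\<^sub>R e = k' + r2 *\<^sub>R e"
        by (simp_all add: h'_def k'_def algebra_simps)
      from PL_conditionD[OF PL 1 2] show ?thesis
        unfolding 3 .
    qed
    from AE_resample_pair[OF le e this] show ?thesis
    proof eventually_elim
      case (elim p)
      obtain w x where p: "p = (w, x)" by fastforce
        have "exp (- (s * t * (norm ((h' + r1 *\<^sub>R e) - (k' + r2 *\<^sub>R e)))\<^sup>2 / 2)) =
            \<kappa> * exp (- (s * t * ((x + r1) - (x + r2))\<^sup>2 / 2))"
          unfolding norm_split by (simp add: \<kappa>_def exp_add[symmetric] distrib_left add_divide_distrib)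
        moreover have "resample l e w x + j (h' + r1 *\<^sub>R e) = u w + j h' + (x + r1) *\<^sub>R j e"
          "resample l e w x + j (k' + r2 *\<^sub>R e) = u w + j k' + (x + r2) *\<^sub>R j e"
          by (simp_all add: resample_def u_def j_add j_scale algebra_simps)
        moreover have "resample l e w x + j (s *\<^sub>R (h' + r1 *\<^sub>R e) + t *\<^sub>R (k' + r2 *\<^sub>R e)) =
            u w + av + (s * (x + r1) + t * (x + r2)) *\<^sub>R j e"
        proof -
          have x: "s * (x + r1) + t * (x + r2) = x + (s * r1 + t * r2)"
          proof -
            have "s * x + t * x = x" using st(3) by (simp add: distrib_right[symmetric])
            then show ?thesis by (simp add: algebra_simps)
          qed
          show ?thesis
            unfolding x by (simp add: resample_def u_def av_def j_add j_scale algebra_simps)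
        qed
        ultimately show ?case
          using elim by (simp only: Q_def p fst_conv snd_conv)
    qed
  qed
  have pred_inequality: "Measurable.pred K (\<lambda>z. ennreal (\<kappa> * exp (- (s * t * (x z - y z)\<^sup>2 / 2))) * (\<beta> z ennpow s * \<gamma> z ennpow t) \<le> \<alpha> z)"
    if [measurable]: "\<alpha> \<in> borel_measurable K" "\<beta> \<in> borel_measurable K" "\<gamma> \<in> borel_measurable K"
      "x \<in> borel_measurable K" "y \<in> borel_measurable K" for K :: "((real \<times> real) \<times> 'w \<times> real) measure" and \<alpha> \<beta> \<gamma> x y
    by measurable
  have swap: "AE w in \<mu>. AE x in std_normal_distribution. AE r1 in lborel. AE r2 in lborel. Q (u w) (x + r1) (x + r2)"
  proof -
    interpret N: pair_prob_space \<mu> std_normal_distribution ..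
    have [measurable]: "(\<lambda>z. A (u (fst (snd z)) + av + (s * (snd (snd z) + fst (fst z)) + t * (snd (snd z) + snd (fst z))) *\<^sub>R j e))
        \<in> borel_measurable ((lborel \<Otimes>\<^sub>M lborel) \<Otimes>\<^sub>M (\<mu> \<Otimes>\<^sub>M std_normal_distribution))"
      by measurable
    have [measurable]: "(\<lambda>z. B (u (fst (snd z)) + j h' + (snd (snd z) + fst (fst z)) *\<^sub>R j e))
        \<in> borel_measurable ((lborel \<Otimes>\<^sub>M lborel) \<Otimes>\<^sub>M (\<mu> \<Otimes>\<^sub>M std_normal_distribution))"
      by measurable
    have [measurable]: "(\<lambda>z. C (u (fst (snd z)) + j k' + (snd (snd z) + snd (fst z)) *\<^sub>R j e))
        \<in> borel_measurable ((lborel \<Otimes>\<^sub>M lborel) \<Otimes>\<^sub>M (\<mu> \<Otimes>\<^sub>M std_normal_distribution))"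
      by measurable
    have "Measurable.pred ((lborel \<Otimes>\<^sub>M lborel) \<Otimes>\<^sub>M (\<mu> \<Otimes>\<^sub>M std_normal_distribution))
        (\<lambda>(r, p). Q (u (fst p)) (snd p + fst r) (snd p + snd r))"
      unfolding Q_def case_prod_beta' by (rule pred_inequality) measurable
    from N.P.AE_swap_real2[OF this each]
    have "AE p in \<mu> \<Otimes>\<^sub>M std_normal_distribution. AE r1 in lborel. AE r2 in lborel. Q (u (fst p)) (snd p + r1) (snd p + r2)" .
    from N.AE_pair[OF this] show ?thesis by simp
  qed
  have sections: "AE w in \<mu>. AE x in lborel. AE y in lborel. Q (u w) x y"
    using swap
  proof eventually_elim
    case (elim w)
    then have "AE x in std_normal_distribution. AE X in lborel. AE Y in lborel. Q (u w) X Y"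
    proof eventually_elim
      case (elim x)
      then have "AE r1 in lborel. AE Y in lborel. Q (u w) (x + r1) Y"
      proof eventually_elim
        case (elim r1)
        from AE_lborel_shift[OF elim, of "- x"] show ?case by simp
      qed
      from AE_lborel_shift[OF this, of "- x"] show ?case by simp
    qed
    (* The statement no longer mentions \<open>x\<close>, and a probability measure is not null. *)
    then show ?case by (simp only: std_normal.AE_const)
  qed
  then show "AE w in \<mu>. ennreal (exp (- (s * t * (norm (h - k))\<^sup>2 / 2))) *
      (smooth l e B (w + j h) ennpow s * smooth l e C (w + j k) ennpow t) \<le> smooth l e A (w + j (s *\<^sub>R h + t *\<^sub>R k))"
  proof eventually_elim
    case (elim w)
    have B: "smooth l e B (w + j h) = (\<integral>\<^sup>+x. ennreal (std_normal_density x) * B (u w + j h' + x *\<^sub>R j e) \<partial>lborel)"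
    proof -
      have "resample l e (w + j h) x = u w + j h' + x *\<^sub>R j e" for x
        by (simp add: resample_def u_def h'_def j_diff j_scale dual_pairD(4)[OF le] dual_pairD(3)[OF le] algebra_simps)
      then show ?thesis unfolding smooth_def by (simp add: nn_integral_std_normal)
    qed
    have C: "smooth l e C (w + j k) = (\<integral>\<^sup>+x. ennreal (std_normal_density x) * C (u w + j k' + x *\<^sub>R j e) \<partial>lborel)"
    proof -
      have "resample l e (w + j k) x = u w + j k' + x *\<^sub>R j e" for x
        by (simp add: resample_def u_def k'_def j_diff j_scale dual_pairD(4)[OF le] dual_pairD(3)[OF le] algebra_simps)
      then show ?thesis unfolding smooth_def by (simp add: nn_integral_std_normal)
    qed
    have A: "smooth l e A (w + j (s *\<^sub>R h + t *\<^sub>R k)) = (\<integral>\<^sup>+x. ennreal (std_normal_density x) * A (u w + av + x *\<^sub>R j e) \<partial>lborel)"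
    proof -
      have "resample l e (w + j (s *\<^sub>R h + t *\<^sub>R k)) x = u w + av + x *\<^sub>R j e" for x
        by (simp add: resample_def u_def av_def h'_def k'_def j_diff j_add j_scale dual_pairD(3,4,5)[OF le] inner_simps algebra_simps)
      then show ?thesis unfolding smooth_def by (simp add: nn_integral_std_normal)
    qed
    have "(\<integral>\<^sup>+x. ennreal \<kappa> * (ennreal (std_normal_density x) * B (u w + j h' + x *\<^sub>R j e)) \<partial>lborel) ennpow s *
        (\<integral>\<^sup>+x. ennreal \<kappa> * (ennreal (std_normal_density x) * C (u w + j k' + x *\<^sub>R j e)) \<partial>lborel) ennpow t
        \<le> (\<integral>\<^sup>+x. ennreal (std_normal_density x) * A (u w + av + x *\<^sub>R j e) \<partial>lborel)"
    proof (rule essential_Prekopa_Leindler[OF _ _ _ st])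
      show "AE x in lborel. AE y in lborel.
          (ennreal \<kappa> * (ennreal (std_normal_density x) * B (u w + j h' + x *\<^sub>R j e))) ennpow s *
          (ennreal \<kappa> * (ennreal (std_normal_density y) * C (u w + j k' + y *\<^sub>R j e))) ennpow t
          \<le> ennreal (std_normal_density (s * x + t * y)) * A (u w + av + (s * x + t * y) *\<^sub>R j e)"
        using elim
      proof eventually_elim
        case (elim x)
        then show ?case
        proof eventually_elim
          case (elim y)
          define b c where "b = B (u w + j h' + x *\<^sub>R j e)" and "c = C (u w + j k' + y *\<^sub>R j e)"
          have "(ennreal \<kappa> * (ennreal (std_normal_density x) * b)) ennpow s * (ennreal \<kappa> * (ennreal (std_normal_density y) * c)) ennpow t
            = (ennreal \<kappa> ennpow s * ennreal \<kappa> ennpow t) *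
              (ennreal (std_normal_density x) ennpow s * ennreal (std_normal_density y) ennpow t) * (b ennpow s * c ennpow t)"
            using st by (simp add: ennpow_mult mult_ac)
          also have "ennreal \<kappa> ennpow s * ennreal \<kappa> ennpow t = ennreal \<kappa>"
            using st by (rule ennpow_add_self)
          also have "ennreal (std_normal_density x) ennpow s * ennreal (std_normal_density y) ennpow t =
              ennreal (exp (- (s * t * (x - y)\<^sup>2 / 2)) * std_normal_density (s * x + t * y))"
            using st(3) by (simp add: ennpow_product_ennreal normal_density_pos std_normal_density_power_product)
          also have "ennreal \<kappa> * ennreal (exp (- (s * t * (x - y)\<^sup>2 / 2)) * std_normal_density (s * x + t * y)) * (b ennpow s * c ennpow t)
            = ennreal (std_normal_density (s * x + t * y)) * (ennreal (\<kappa> * exp (- (s * t * (x - y)\<^sup>2 / 2))) * (b ennpow s * c ennpow t))"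
            using \<kappa> by (simp add: ennreal_mult mult_ac)
          also have "\<dots> \<le> ennreal (std_normal_density (s * x + t * y)) * A (u w + av + (s * x + t * y) *\<^sub>R j e)"
            using elim unfolding Q_def b_def c_def by (intro mult_left_mono) auto
          finally show ?case
            unfolding b_def c_def .
        qed
      qed
    qed measurable
    then have "(ennreal \<kappa> * smooth l e B (w + j h)) ennpow s * (ennreal \<kappa> * smooth l e C (w + j k)) ennpow t
        \<le> smooth l e A (w + j (s *\<^sub>R h + t *\<^sub>R k))"
      unfolding A B C by (simp add: nn_integral_cmult)
    moreover have "(ennreal \<kappa> * smooth l e B (w + j h)) ennpow s * (ennreal \<kappa> * smooth l e C (w + j k)) ennpow t
        = (ennreal \<kappa> ennpow s * ennreal \<kappa> ennpow t) * (smooth l e B (w + j h) ennpow s * smooth l e C (w + j k) ennpow t)"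
      using st by (simp add: ennpow_mult mult_ac)
    moreover have "ennreal \<kappa> ennpow s * ennreal \<kappa> ennpow t = ennreal \<kappa>"
      using st by (rule ennpow_add_self)
    ultimately have main: "ennreal \<kappa> * (smooth l e B (w + j h) ennpow s * smooth l e C (w + j k) ennpow t)
        \<le> smooth l e A (w + j (s *\<^sub>R h + t *\<^sub>R k))" by simp
    (* Projecting away \<open>e\<close> shortens \<open>h - k\<close>. *)
    have "exp (- (s * t * (norm (h - k))\<^sup>2 / 2)) \<le> \<kappa>"
    proof -
      have "(norm (h' - k'))\<^sup>2 \<le> (norm (h - k))\<^sup>2"
        using norm_split[of "e \<bullet> h" "e \<bullet> k"] by (simp add: h'_def k'_def)
      then have "s * t * (norm (h' - k'))\<^sup>2 \<le> s * t * (norm (h - k))\<^sup>2"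
        using st by (intro mult_left_mono) auto
      then show ?thesis by (simp add: \<kappa>_def)
    qed
    then have "ennreal (exp (- (s * t * (norm (h - k))\<^sup>2 / 2))) * (smooth l e B (w + j h) ennpow s * smooth l e C (w + j k) ennpow t)
        \<le> ennreal \<kappa> * (smooth l e B (w + j h) ennpow s * smooth l e C (w + j k) ennpow t)"
      by (intro mult_right_mono ennreal_leI) auto
    also note main
    finally show ?case .
  qed
qed

end

section \<open>Smoothing along finite orthonormal families\<close>

text \<open>
  Stability of the geometric mean under small defects, in a form that can be integrated: the right
  side is linear in \<open>d\<close> and \<open>d'\<close>. If \<open>d / \<beta> + d' / \<kappa> \<ge> 1\<close>, the defect term alone
  dominates the left side; otherwise the bound rests on \<open>z \<le> z\<^sup>r\<close> for \<open>z, r \<in> (0, 1]\<close>.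
\<close>

lemma ennpow_defect:
  assumes st: "s > 0" "t > 0" "s + t = 1" and pos: "\<beta> > 0" "\<kappa> > 0"
    and x: "ennreal \<beta> \<le> x + d" and y: "ennreal \<kappa> \<le> y + d'"
  shows "ennreal (\<beta> powr s * \<kappa> powr t) \<le>
    x ennpow s * y ennpow t + ennreal (\<beta> powr s * \<kappa> powr t) * (ennreal (1 / \<beta>) * d + ennreal (1 / \<kappa>) * d')"
proof (cases "ennreal (1 / \<beta>) * d + ennreal (1 / \<kappa>) * d' \<ge> 1")
  case True
  have "ennreal (\<beta> powr s * \<kappa> powr t) * 1 \<le> ennreal (\<beta> powr s * \<kappa> powr t) * (ennreal (1 / \<beta>) * d + ennreal (1 / \<kappa>) * d')"
    by (intro mult_left_mono True) auto
  then show ?thesis by (simp add: add_increasing)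
next
  case False
  then have fin: "ennreal (1 / \<beta>) * d < 1" "ennreal (1 / \<kappa>) * d' < 1"
    by (auto simp: not_le intro: le_less_trans[rotated])
  obtain u where u: "d = ennreal u" "u \<ge> 0"
    using fin(1) pos by (cases d) (auto simp: ennreal_mult_top)
  obtain v where v: "d' = ennreal v" "v \<ge> 0"
    using fin(2) pos by (cases d') (auto simp: ennreal_mult_top)
  have eq: "ennreal (1 / \<beta>) * d = ennreal (u / \<beta>)" "ennreal (1 / \<kappa>) * d' = ennreal (v / \<kappa>)"
    using u v pos by (auto simp: ennreal_mult[symmetric])
  have lt: "u / \<beta> < 1" "v / \<kappa> < 1"
    using fin u v pos unfolding eq by (auto simp: ennreal_less_one_iff)
  have sub: "ennreal (\<beta> - u) \<le> x"
  proof (cases x)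
    case (real r)
    with x u pos have "\<beta> \<le> r + u" by (simp add: ennreal_plus[symmetric] ennreal_le_iff del: ennreal_plus)
    with real show ?thesis by (simp add: ennreal_le_iff)
  qed simp
  have sub': "ennreal (\<kappa> - v) \<le> y"
  proof (cases y)
    case (real r)
    with y v pos have "\<kappa> \<le> r + v" by (simp add: ennreal_plus[symmetric] ennreal_le_iff del: ennreal_plus)
    with real show ?thesis by (simp add: ennreal_le_iff)
  qed simp
  have gt: "\<beta> - u > 0" "\<kappa> - v > 0"
    using lt pos by (auto simp: field_simps)
  have le_powr: "z \<le> z powr r" if "0 < z" "z \<le> 1" "0 < r" "r \<le> 1" for z r :: real
    using that powr_mono'[of r 1 z] by simp
  define K where "K = \<beta> powr s * \<kappa> powr t"
  have "K * (1 - (u / \<beta> + v / \<kappa>)) \<le> K * ((1 - u / \<beta>) * (1 - v / \<kappa>))"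
  proof (intro mult_left_mono)
    have "0 \<le> u / \<beta> * (v / \<kappa>)" using u v pos by simp
    then show "1 - (u / \<beta> + v / \<kappa>) \<le> (1 - u / \<beta>) * (1 - v / \<kappa>)"
      by (simp add: algebra_simps)
  qed (simp add: K_def)
  also have "\<dots> \<le> K * ((1 - u / \<beta>) powr s * (1 - v / \<kappa>) powr t)"
    using lt u v pos st by (intro mult_left_mono mult_mono le_powr) (auto simp: K_def)
  also have "\<dots> = (\<beta> * (1 - u / \<beta>)) powr s * (\<kappa> * (1 - v / \<kappa>)) powr t"
    using lt pos by (simp add: K_def powr_mult)
  also have "\<beta> * (1 - u / \<beta>) = \<beta> - u"
    using pos by (simp add: right_diff_distrib)
  also have "\<kappa> * (1 - v / \<kappa>) = \<kappa> - v"
    using pos by (simp add: right_diff_distrib)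
  finally have "K \<le> (\<beta> - u) powr s * (\<kappa> - v) powr t + K * (u / \<beta> + v / \<kappa>)"
    by (simp add: algebra_simps)
  then have "ennreal K \<le> ennreal ((\<beta> - u) powr s * (\<kappa> - v) powr t) + ennreal (K * (u / \<beta> + v / \<kappa>))"
    using u v pos by (simp add: ennreal_plus[symmetric] ennreal_leI K_def del: ennreal_plus)
  also have "ennreal ((\<beta> - u) powr s * (\<kappa> - v) powr t) = ennreal (\<beta> - u) ennpow s * ennreal (\<kappa> - v) ennpow t"
    using gt by (simp add: ennpow_product_ennreal)
  also have "\<dots> \<le> x ennpow s * y ennpow t"
    using st sub sub' by (intro mult_mono ennpow_mono) auto
  also have "ennreal (K * (u / \<beta> + v / \<kappa>)) = ennreal K * (ennreal (u / \<beta>) + ennreal (v / \<kappa>))"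
    using u v pos by (simp add: ennreal_mult ennreal_plus K_def)
  finally show ?thesis
    unfolding eq K_def by (simp add: add_right_mono)
qed

context abstract_wiener_space
begin

fun orthonormal_pairs :: "(('w \<Rightarrow> real) \<times> 'h) list \<Rightarrow> bool" where
  "orthonormal_pairs [] \<longleftrightarrow> True"
| "orthonormal_pairs ((l, e) # ps) \<longleftrightarrow>
     dual_pair l e \<and> norm e = 1 \<and> (\<forall>p\<in>set ps. fst p (j e) = 0) \<and> orthonormal_pairs ps"

lemma orthonormal_pairs_dual: "orthonormal_pairs ps \<Longrightarrow> p \<in> set ps \<Longrightarrow> dual_pair (fst p) (snd p)"
  by (induction ps rule: orthonormal_pairs.induct) auto

text \<open>
  The Gram-Schmidt step. The subtracted part is recorded only through the fact that it is a function
  of the coordinates in \<open>ps\<close>.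
\<close>

lemma orthogonal_residual:
  assumes "orthonormal_pairs ps" "m \<in> dual_space"
  shows "\<exists>m'\<in>dual_space. (\<forall>p\<in>set ps. m' (j (snd p)) = 0) \<and> depends_only_on (fst ` set ps) (\<lambda>w. m w - m' w)"
  using assms
proof (induction ps)
  case Nil
  then show ?case by (intro bexI[of _ m]) (auto simp: depends_only_on_def)
next
  case (Cons p ps)
  obtain l e where p: "p = (l, e)" by fastforce
  from Cons p have le: "dual_pair l e" and e: "norm e = 1" and orth: "\<forall>p\<in>set ps. fst p (j e) = 0"
    and ps: "orthonormal_pairs ps" by auto
  obtain m' where m': "m' \<in> dual_space" "\<forall>p\<in>set ps. m' (j (snd p)) = 0"
    "depends_only_on (fst ` set ps) (\<lambda>w. m w - m' w)"
    using Cons.IH[OF ps Cons.prems(2)] by blast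
  define c where "c = m' (j e)"
  have "e \<bullet> e = 1" using e by (simp add: power2_norm_eq_inner[symmetric])
  then have le1: "l (j e) = 1" by (simp add: dual_pairD(3)[OF le])
  have l0: "l (j (snd p)) = 0" if "p \<in> set ps" for p
    using orth that dual_pairD(3)[OF orthonormal_pairs_dual[OF ps that], of e]
    by (simp add: dual_pairD(3)[OF le] inner_commute)
  show ?case
  proof (intro bexI[of _ "\<lambda>w. m' w - c * l w"] conjI)
    show "(\<lambda>w. m' w - c * l w) \<in> dual_space"
      by (intro dual_space_diff dual_space_scale m'(1) dual_pairD(1)[OF le])
    show "\<forall>q\<in>set (p # ps). m' (j (snd q)) - c * l (j (snd q)) = 0"
      using m'(2) l0 le1 by (auto simp: p c_def)
    show "depends_only_on (fst ` set (p # ps)) (\<lambda>w. m w - (m' w - c * l w))"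
    proof (rule depends_only_onI)
      fix w w' assume eq: "\<And>n. n \<in> fst ` set (p # ps) \<Longrightarrow> n w = n w'"
      have "m w - m' w = m w' - m' w'"
        by (rule depends_only_onD[OF m'(3)]) (simp add: eq)
      moreover have "l w = l w'" by (rule eq) (simp add: p)
      ultimately show "m w - (m' w - c * l w) = m w' - (m' w' - c * l w')" by simp
    qed
  qed
qed

theorem Gram_Schmidt_dual:
  assumes "finite L" "L \<subseteq> dual_space"
  shows "\<exists>ps. orthonormal_pairs ps \<and> (\<forall>m\<in>L. depends_only_on (fst ` set ps) m)"
  using assms
proof (induction L)
  case empty
  have "orthonormal_pairs []" by simp
  then show ?case by blast
next
  case (insert m L)
  from insert.prems have "L \<subseteq> dual_space" by blast
  then obtain ps where ps: "orthonormal_pairs ps" "\<forall>m\<in>L. depends_only_on (fst ` set ps) m"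
    using insert.IH by blast
  obtain m' where m': "m' \<in> dual_space" "\<forall>p\<in>set ps. m' (j (snd p)) = 0"
    "depends_only_on (fst ` set ps) (\<lambda>w. m w - m' w)"
    using orthogonal_residual[OF ps(1), of m] insert.prems by blast
  obtain f where f: "dual_pair m' f" using ex_dual_pair[OF m'(1)] .
  show ?case
  proof (cases "f = 0")
    case True
    then have "m' w = 0" for w using dual_pair_zero_iff f by blast
    then have "depends_only_on (fst ` set ps) m" using m'(3) by simp
    with ps show ?thesis by blast
  next
    case False
    define l where "l = (\<lambda>w. 1 / norm f * m' w)"
    define e where "e = (1 / norm f) *\<^sub>R f"
    have le: "dual_pair l e"
      using dual_pair_combine[OF f f, of "1 / norm f" 0] by (simp add: l_def e_def)
    have e: "norm e = 1" using False by (simp add: e_def)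
    have "fst p (j e) = 0" if "p \<in> set ps" for p
    proof -
      have "f \<bullet> snd p = 0" using m'(2) that dual_pairD(3)[OF f] by simp
      then show ?thesis
        by (simp add: dual_pairD(3)[OF orthonormal_pairs_dual[OF ps(1) that]] e_def inner_commute)
    qed
    then have ortho: "orthonormal_pairs ((l, e) # ps)" using le e ps(1) by auto
    have "depends_only_on (fst ` set ((l, e) # ps)) m"
    proof (rule depends_only_onI)
      fix w w' assume eq: "\<And>n. n \<in> fst ` set ((l, e) # ps) \<Longrightarrow> n w = n w'"
      have "m w - m' w = m w' - m' w'"
        by (rule depends_only_onD[OF m'(3)]) (simp add: eq)
      moreover have "l w = l w'" by (rule eq) simp
      then have "m' w = m' w'" using False by (simp add: l_def)
      ultimately show "m w = m w'" by simp
    qed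
    moreover have "depends_only_on (fst ` set ((l, e) # ps)) n" if "n \<in> L" for n
      by (rule depends_only_on_mono[of "fst ` set ps"]) (use ps(2) that in auto)
    ultimately show ?thesis using ortho by (intro exI[of _ "(l, e) # ps"]) simp
  qed
qed

fun smooth_list :: "(('w \<Rightarrow> real) \<times> 'h) list \<Rightarrow> ('w \<Rightarrow> ennreal) \<Rightarrow> 'w \<Rightarrow> ennreal" where
  "smooth_list [] f = f"
| "smooth_list ((l, e) # ps) f = smooth_list ps (smooth l e f)"

lemma borel_measurable_smooth_list:
  "orthonormal_pairs ps \<Longrightarrow> f \<in> borel_measurable borel \<Longrightarrow> smooth_list ps f \<in> borel_measurable borel"
  by (induction ps f rule: smooth_list.induct) (auto intro: borel_measurable_smooth dual_pairD(1))

lemma nn_integral_smooth_list: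
  "orthonormal_pairs ps \<Longrightarrow> f \<in> borel_measurable borel \<Longrightarrow> (\<integral>\<^sup>+w. smooth_list ps f w \<partial>\<mu>) = (\<integral>\<^sup>+w. f w \<partial>\<mu>)"
  by (induction ps f rule: smooth_list.induct) (auto simp: nn_integral_smooth borel_measurable_smooth dual_pairD(1))

lemma smooth_list_mono: "(\<And>w. f w \<le> g w) \<Longrightarrow> smooth_list ps f w \<le> smooth_list ps g w"
  by (induction ps f arbitrary: g rule: smooth_list.induct) (auto intro: smooth_mono)

lemma smooth_list_add:
  assumes "orthonormal_pairs ps" "f \<in> borel_measurable borel" "g \<in> borel_measurable borel"
  shows "smooth_list ps (\<lambda>w. f w + g w) w = smooth_list ps f w + smooth_list ps g w"
  using assms
proof (induction ps f arbitrary: g rule: smooth_list.induct)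
  case (2 l e ps f)
  then have le: "l \<in> dual_space" and ps: "orthonormal_pairs ps" by (auto intro: dual_pairD(1))
  then have "smooth l e (\<lambda>w. f w + g w) = (\<lambda>w. smooth l e f w + smooth l e g w)"
    using 2 by (intro ext smooth_add) auto
  moreover have "smooth_list ps (\<lambda>w. smooth l e f w + smooth l e g w) w =
      smooth_list ps (smooth l e f) w + smooth_list ps (smooth l e g) w"
    using 2 le ps by (intro "2.IH" borel_measurable_smooth) auto
  ultimately show ?case by simp
qed simp

lemma PL_condition_smooth_list:
  assumes st: "s > 0" "t > 0" "s + t = 1"
    and "A \<in> borel_measurable borel" "B \<in> borel_measurable borel" "C \<in> borel_measurable borel"
    and "PL_condition s t A B C" "orthonormal_pairs ps"
  shows "PL_condition s t (smooth_list ps A) (smooth_list ps B) (smooth_list ps C)"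
  using assms(4-)
proof (induction ps arbitrary: A B C)
  case (Cons p ps)
  obtain l e where p: "p = (l, e)" by fastforce
  with Cons.prems have le: "dual_pair l e" "norm e = 1" "orthonormal_pairs ps" by auto
  have "PL_condition s t (smooth l e A) (smooth l e B) (smooth l e C)"
    using Cons.prems le st by (intro PL_condition_smooth) auto
  then show ?case
    unfolding p smooth_list.simps using Cons.prems le
    by (intro Cons.IH borel_measurable_smooth) (auto intro: dual_pairD(1))
qed simp

text \<open>
  Each smoothing removes one coordinate from those the function depends on; orthogonality keeps the
  remaining coordinates untouched. At the end nothing is left, and the constant is the integral
  because smoothing preserves integrals.
\<close>

lemma smooth_list_cylinder:
  assumes ps: "orthonormal_pairs ps" and f: "f \<in> borel_measurable borel" and dep: "depends_only_on (fst ` set ps) f"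
  shows "smooth_list ps f w = (\<integral>\<^sup>+w. f w \<partial>\<mu>)"
proof -
  have "depends_only_on {} (smooth_list ps f)"
    using ps dep
  proof (induction ps f rule: smooth_list.induct)
    case (2 l e ps f)
    then have le: "dual_pair l e" "norm e = 1" "orthonormal_pairs ps" "\<forall>p\<in>set ps. fst p (j e) = 0" by auto
    have "depends_only_on (fst ` set ps) (smooth l e f)"
    proof (rule depends_only_on_smooth[OF le(1,2)])
      show "linear m \<and> m (j e) = 0" if "m \<in> fst ` set ps" for m
        using that le(4) dual_pairD(2)[OF orthonormal_pairs_dual[OF le(3)]] by auto
      show "depends_only_on (insert l (fst ` set ps)) f" using 2(3) by simp
    qed
    with 2(1)[OF le(3)] show ?case by simp
  qed simp
  then have const: "smooth_list ps f v = smooth_list ps f w" for v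
    by (rule depends_only_onD) simp
  have "(\<integral>\<^sup>+w. f w \<partial>\<mu>) = (\<integral>\<^sup>+v. smooth_list ps f v \<partial>\<mu>)"
    by (rule nn_integral_smooth_list[OF ps f, symmetric])
  also have "\<dots> = (\<integral>\<^sup>+v. smooth_list ps f w \<partial>\<mu>)"
    by (intro nn_integral_cong const)
  also have "\<dots> = smooth_list ps f w" by (simp add: emeasure_space_1)
  finally show ?thesis by simp
qed

text \<open>
  Only one-sided closeness is needed, so the approximation error can be carried as a nonnegative
  function \<open>d\<close> and no subtraction in \<open>[0, \<infinity>]\<close> occurs.
\<close>

lemma cylinder_approximation_from_below:
  assumes B [measurable]: "B \<in> borel_measurable borel" and \<beta>: "\<beta> > 0" "ennreal \<beta> < (\<integral>\<^sup>+w. B w \<partial>\<mu>)" and \<epsilon>: "\<epsilon> > 0"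
  obtains g d L where "g \<in> borel_measurable borel" "d \<in> borel_measurable borel" "finite L" "L \<subseteq> dual_space"
    "depends_only_on L g" "\<And>w. g w \<le> B w + d w" "(\<integral>\<^sup>+w. d w \<partial>\<mu>) \<le> ennreal \<epsilon>" "ennreal \<beta> \<le> (\<integral>\<^sup>+w. g w \<partial>\<mu>)"
proof -
  obtain M where M: "M > 0" "ennreal \<beta> < (\<integral>\<^sup>+w. min (B w) (ennreal M) \<partial>\<mu>)"
    using nn_integral_less_truncation[OF measurable_mu[OF B] \<beta>(2,1)] by blast
  define f where "f w = enn2real (min (B w) (ennreal M))" for w
  have f: "ennreal (f w) = min (B w) (ennreal M)" for w
    unfolding f_def by (intro ennreal_enn2real le_less_trans[OF min.cobounded2 ennreal_less_top])
  have f_le: "f w \<le> M" for w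
    using min.cobounded2[of "B w" "ennreal M"] M(1) by (simp add: f[symmetric] ennreal_le_iff)
  have f_ge: "0 \<le> f w" for w by (simp add: f_def)
  have [measurable]: "f \<in> borel_measurable borel" unfolding f_def[abs_def] by measurable
  define I where "I = (\<integral>\<^sup>+w. ennreal (f w) \<partial>\<mu>)"
  have I: "ennreal \<beta> < I" using M(2) by (simp add: I_def f)
  (* The approximation error must also fit into the gap between \<open>\<beta>\<close> and the truncated integral. *)
  have "\<exists>\<eta>>0. \<eta> \<le> \<epsilon> \<and> ennreal (\<beta> + \<eta>) \<le> I"
  proof (cases I)
    case (real i)
    with I \<beta> have "\<beta> < i" by (simp add: ennreal_less_iff)
    then show ?thesis using \<epsilon> real \<beta> by (intro exI[of _ "min \<epsilon> (i - \<beta>)"])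
        (auto simp: ennreal_plus[symmetric] ennreal_le_iff simp del: ennreal_plus)
  qed (use \<epsilon> in auto)
  then obtain \<eta> where \<eta>: "\<eta> > 0" "\<eta> \<le> \<epsilon>" "ennreal (\<beta> + \<eta>) \<le> I" by auto
  obtain g where g: "g \<in> trig_polynomials" "(\<integral>\<^sup>+w. ennreal \<bar>f w - g w\<bar> \<partial>\<mu>) \<le> ennreal \<eta>"
  proof (rule trig_polynomials_dense[OF frechet, of "{\<mu>}" f M \<eta>])
    show "finite_measure M" if "M \<in> {\<mu>}" for M using that finite_measure_axioms by simp
    show "sets M = sets borel" if "M \<in> {\<mu>}" for M using that sets_eq_borel by simp
  qed (use f_le f_ge \<eta> that in auto)
  note [measurable] = trig_polynomials_borel[OF g(1)]
  obtain L where L: "finite L" "L \<subseteq> dual_space" "depends_only_on L g"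
    using trig_polynomials_depend_on_finite[OF g(1)] .
  define d where "d w = ennreal \<bar>f w - g w\<bar>" for w
  have [measurable]: "d \<in> borel_measurable borel" unfolding d_def[abs_def] by measurable
  show thesis
  proof (rule that[of "\<lambda>w. ennreal (g w)" d L])
    show "depends_only_on L (\<lambda>w. ennreal (g w))"
      by (rule depends_only_onI) (metis depends_only_onD[OF L(3)])
    show "ennreal (g w) \<le> B w + d w" for w
    proof -
      have "ennreal (g w) \<le> ennreal (f w + \<bar>f w - g w\<bar>)" by (intro ennreal_leI) linarith
      also have "\<dots> = ennreal (f w) + d w" using f_ge by (simp add: d_def ennreal_plus)
      also have "\<dots> \<le> B w + d w" by (intro add_right_mono) (simp add: f)
      finally show ?thesis .
    qed
    show "(\<integral>\<^sup>+w. d w \<partial>\<mu>) \<le> ennreal \<epsilon>"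
      using g(2) \<eta>(2) by (auto simp: d_def intro: order_trans ennreal_leI)
    have "ennreal \<beta> + ennreal \<eta> \<le> I" using \<eta> \<beta> by (simp add: ennreal_plus[symmetric] del: ennreal_plus)
    also have "I \<le> (\<integral>\<^sup>+w. ennreal (g w) + d w \<partial>\<mu>)"
      unfolding I_def
    proof (intro nn_integral_mono)
      fix w
      have "ennreal (f w) \<le> ennreal (max 0 (g w) + \<bar>f w - g w\<bar>)" by (intro ennreal_leI) linarith
      also have "\<dots> = ennreal (g w) + d w" by (simp add: d_def ennreal_plus ennreal_max_0)
      finally show "ennreal (f w) \<le> ennreal (g w) + d w" .
    qed
    also have "\<dots> = (\<integral>\<^sup>+w. ennreal (g w) \<partial>\<mu>) + (\<integral>\<^sup>+w. d w \<partial>\<mu>)"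
      by (intro nn_integral_add measurable_mu) measurable
    also have "\<dots> \<le> (\<integral>\<^sup>+w. ennreal (g w) \<partial>\<mu>) + ennreal \<eta>"
      using g(2) by (intro add_left_mono) (simp add: d_def)
    finally show "ennreal \<beta> \<le> (\<integral>\<^sup>+w. ennreal (g w) \<partial>\<mu>)"
      by (simp add: ennreal_add_left_cancel_le add.commute)
  qed (use L in auto)
qed

text \<open>
  Smooth \<open>A\<close>, \<open>B\<close>, \<open>C\<close> along an orthonormal family that carries cylinder approximations of \<open>B\<close> and
  \<open>C\<close>. The smoothed \<open>B\<close> and \<open>C\<close> then exceed \<open>\<beta>\<close> and \<open>\<kappa>\<close> up to errors of small integral, and the
  condition at \<open>h = k = 0\<close> is a pointwise bound for the smoothed \<open>A\<close>. Its integral is that of \<open>A\<close>.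
\<close>

theorem Prekopa_Leindler_Wiener:
  assumes st: "s > 0" "t > 0" "s + t = 1"
    and A [measurable]: "A \<in> borel_measurable borel" and B [measurable]: "B \<in> borel_measurable borel"
    and C [measurable]: "C \<in> borel_measurable borel"
    and PL: "PL_condition s t A B C"
  shows "(\<integral>\<^sup>+w. B w \<partial>\<mu>) ennpow s * (\<integral>\<^sup>+w. C w \<partial>\<mu>) ennpow t \<le> (\<integral>\<^sup>+w. A w \<partial>\<mu>)"
proof (rule ennpow_product_le_if_below[OF st(1,2)])
  fix \<beta> \<kappa> :: real
  assume \<beta>: "\<beta> > 0" "ennreal \<beta> < (\<integral>\<^sup>+w. B w \<partial>\<mu>)" and \<kappa>: "\<kappa> > 0" "ennreal \<kappa> < (\<integral>\<^sup>+w. C w \<partial>\<mu>)"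
  define K where "K = \<beta> powr s * \<kappa> powr t"
  have K: "K > 0" using \<beta> \<kappa> by (simp add: K_def)
  show "ennreal (\<beta> powr s * \<kappa> powr t) \<le> (\<integral>\<^sup>+w. A w \<partial>\<mu>)"
    unfolding K_def[symmetric]
  proof (rule ennreal_le_epsilon)
    fix \<epsilon> :: real assume \<epsilon>: "\<epsilon> > 0"
    (* Error budgets chosen so that the two defect terms add up to \<open>\<epsilon>\<close>. *)
    have pos: "\<epsilon> * \<beta> / (2 * K) > 0" "\<epsilon> * \<kappa> / (2 * K) > 0"
      using \<epsilon> \<beta> \<kappa> K by auto
    obtain g d L where g: "g \<in> borel_measurable borel" "d \<in> borel_measurable borel" "finite L" "L \<subseteq> dual_space"
      "depends_only_on L g" "\<And>w. g w \<le> B w + d w" "(\<integral>\<^sup>+w. d w \<partial>\<mu>) \<le> ennreal (\<epsilon> * \<beta> / (2 * K))" "ennreal \<beta> \<le> (\<integral>\<^sup>+w. g w \<partial>\<mu>)"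
      using cylinder_approximation_from_below[OF B \<beta> pos(1)] by blast
    obtain g' d' L' where g': "g' \<in> borel_measurable borel" "d' \<in> borel_measurable borel" "finite L'" "L' \<subseteq> dual_space"
      "depends_only_on L' g'" "\<And>w. g' w \<le> C w + d' w" "(\<integral>\<^sup>+w. d' w \<partial>\<mu>) \<le> ennreal (\<epsilon> * \<kappa> / (2 * K))" "ennreal \<kappa> \<le> (\<integral>\<^sup>+w. g' w \<partial>\<mu>)"
      using cylinder_approximation_from_below[OF C \<kappa> pos(2)] by blast
    obtain ps where ps: "orthonormal_pairs ps" "\<forall>m\<in>L \<union> L'. depends_only_on (fst ` set ps) m"
      using Gram_Schmidt_dual[of "L \<union> L'"] g(3,4) g'(3,4) by auto
    define S where "S = smooth_list ps"
    have S_meas: "S f \<in> borel_measurable borel" "S f \<in> borel_measurable \<mu>" if "f \<in> borel_measurable borel" for f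
      using borel_measurable_smooth_list[OF ps(1) that] measurable_mu by (auto simp: S_def)
    have S_int: "(\<integral>\<^sup>+w. S f w \<partial>\<mu>) = (\<integral>\<^sup>+w. f w \<partial>\<mu>)" if "f \<in> borel_measurable borel" for f
      using nn_integral_smooth_list[OF ps(1) that] by (simp add: S_def)
    have dep: "depends_only_on (fst ` set ps) f" if f: "depends_only_on M f" and M: "M \<subseteq> L \<union> L'" for f :: "'w \<Rightarrow> ennreal" and M
    proof (rule depends_only_onI)
      fix w w' assume eq: "\<And>l. l \<in> fst ` set ps \<Longrightarrow> l w = l w'"
      have "m w = m w'" if "m \<in> M" for m
        using ps(2) M that eq by (intro depends_only_onD[of "fst ` set ps" m]) auto
      then show "f w = f w'" by (rule depends_only_onD[OF f])
    qed
    have lower_B: "ennreal \<beta> \<le> S B w + S d w" for w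
    proof -
      have "ennreal \<beta> \<le> S g w"
        using g(8) smooth_list_cylinder[OF ps(1) g(1) dep[OF g(5)]] by (simp add: S_def)
      also have "\<dots> \<le> S (\<lambda>w. B w + d w) w" unfolding S_def by (intro smooth_list_mono g(6))
      also have "\<dots> = S B w + S d w" unfolding S_def by (rule smooth_list_add[OF ps(1) B g(2)])
      finally show ?thesis .
    qed
    have lower_C: "ennreal \<kappa> \<le> S C w + S d' w" for w
    proof -
      have "ennreal \<kappa> \<le> S g' w"
        using g'(8) smooth_list_cylinder[OF ps(1) g'(1) dep[OF g'(5)]] by (simp add: S_def)
      also have "\<dots> \<le> S (\<lambda>w. C w + d' w) w" unfolding S_def by (intro smooth_list_mono g'(6))
      also have "\<dots> = S C w + S d' w" unfolding S_def by (rule smooth_list_add[OF ps(1) C g'(2)])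
      finally show ?thesis .
    qed
    have "PL_condition s t (S A) (S B) (S C)"
      unfolding S_def by (rule PL_condition_smooth_list[OF st A B C PL ps(1)])
    moreover have zero: "dual_pair (\<lambda>w. 0) 0"
      by (simp add: dual_pair_def dual_space_zero)
    ultimately have AE: "AE w in \<mu>. S B w ennpow s * S C w ennpow t \<le> S A w"
      using PL_conditionD[of s t "S A" "S B" "S C", OF _ zero zero] by simp
    note [measurable] = S_meas(2)[OF A] S_meas(2)[OF g(2)] S_meas(2)[OF g'(2)]
    have "ennreal K = (\<integral>\<^sup>+w. ennreal K \<partial>\<mu>)" by (simp add: emeasure_space_1)
    also have "\<dots> \<le> (\<integral>\<^sup>+w. S A w + ennreal K * (ennreal (1 / \<beta>) * S d w + ennreal (1 / \<kappa>) * S d' w) \<partial>\<mu>)"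
    proof (rule nn_integral_mono_AE)
      show "AE w in \<mu>. ennreal K \<le> S A w + ennreal K * (ennreal (1 / \<beta>) * S d w + ennreal (1 / \<kappa>) * S d' w)"
        using AE
      proof eventually_elim
        case (elim w)
        have "ennreal K \<le> S B w ennpow s * S C w ennpow t + ennreal K * (ennreal (1 / \<beta>) * S d w + ennreal (1 / \<kappa>) * S d' w)"
          unfolding K_def by (rule ennpow_defect[OF st \<beta>(1) \<kappa>(1) lower_B lower_C])
        also have "\<dots> \<le> S A w + ennreal K * (ennreal (1 / \<beta>) * S d w + ennreal (1 / \<kappa>) * S d' w)"
          by (intro add_right_mono elim)
        finally show ?case .
      qed
    qed
    also have "\<dots> = (\<integral>\<^sup>+w. A w \<partial>\<mu>) + ennreal K * (ennreal (1 / \<beta>) * (\<integral>\<^sup>+w. d w \<partial>\<mu>) + ennreal (1 / \<kappa>) * (\<integral>\<^sup>+w. d' w \<partial>\<mu>))"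
      using g(2) g'(2) by (simp add: nn_integral_add nn_integral_cmult S_int)
    also have "\<dots> \<le> (\<integral>\<^sup>+w. A w \<partial>\<mu>) + ennreal K * (ennreal (1 / \<beta>) * ennreal (\<epsilon> * \<beta> / (2 * K)) + ennreal (1 / \<kappa>) * ennreal (\<epsilon> * \<kappa> / (2 * K)))"
      by (intro add_left_mono mult_left_mono add_mono g g') auto
    also have "ennreal K * (ennreal (1 / \<beta>) * ennreal (\<epsilon> * \<beta> / (2 * K)) + ennreal (1 / \<kappa>) * ennreal (\<epsilon> * \<kappa> / (2 * K))) =
        ennreal (K * (1 / \<beta> * (\<epsilon> * \<beta> / (2 * K)) + 1 / \<kappa> * (\<epsilon> * \<kappa> / (2 * K))))"
      using \<beta>(1) \<kappa>(1) K \<epsilon> by (simp add: ennreal_mult[symmetric] ennreal_plus[symmetric] del: ennreal_plus)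
    also have "K * (1 / \<beta> * (\<epsilon> * \<beta> / (2 * K)) + 1 / \<kappa> * (\<epsilon> * \<kappa> / (2 * K))) = \<epsilon>"
      using \<beta>(1) \<kappa>(1) K by (simp add: field_simps)
    finally show "ennreal K \<le> (\<integral>\<^sup>+w. A w \<partial>\<mu>) + ennreal \<epsilon>" .
  qed
qed

end

section \<open>The inequality for log-concave densities\<close>

theorem theorem8:
  fixes j :: "'h::{real_inner, polish_space} \<Rightarrow> 'w::{real_vector, polish_space}"
    and \<mu> :: "'w measure"
    and a b c :: "'w \<Rightarrow> ennreal"
    and q :: "'w \<Rightarrow> real"
    and s t :: real
  assumes "abstract_wiener_space j \<mu>"
    and "a \<in> borel_measurable (completion \<mu>)"
    and "b \<in> borel_measurable (completion \<mu>)"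
    and "c \<in> borel_measurable (completion \<mu>)"
    and "s \<in> {0..1}" and "t \<in> {0..1}" and "s + t = 1"
    and "\<And>h k. AE w in \<mu>.
           a (w + j (s *\<^sub>R h + t *\<^sub>R k)) * ennreal (exp (- (1/2) * (norm (s *\<^sub>R h + t *\<^sub>R k))\<^sup>2))
           \<ge> ((b (w + j h) * ennreal (exp (- (1/2) * (norm h)\<^sup>2))) ennpow s)
             * ((c (w + j k) * ennreal (exp (- (1/2) * (norm k)\<^sup>2))) ennpow t)"
    and "H_log_concave_density j \<mu> q"
  defines "\<nu> \<equiv> density (completion \<mu>) (\<lambda>w. ennreal (q w))"
  shows "(\<integral>\<^sup>+w. a w \<partial>\<nu>) \<ge> ((\<integral>\<^sup>+w. b w \<partial>\<nu>) ennpow s) * ((\<integral>\<^sup>+w. c w \<partial>\<nu>) ennpow t)"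
proof -
  interpret abstract_wiener_space j \<mu> by fact
  note hyp = assms(8)
  have q_meas [measurable]: "q \<in> borel_measurable (completion \<mu>)"
    and q_lc: "\<And>h k s t. s \<ge> 0 \<Longrightarrow> t \<ge> 0 \<Longrightarrow> s + t = 1 \<Longrightarrow>
        AE w in \<mu>. (ennreal (q (w + j h)) ennpow s) * (ennreal (q (w + j k)) ennpow t) \<le> ennreal (q (w + j (s *\<^sub>R h + t *\<^sub>R k)))"
    using assms(9) by (auto simp: H_log_concave_density_def)
  consider "s = 0" "t = 1" | "s = 1" "t = 0" | "s > 0" "t > 0"
    using assms(5-7) by fastforce
  then show ?thesis
  proof cases
    case 1
    (* By \<open>0\<^sup>0 = \<infinity>\<^sup>0 = 1\<close> the hypothesis at \<open>h = k = 0\<close> is \<open>c \<le> a\<close>. *)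
    have "AE w in \<mu>. c w \<le> a w" using hyp[of 0 0] 1 by simp
    then have "AE w in \<nu>. c w \<le> a w"
      unfolding \<nu>_def by (subst AE_density) (auto dest: AE_completion elim: eventually_mono)
    then show ?thesis using 1 by (simp add: nn_integral_mono_AE)
  next
    case 2
    have "AE w in \<mu>. b w \<le> a w" using hyp[of 0 0] 2 by simp
    then have "AE w in \<nu>. b w \<le> a w"
      unfolding \<nu>_def by (subst AE_density) (auto dest: AE_completion elim: eventually_mono)
    then show ?thesis using 2 by (simp add: nn_integral_mono_AE)
  next
    case 3
    (* Borel versions with the density absorbed. *)
    have \<nu>_int: "\<exists>F\<in>borel_measurable borel. (AE w in \<mu>. f w * ennreal (q w) = F w) \<and> (\<integral>\<^sup>+w. f w \<partial>\<nu>) = (\<integral>\<^sup>+w. F w \<partial>\<mu>)"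
      if f [measurable]: "f \<in> borel_measurable (completion \<mu>)" for f
    proof -
      have "(\<lambda>w. f w * ennreal (q w)) \<in> borel_measurable (completion \<mu>)" by measurable
      from completion_ex_borel_measurable[OF this] obtain F where
        F: "F \<in> borel_measurable \<mu>" "AE w in \<mu>. f w * ennreal (q w) = F w" by blast
      have "(\<integral>\<^sup>+w. f w \<partial>\<nu>) = (\<integral>\<^sup>+w. ennreal (q w) * f w \<partial>completion \<mu>)"
        unfolding \<nu>_def by (rule nn_integral_density) measurable
      also have "\<dots> = (\<integral>\<^sup>+w. F w \<partial>\<mu>)"
        unfolding nn_integral_completion using F(2) by (intro nn_integral_cong_AE) (auto simp: mult.commute)
      finally show ?thesis
        using F measurable_cong_sets[OF sets_eq_borel refl] by blast
    qed
    obtain A where A: "A \<in> borel_measurable borel" "AE w in \<mu>. a w * ennreal (q w) = A w" "(\<integral>\<^sup>+w. a w \<partial>\<nu>) = (\<integral>\<^sup>+w. A w \<partial>\<mu>)"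
      using \<nu>_int[OF assms(2)] by blast
    obtain B where B: "B \<in> borel_measurable borel" "AE w in \<mu>. b w * ennreal (q w) = B w" "(\<integral>\<^sup>+w. b w \<partial>\<nu>) = (\<integral>\<^sup>+w. B w \<partial>\<mu>)"
      using \<nu>_int[OF assms(3)] by blast
    obtain C where C: "C \<in> borel_measurable borel" "AE w in \<mu>. c w * ennreal (q w) = C w" "(\<integral>\<^sup>+w. c w \<partial>\<nu>) = (\<integral>\<^sup>+w. C w \<partial>\<mu>)"
      using \<nu>_int[OF assms(4)] by blast
    have "PL_condition s t A B C"
      unfolding PL_condition_def
    proof (intro allI impI)
      fix l m h k assume lh: "dual_pair l h" and mk: "dual_pair m k"
      let ?E = "\<lambda>h :: 'h. exp (- (1/2) * (norm h)\<^sup>2)"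
      (* The Gaussian factors of the hypothesis combine to the weight of the condition. *)
      have weight: "?E h powr s * ?E k powr t = exp (- (s * t * (norm (h - k))\<^sup>2 / 2)) * ?E (s *\<^sub>R h + t *\<^sub>R k)"
        unfolding Gaussian_weight_identity[OF assms(7)]
        by (simp add: exp_powr_real exp_add[symmetric] field_simps)
      show "AE w in \<mu>. ennreal (exp (- (s * t * (norm (h - k))\<^sup>2 / 2))) * (B (w + j h) ennpow s * C (w + j k) ennpow t)
          \<le> A (w + j (s *\<^sub>R h + t *\<^sub>R k))"
        using hyp[of h k] q_lc[OF less_imp_le[OF 3(1)] less_imp_le[OF 3(2)] assms(7), of h k]
          AE_translate[OF dual_pair_combine[OF lh mk, of s t] A(2)] AE_translate[OF lh B(2)] AE_translate[OF mk C(2)]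
      proof eventually_elim
        case (elim w)
        define x y z where "x = a (w + j (s *\<^sub>R h + t *\<^sub>R k))" and "y = b (w + j h)" and "z = c (w + j k)"
        define p q1 q2 where "p = ennreal (q (w + j (s *\<^sub>R h + t *\<^sub>R k)))" and "q1 = ennreal (q (w + j h))" and "q2 = ennreal (q (w + j k))"
        define u where "u = ?E (s *\<^sub>R h + t *\<^sub>R k)"
        define r where "r = exp (- (s * t * (norm (h - k))\<^sup>2 / 2))"
        have u: "u > 0" by (simp add: u_def)
        have "ennreal (?E h) ennpow s * ennreal (?E k) ennpow t = ennreal (r * u)"
          unfolding r_def u_def by (simp only: ennpow_product_ennreal exp_gt_zero weight)
        then have "ennreal u * (ennreal r * (y ennpow s * z ennpow t)) =
            (y * ennreal (?E h)) ennpow s * (z * ennreal (?E k)) ennpow t"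
          using 3 by (simp add: ennpow_mult ennreal_mult r_def u_def mult_ac)
        also have "\<dots> \<le> ennreal u * x"
          using elim(1) by (simp add: x_def y_def z_def u_def mult.commute)
        finally have "ennreal r * (y ennpow s * z ennpow t) \<le> x"
          using u by (simp add: ennreal_mult_le_mult_iff)
        moreover have "q1 ennpow s * q2 ennpow t \<le> p"
          using elim(2) by (simp add: p_def q1_def q2_def)
        ultimately have "(ennreal r * (y ennpow s * z ennpow t)) * (q1 ennpow s * q2 ennpow t) \<le> x * p"
          by (rule mult_mono) auto
        then have "ennreal r * ((y * q1) ennpow s * (z * q2) ennpow t) \<le> x * p"
          using 3 by (simp add: ennpow_mult mult_ac)
        then show ?case
          using elim(3-5) by (simp add: x_def y_def z_def p_def q1_def q2_def r_def)
      qed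
    qed
    then show ?thesis
      unfolding A(3) B(3) C(3)
      by (rule Prekopa_Leindler_Wiener[OF 3 assms(7) A(1) B(1) C(1)])
  qed
qed

end
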